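(* The alternating group $A_5$ occurs infinitely often as a Galois group over $\mathbb{Q}$ with all nontrivial inertia groups of order $2$; that is, there exist infinitely many distinct Galois extensions $K/\mathbb{Q}$ (inside a fixed algebraic closure of $\mathbb{Q}$) with $\mathrm{Gal}(K/\mathbb{Q})\cong A_5$ such that every nontrivial inertia group at a (finite) prime of $K$ has order $2$. *)

theory Defs
  imports
    "HOL-Algebra.Algebraic_Closure_Type"
    "HOL-Algebra.Sym_Groups"
    "HOL-Algebra.Bij"
begin

(* Extensions of the rationals are represented as subsets of the complex numbers; the fixed
   algebraic closure of the rationals is the field of algebraic complex numbers. *)

abbreviation complex_ring :: "complex ring"
  where "complex_ring \<equiv> ring_of_type_algebra"

definition rat_closure :: "complex set"
  where "rat_closure = {x. algebraic x}"

definition subring_of :: "complex set \<Rightarrow> complex ring"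
  where "subring_of S = complex_ring \<lparr>carrier := S\<rparr>"

(* Automorphisms are extensional functions on K, as in BijGroup, so that distinct elements of
   the carrier are distinct as maps on K. *)
definition Gal :: "complex set \<Rightarrow> (complex \<Rightarrow> complex) monoid"
  where "Gal K = BijGroup K
    \<lparr>carrier := {\<sigma> \<in> Bij K. \<sigma> \<in> ring_hom (subring_of K) (subring_of K) \<and> (\<forall>q\<in>\<rat>. \<sigma> q = q)}\<rparr>"

definition finite_galois_ext :: "complex set \<Rightarrow> bool"
  where "finite_galois_ext K \<longleftrightarrow>
    subfield K complex_ring \<and> K \<subseteq> rat_closure \<and>
    ring.finite_dimension complex_ring \<rat> K \<and>
    {x \<in> K. \<forall>\<sigma>\<in>carrier (Gal K). \<sigma> x = x} = \<rat>"

definition ring_of_integers :: "complex set \<Rightarrow> complex set"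
  where "ring_of_integers K = {x \<in> K. algebraic_int x}"

definition finite_prime :: "complex set \<Rightarrow> complex set \<Rightarrow> bool"
  where "finite_prime K P \<longleftrightarrow> primeideal P (subring_of (ring_of_integers K)) \<and> P \<noteq> {0}"

definition decomposition_group :: "complex set \<Rightarrow> complex set \<Rightarrow> (complex \<Rightarrow> complex) set"
  where "decomposition_group K P = {\<sigma> \<in> carrier (Gal K). \<sigma> ` P = P}"

(* The kernel of the action of the decomposition group on the residue ring modulo P. *)
definition inertia_group :: "complex set \<Rightarrow> complex set \<Rightarrow> (complex \<Rightarrow> complex) set"
  where "inertia_group K P =
    {\<sigma> \<in> decomposition_group K P. \<forall>x\<in>ring_of_integers K. \<sigma> x - x \<in> P}"

end

theory Submission
  imports Defs
    "HOL-Computational_Algebra.Fundamental_Theorem_Algebra"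
    "Jordan_Normal_Form.Char_Poly"
begin

text \<open>The quintics \<open>f\<^sub>T = x\<^sup>5 - 10 x\<^sup>3 - T x\<^sup>2 + (25 - 3 T) x + 24 - 9 T\<close> form a pencil
  \<open>F - T g\<close> with \<open>g = x\<^sup>2 + 3 x + 9\<close> whose discriminant is the square of a polynomial in \<open>T\<close>.
  For \<open>T \<equiv> 1\<close> modulo \<open>190 = 2 \<cdot> 5 \<cdot> 19\<close> the Frobenius at 2 has no fixed root and neither has its square, which
  makes the Galois group transitive, and the Frobenius at 5 is a 3-cycle; hence the group is \<open>A\<^sub>5\<close>.
  The same congruence prevents three roots from coinciding modulo a prime of the splitting field. So an inertia
  group permutes the roots within classes of at most two elements, and the only nontrivial even permutation of this
  kind is a double transposition.

  For infinitely many primes \<open>p\<close> there is a specialization having exactly one factor \<open>p\<close> in \<open>f\<^sub>T(a)\<close>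
  at a multiple root \<open>a\<close> modulo \<open>p\<close>. The integers of the splitting field are then not reduced modulo \<open>p\<close>,
  which for a given number field occurs at finitely many primes only. Hence there are infinitely many splitting
  fields. Reduction takes place modulo prime ideals of the ring of all algebraic integers.\<close>

section \<open>Algebraic integers\<close>

text \<open>The map \<open>F / g\<close> of the projective line has degree 5. Its six finite
  critical points lie in pairs over three values of \<open>T\<close>, the zeros of
  \<open>disc_sqrt\<close>; the remaining branch point is infinity, where the ramification is 3, 1,
  1. An integer \<open>T\<close> reduces to infinity at no prime, so away from the primes 2, 5 and
  19, where the pencil degenerates, only double transpositions can occur as inertia.

  The arithmetic is arranged to avoid decomposition groups and factorization of ideals. One prime of
  the ring of all algebraic integers reduces roots, conjugates and auxiliary numbers together. The
  price is that a congruence \<open>x ^ q - \<sigma> x \<in> P\<close> is obtained for one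
  \<open>x\<close> at a time, with \<sigma> depending on \<open>x\<close>. For transitivity this
  suffices; for the 3-cycle an \<open>x\<close> is needed that records a whole permutation of the
  roots.

  Likewise, ramification at \<open>p\<close> is replaced by an element \<open>x\<close> such that
  \<open>p\<close> divides \<open>x ^ 2\<close> but not \<open>x\<close>. This is a property of the
  field alone, so it separates fields belonging to different \<open>T\<close>.\<close>

definition int_span :: "'s set \<Rightarrow> ('s \<Rightarrow> complex) \<Rightarrow> complex set"
  where "int_span S v = {z. \<exists>c :: 's \<Rightarrow> int. z = (\<Sum>s\<in>S. of_int (c s) * v s)}"

lemma int_span_add: "y \<in> int_span S v \<Longrightarrow> z \<in> int_span S v \<Longrightarrow> y + z \<in> int_span S v"
proof -
  assume "y \<in> int_span S v" "z \<in> int_span S v"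
  then obtain c d :: "'a \<Rightarrow> int" where "y = (\<Sum>s\<in>S. of_int (c s) * v s)" "z = (\<Sum>s\<in>S. of_int (d s) * v s)"
    unfolding int_span_def by auto
  then have "y + z = (\<Sum>s\<in>S. of_int (c s + d s) * v s)"
    by (simp add: sum.distrib distrib_right)
  then show ?thesis unfolding int_span_def by (intro CollectI exI[of _ "\<lambda>s. c s + d s"])
qed

lemma int_span_of_int_mult: "z \<in> int_span S v \<Longrightarrow> of_int k * z \<in> int_span S v"
proof -
  assume "z \<in> int_span S v"
  then obtain d :: "'a \<Rightarrow> int" where "z = (\<Sum>s\<in>S. of_int (d s) * v s)"
    unfolding int_span_def by auto
  then have "of_int k * z = (\<Sum>s\<in>S. of_int (k * d s) * v s)"
    by (simp add: sum_distrib_left mult.assoc)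
  then show ?thesis unfolding int_span_def by (intro CollectI exI[of _ "\<lambda>s. k * d s"])
qed

lemma int_span_0: "0 \<in> int_span S v"
  unfolding int_span_def by (intro CollectI exI[of _ "\<lambda>_. 0"]) simp

lemma int_span_sum: "(\<And>i. i \<in> I \<Longrightarrow> f i \<in> int_span S v) \<Longrightarrow> sum f I \<in> int_span S v"
  by (induction I rule: infinite_finite_induct) (auto intro: int_span_0 int_span_add)

lemma int_span_base: "finite S \<Longrightarrow> s \<in> S \<Longrightarrow> v s \<in> int_span S v"
  unfolding int_span_def
  by (intro CollectI exI[of _ "\<lambda>t. if t = s then 1 else 0"]) (simp add: if_distrib[of "\<lambda>x. x * _"] if_distrib[of of_int] sum.delta cong: if_cong)

lemma int_span_mult:
  assumes "\<And>s. s \<in> S \<Longrightarrow> x * v s \<in> int_span S v" "z \<in> int_span S v"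
  shows "x * z \<in> int_span S v"
proof -
  obtain d :: "'a \<Rightarrow> int" where "z = (\<Sum>s\<in>S. of_int (d s) * v s)"
    using assms(2) unfolding int_span_def by auto
  then have "x * z = (\<Sum>s\<in>S. of_int (d s) * (x * v s))"
    by (simp add: sum_distrib_left mult_ac)
  then show ?thesis by (simp add: assms(1) int_span_sum int_span_of_int_mult)
qed

text \<open>The matrix of multiplication by \<open>x\<close> on the module is an integer matrix with eigenvalue \<open>x\<close>.\<close>

lemma algebraic_int_if_int_span_stable:
  assumes S: "finite S" "t \<in> S" "v t \<noteq> 0"
    and st: "\<And>s. s \<in> S \<Longrightarrow> x * v s \<in> int_span S v"
  shows "algebraic_int x"
proof -
  obtain h where h: "bij_betw h {0..<card S} S"
    using ex_bij_betw_nat_finite[OF S(1)] by blast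
  let ?n = "card S"
  have "\<forall>s\<in>S. \<exists>c :: 'a \<Rightarrow> int. x * v s = (\<Sum>r\<in>S. of_int (c r) * v r)"
    using st unfolding int_span_def by blast
  then obtain c :: "'a \<Rightarrow> 'a \<Rightarrow> int" where c: "\<And>s. s \<in> S \<Longrightarrow> x * v s = (\<Sum>r\<in>S. of_int (c s r) * v r)"
    by metis
  define B where "B = mat ?n ?n (\<lambda>(i, j). c (h i) (h j))"
  define A :: "complex mat" where "A = map_mat of_int B"
  have A: "A \<in> carrier_mat ?n ?n" and B: "B \<in> carrier_mat ?n ?n"
    unfolding A_def B_def by auto
  have hS: "h i \<in> S" if "i < ?n" for i using h that unfolding bij_betw_def by auto
  have "eigenvector A (vec ?n (\<lambda>i. v (h i))) x"
    unfolding eigenvector_def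
  proof (intro conjI)
    show "vec ?n (\<lambda>i. v (h i)) \<in> carrier_vec (dim_row A)" using A by simp
    obtain i where i: "i < ?n" "h i = t" using h S(2) unfolding bij_betw_def by (metis atLeastLessThan_iff imageE)
    show "vec ?n (\<lambda>i. v (h i)) \<noteq> 0\<^sub>v (dim_row A)"
    proof
      assume "vec ?n (\<lambda>i. v (h i)) = 0\<^sub>v (dim_row A)"
      then have "vec ?n (\<lambda>i. v (h i)) $ i = 0\<^sub>v (dim_row A) $ i" by simp
      then show False using i S(3) A by simp
    qed
    show "A *\<^sub>v vec ?n (\<lambda>i. v (h i)) = x \<cdot>\<^sub>v vec ?n (\<lambda>i. v (h i))"
    proof (rule eq_vecI)
      fix i assume "i < dim_vec (x \<cdot>\<^sub>v vec ?n (\<lambda>i. v (h i)))"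
      then have i: "i < ?n" by simp
      have "(A *\<^sub>v vec ?n (\<lambda>i. v (h i))) $ i = (\<Sum>j = 0..<?n. of_int (c (h i) (h j)) * v (h j))"
        using i A by (simp add: scalar_prod_def A_def B_def)
      also have "\<dots> = (\<Sum>r\<in>S. of_int (c (h i) r) * v r)"
        by (rule sum.reindex_bij_betw[OF h])
      also have "\<dots> = x * v (h i)" using c[OF hS[OF i]] by simp
      finally show "(A *\<^sub>v vec ?n (\<lambda>i. v (h i))) $ i = (x \<cdot>\<^sub>v vec ?n (\<lambda>i. v (h i))) $ i"
        using i by simp
    qed (use A in simp)
  qed
  then have "eigenvalue A x" unfolding eigenvalue_def by blast
  then have "poly (char_poly A) x = 0" using eigenvalue_root_char_poly[OF A] by simp
  moreover have "char_poly A = map_poly of_int (char_poly B)"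
    unfolding A_def by (rule of_int_hom.char_poly_hom[OF B])
  moreover have "lead_coeff (char_poly B) = 1" using degree_monic_char_poly[OF B] by simp
  ultimately show ?thesis unfolding algebraic_int_altdef_ipoly by metis
qed

text \<open>A monic integral relation expresses \<open>x ^ n\<close> through lower powers.
  Positivity of \<open>n\<close> puts 1 among the generators, which supplies the nonzero entry for
  the eigenvector argument.\<close>

lemma algebraic_int_power_in_span:
  assumes "algebraic_int (x :: complex)"
  obtains n where "n > 0" "x ^ n \<in> int_span {..<n} (\<lambda>i. x ^ i)"
proof -
  obtain p where p: "poly (map_poly of_int p) x = 0" "lead_coeff p = 1"
    using assms unfolding algebraic_int_altdef_ipoly by blast
  let ?n = "degree p"
  have n: "?n > 0"
  proof (rule ccontr)
    assume "\<not> ?n > 0"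
    then have "p = 1" using p(2) by (metis degree_0_id gr0I one_pCons coeff_0_degree_minus_1 diff_0_eq_0 less_numeral_extra(3) monic_degree_0)
    then show False using p(1) by simp
  qed
  have "(\<Sum>i\<le>?n. of_int (coeff p i) * x ^ i) = 0"
    using p(1) by (simp add: poly_altdef degree_map_poly coeff_map_poly)
  then have "x ^ ?n = (\<Sum>i<?n. of_int (- coeff p i) * x ^ i)"
    using p(2) by (simp add: lessThan_Suc_atMost[symmetric] sum_negf add_eq_0_iff)
  then have "x ^ ?n \<in> int_span {..<?n} (\<lambda>i. x ^ i)" unfolding int_span_def by (intro CollectI exI)
  with n that show ?thesis by blast
qed

text \<open>The products \<open>x ^ i * y ^ j\<close> with exponents below the two degrees span a
  module stable under \<open>x\<close> and under \<open>y\<close>, hence under sum and product; an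
  exponent reaching its bound is lowered by the monic relation. The span is that of an indexed
  family because distinct exponents may give equal products.\<close>

lemma
  assumes "algebraic_int (x :: complex)" "algebraic_int y"
  shows algebraic_int_add: "algebraic_int (x + y)" and algebraic_int_mult: "algebraic_int (x * y)"
proof -
  obtain n where n: "n > 0" "x ^ n \<in> int_span {..<n} (\<lambda>i. x ^ i)"
    using algebraic_int_power_in_span[OF assms(1)] .
  obtain m where m: "m > 0" "y ^ m \<in> int_span {..<m} (\<lambda>i. y ^ i)"
    using algebraic_int_power_in_span[OF assms(2)] .
  define S where "S = {..<n} \<times> {..<m}"
  define v where "v = (\<lambda>(i, j). x ^ i * y ^ j)"
  have S: "finite S" "(0, 0) \<in> S" "v (0, 0) \<noteq> 0" using n(1) m(1) unfolding S_def v_def by auto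
  have base: "x ^ i * y ^ j \<in> int_span S v" if "i < n" "j < m" for i j
    using int_span_base[OF S(1), of "(i, j)" v] that unfolding S_def v_def by auto
  have X: "x * v s \<in> int_span S v" if s: "s \<in> S" for s
  proof -
    obtain i j where ij: "s = (i, j)" "i < n" "j < m" using s unfolding S_def by auto
    show ?thesis
    proof (cases "Suc i < n")
      case True
      then show ?thesis using base[OF True ij(3)] by (simp add: v_def ij(1) mult.assoc)
    next
      case False
      then have [simp]: "n = Suc i" using ij by simp
      obtain c :: "nat \<Rightarrow> int" where c: "x ^ n = (\<Sum>k<n. of_int (c k) * x ^ k)"
        using n(2) unfolding int_span_def by auto
      have "x * v s = x ^ n * y ^ j" by (simp add: v_def ij(1))
      also have "\<dots> = (\<Sum>k<n. of_int (c k) * (x ^ k * y ^ j))"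
        unfolding c sum_distrib_right by (simp add: mult.assoc)
      also have "\<dots> \<in> int_span S v"
        by (intro int_span_sum int_span_of_int_mult base) (use ij in auto)
      finally show ?thesis .
    qed
  qed
  have Y: "y * v s \<in> int_span S v" if s: "s \<in> S" for s
  proof -
    obtain i j where ij: "s = (i, j)" "i < n" "j < m" using s unfolding S_def by auto
    show ?thesis
    proof (cases "Suc j < m")
      case True
      then show ?thesis using base[OF ij(2) True] by (simp add: v_def ij(1) mult_ac)
    next
      case False
      then have [simp]: "m = Suc j" using ij by simp
      obtain c :: "nat \<Rightarrow> int" where c: "y ^ m = (\<Sum>k<m. of_int (c k) * y ^ k)"
        using m(2) unfolding int_span_def by auto
      have "y * v s = x ^ i * y ^ m" by (simp add: v_def ij(1))
      also have "\<dots> = (\<Sum>k<m. of_int (c k) * (x ^ i * y ^ k))"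
        unfolding c sum_distrib_left by (simp add: mult_ac)
      also have "\<dots> \<in> int_span S v"
        by (intro int_span_sum int_span_of_int_mult base) (use ij in auto)
      finally show ?thesis .
    qed
  qed
  show "algebraic_int (x + y)"
    by (rule algebraic_int_if_int_span_stable[where S = S and v = v, OF S(1-3)])
       (simp add: distrib_right int_span_add X Y)
  show "algebraic_int (x * y)"
    by (rule algebraic_int_if_int_span_stable[where S = S and v = v, OF S(1-3)])
       (simp add: mult.assoc int_span_mult X Y)
qed

lemma algebraic_int_diff: "algebraic_int (x :: complex) \<Longrightarrow> algebraic_int y \<Longrightarrow> algebraic_int (x - y)"
  using algebraic_int_add[of x "- y"] by simp

lemma algebraic_int_of_int: "algebraic_int (of_int k :: complex)"
  by (simp add: int_imp_algebraic_int)

lemma algebraic_int_power: "algebraic_int (x :: complex) \<Longrightarrow> algebraic_int (x ^ n)"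
  by (induction n) (auto intro: algebraic_int_mult)

lemma algebraic_int_sum:
  "(\<And>i. i \<in> I \<Longrightarrow> algebraic_int (f i :: complex)) \<Longrightarrow> algebraic_int (sum f I)"
  by (induction I rule: infinite_finite_induct) (auto intro: algebraic_int_add)

lemma algebraic_int_prod:
  "(\<And>i. i \<in> I \<Longrightarrow> algebraic_int (f i :: complex)) \<Longrightarrow> algebraic_int (prod f I)"
  by (induction I rule: infinite_finite_induct) (auto intro: algebraic_int_mult)

lemmas algebraic_int_closed = algebraic_int_add algebraic_int_mult algebraic_int_diff
  algebraic_int_of_int algebraic_int_power algebraic_int_sum algebraic_int_prod

section \<open>Homomorphisms between subfields of the complex numbers\<close>

lemma complex_ring_simps [simp]:
  "carrier complex_ring = UNIV" "x \<otimes>\<^bsub>complex_ring\<^esub> y = x * y" "x \<oplus>\<^bsub>complex_ring\<^esub> y = x + y"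
  "\<zero>\<^bsub>complex_ring\<^esub> = 0" "\<one>\<^bsub>complex_ring\<^esub> = 1"
  by (simp_all add: ring_of_type_algebra_def)

lemma field_complex_ring: "field complex_ring"
  by (rule field_from_type_algebra)

interpretation CC: domain complex_ring
  using field_complex_ring by (rule field.axioms(1))

lemma complex_ring_a_inv [simp]: "\<ominus>\<^bsub>complex_ring\<^esub> x = - x"
  using CC.add.inv_equality[of "- x" x] by (simp add: a_inv_def)

lemma complex_ring_m_inv: "x \<noteq> 0 \<Longrightarrow> inv\<^bsub>complex_ring\<^esub> x = inverse x"
  using CC.inv_char[of x "inverse x"] by simp

lemma subfieldD:
  assumes "subfield F complex_ring"
  shows "0 \<in> F" "1 \<in> F" "x \<in> F \<Longrightarrow> y \<in> F \<Longrightarrow> x + y \<in> F" "x \<in> F \<Longrightarrow> y \<in> F \<Longrightarrow> x * y \<in> F"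
    "x \<in> F \<Longrightarrow> - x \<in> F" "x \<in> F \<Longrightarrow> y \<in> F \<Longrightarrow> x - y \<in> F" "x \<in> F \<Longrightarrow> inverse x \<in> F"
proof -
  note r = subfieldE(1)[OF assms]
  show 0: "0 \<in> F" and "1 \<in> F" using subringE(2,3)[OF r] by simp_all
  show *: "x \<in> F \<Longrightarrow> y \<in> F \<Longrightarrow> x + y \<in> F" for x y using subringE(7)[OF r] by simp
  show "x \<in> F \<Longrightarrow> y \<in> F \<Longrightarrow> x * y \<in> F" using subringE(6)[OF r] by simp
  show **: "x \<in> F \<Longrightarrow> - x \<in> F" for x using subringE(5)[OF r] by simp
  show "x \<in> F \<Longrightarrow> y \<in> F \<Longrightarrow> x - y \<in> F" using *[of x "- y"] ** by simp
  show "x \<in> F \<Longrightarrow> inverse x \<in> F"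
    using CC.subfield_m_inv(1)[OF assms, of x] 0 by (cases "x = 0") (auto simp: complex_ring_m_inv)
qed

lemma subfieldI_complex:
  assumes "1 \<in> F" "\<And>x y. x \<in> F \<Longrightarrow> y \<in> F \<Longrightarrow> x - y \<in> F"
    "\<And>x y. x \<in> F \<Longrightarrow> y \<in> F \<Longrightarrow> x * y \<in> F" "\<And>x. x \<in> F \<Longrightarrow> inverse x \<in> F"
  shows "subfield F complex_ring"
proof (rule field.subfieldI'[OF field_complex_ring])
  have 0: "0 \<in> F" using assms(2)[OF assms(1,1)] by simp
  have m: "- x \<in> F" if "x \<in> F" for x using assms(2)[OF 0 that] by simp
  show "subring F complex_ring"
    by (rule CC.subringI) (use assms m assms(2)[of _ "- _"] in auto)
  show "inv\<^bsub>complex_ring\<^esub> k \<in> F" if "k \<in> F - {\<zero>\<^bsub>complex_ring\<^esub>}" for k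
    using that assms(4) by (auto simp: complex_ring_m_inv)
qed

lemma subfield_Rats: "subfield \<rat> complex_ring"
  by (rule subfieldI_complex) auto

lemma subfield_sum:
  assumes "subfield F complex_ring" "\<And>i. i \<in> I \<Longrightarrow> f i \<in> F"
  shows "sum f I \<in> F"
  using assms(2) by (induction I rule: infinite_finite_induct) (auto intro: subfieldD[OF assms(1)])

lemma subfield_prod:
  assumes "subfield F complex_ring" "\<And>i. i \<in> I \<Longrightarrow> f i \<in> F"
  shows "prod f I \<in> F"
  using assms(2) by (induction I rule: infinite_finite_induct) (auto intro: subfieldD[OF assms(1)])

lemma subfield_power:
  assumes "subfield F complex_ring" "x \<in> F"
  shows "x ^ n \<in> F"
  using assms(2) by (induction n) (auto intro: subfieldD[OF assms(1)])

lemma subfield_of_int: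
  assumes "subfield F complex_ring"
  shows "of_int k \<in> F"
proof -
  have *: "of_nat n \<in> F" for n by (induction n) (auto intro: subfieldD[OF assms])
  show ?thesis by (cases k) (use * subfieldD(5)[OF assms] in \<open>auto simp del: of_nat_Suc\<close>)
qed

lemma Rats_subset_subfield:
  assumes "subfield F complex_ring"
  shows "\<rat> \<subseteq> F"
proof
  fix x :: complex assume "x \<in> \<rat>"
  then obtain a b where "x = of_int a / of_int b" by (auto elim: Rats_cases')
  then show "x \<in> F" by (auto simp: divide_inverse intro: subfieldD[OF assms] subfield_of_int[OF assms])
qed

section \<open>Polynomials with coefficients in a subfield, and minimal polynomials\<close>

definition polys_over :: "complex set \<Rightarrow> complex poly set"
  where "polys_over F = {p. \<forall>i. coeff p i \<in> F}"

context
  fixes F assumes F: "subfield F complex_ring"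
begin

lemma polys_over_add: "p \<in> polys_over F \<Longrightarrow> q \<in> polys_over F \<Longrightarrow> p + q \<in> polys_over F"
  unfolding polys_over_def by (auto intro: subfieldD[OF F])

lemma polys_over_diff: "p \<in> polys_over F \<Longrightarrow> q \<in> polys_over F \<Longrightarrow> p - q \<in> polys_over F"
  unfolding polys_over_def by (auto intro: subfieldD[OF F])

lemma polys_over_mult: "p \<in> polys_over F \<Longrightarrow> q \<in> polys_over F \<Longrightarrow> p * q \<in> polys_over F"
  unfolding polys_over_def by (auto simp: coeff_mult intro!: subfield_sum[OF F] subfieldD(4)[OF F])

lemma polys_over_1: "1 \<in> polys_over F"
  unfolding polys_over_def using subfieldD[OF F] by (auto simp: coeff_1)

lemma polys_over_prod: "(\<And>i. i \<in> I \<Longrightarrow> f i \<in> polys_over F) \<Longrightarrow> prod f I \<in> polys_over F"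
  by (induction I rule: infinite_finite_induct) (auto intro: polys_over_mult polys_over_1)

lemma polys_over_monom: "c \<in> F \<Longrightarrow> Polynomial.monom c n \<in> polys_over F"
  unfolding polys_over_def using subfieldD(1)[OF F] by auto

lemma polys_over_pCons: "c \<in> F \<Longrightarrow> p \<in> polys_over F \<Longrightarrow> pCons c p \<in> polys_over F"
  unfolding polys_over_def by (auto simp: coeff_pCons split: nat.split)

lemma polys_over_0: "0 \<in> polys_over F"
  unfolding polys_over_def using subfieldD(1)[OF F] by auto

lemma poly_in_subfield: "p \<in> polys_over F \<Longrightarrow> a \<in> F \<Longrightarrow> poly p a \<in> F"
  unfolding poly_altdef polys_over_def
  by (auto intro!: subfield_sum[OF F] subfieldD(4)[OF F] subfield_power[OF F])

lemma polys_over_division: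
  assumes "m \<in> polys_over F" "lead_coeff m = 1" "p \<in> polys_over F"
  shows "\<exists>q\<in>polys_over F. \<exists>r\<in>polys_over F. p = m * q + r \<and> (r = 0 \<or> degree r < degree m)"
  using assms(3)
proof (induction "degree p" arbitrary: p rule: less_induct)
  case less
  show ?case
  proof (cases "p = 0 \<or> degree p < degree m")
    case True
    then show ?thesis using less.prems polys_over_0 by (intro bexI[of _ 0] bexI[of _ p]) auto
  next
    case False
    define s where "s = Polynomial.monom (lead_coeff p) (degree p - degree m)"
    have s: "s \<in> polys_over F"
      unfolding s_def by (rule polys_over_monom) (use less.prems in \<open>auto simp: polys_over_def\<close>)
    define p' where "p' = p - m * s"
    have p': "p' \<in> polys_over F"
      unfolding p'_def by (intro polys_over_diff polys_over_mult assms less.prems s)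
    have m0: "m \<noteq> 0" using assms(2) by auto
    have lp: "lead_coeff p \<noteq> 0" and le: "degree m \<le> degree p" using False by auto
    have ds: "degree s = degree p - degree m"
      unfolding s_def by (rule Polynomial.degree_monom_eq[OF lp])
    have s0: "s \<noteq> 0" unfolding s_def monom_eq_0_iff by (rule lp)
    have d: "degree (m * s) = degree p" using degree_mult_eq[OF m0 s0] le ds by simp
    have "lead_coeff s = lead_coeff p" unfolding ds by (simp add: s_def)
    then have l: "lead_coeff (m * s) = lead_coeff p" using assms(2) unfolding lead_coeff_mult by simp
    have dp: "degree p' \<le> degree p" unfolding p'_def using d by (intro degree_diff_le) auto
    have z: "coeff p' (degree p) = 0" unfolding p'_def using l d by simp
    have "\<exists>q\<in>polys_over F. \<exists>r\<in>polys_over F. p' = m * q + r \<and> (r = 0 \<or> degree r < degree m)"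
    proof (cases "p' = 0")
      case True
      then show ?thesis using polys_over_0 by (intro bexI[of _ 0]) auto
    next
      case False
      then have "degree p' < degree p" using z dp by (metis le_neq_implies_less leading_coeff_0_iff)
      then show ?thesis using less.hyps p' by blast
    qed
    then obtain q r where qr: "q \<in> polys_over F" "r \<in> polys_over F" "p' = m * q + r" "r = 0 \<or> degree r < degree m"
      by blast
    then have "p = m * (q + s) + r" unfolding p'_def by (simp add: algebra_simps)
    then show ?thesis using qr polys_over_add[OF qr(1) s] by blast
  qed
qed

text \<open>The divisibility clause makes extensions of homomorphisms well defined. The degree
  clause yields separability: \<open>pderiv m\<close> has too small a degree to vanish at
  \<open>a\<close>.\<close>

lemma minimal_poly_over:
  assumes "p \<in> polys_over F" "p \<noteq> 0" "poly p a = 0"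
  obtains m where "m \<in> polys_over F" "lead_coeff m = 1" "poly m a = 0"
    "\<And>p. p \<in> polys_over F \<Longrightarrow> poly p a = 0 \<Longrightarrow> \<exists>q\<in>polys_over F. p = m * q"
    "\<And>p. p \<in> polys_over F \<Longrightarrow> poly p a = 0 \<Longrightarrow> p \<noteq> 0 \<Longrightarrow> degree m \<le> degree p"
proof -
  define Q where "Q p \<longleftrightarrow> p \<in> polys_over F \<and> p \<noteq> 0 \<and> poly p a = 0" for p
  obtain p0 where p0: "Q p0" "\<And>q. Q q \<Longrightarrow> degree p0 \<le> degree q"
    using exists_least_lemma[of "\<lambda>n. \<exists>p. Q p \<and> degree p = n"] assms
    by (metis Q_def ex_has_least_nat)
  define m where "m = Polynomial.smult (inverse (lead_coeff p0)) p0"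
  have m: "m \<in> polys_over F"
    using p0(1) unfolding m_def Q_def polys_over_def by (auto intro: subfieldD[OF F])
  have lm: "lead_coeff m = 1" "poly m a = 0" "degree m = degree p0"
    using p0(1) unfolding m_def Q_def by auto
  have "\<exists>q\<in>polys_over F. p = m * q" if p: "p \<in> polys_over F" "poly p a = 0" for p
  proof -
    obtain q r where qr: "q \<in> polys_over F" "r \<in> polys_over F" "p = m * q + r" "r = 0 \<or> degree r < degree m"
      using polys_over_division[OF m lm(1) p(1)] by blast
    have "poly r a = 0" using p(2) lm(2) unfolding qr(3) by simp
    then have "r = 0" using p0(2)[of r] qr(2,4) lm(3) unfolding Q_def by fastforce
    then show ?thesis using qr by auto
  qed
  with m lm p0(2) that show ?thesis unfolding Q_def by metis
qed

end

section \<open>Homomorphisms on a subfield and their extension\<close>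

definition hom_on :: "complex set \<Rightarrow> (complex \<Rightarrow> complex) \<Rightarrow> bool"
  where "hom_on F \<phi> \<longleftrightarrow> \<phi> 1 = 1 \<and> (\<forall>x\<in>F. \<forall>y\<in>F. \<phi> (x + y) = \<phi> x + \<phi> y \<and> \<phi> (x * y) = \<phi> x * \<phi> y)"

context
  fixes F \<phi> assumes F: "subfield F complex_ring" and \<phi>: "hom_on F \<phi>"
begin

lemma hom_on_1: "\<phi> 1 = 1"
  using \<phi> unfolding hom_on_def by simp

lemma hom_on_add: "x \<in> F \<Longrightarrow> y \<in> F \<Longrightarrow> \<phi> (x + y) = \<phi> x + \<phi> y"
  using \<phi> unfolding hom_on_def by simp

lemma hom_on_mult: "x \<in> F \<Longrightarrow> y \<in> F \<Longrightarrow> \<phi> (x * y) = \<phi> x * \<phi> y"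
  using \<phi> unfolding hom_on_def by simp

lemma hom_on_0: "\<phi> 0 = 0"
  using hom_on_add[of 0 0] subfieldD[OF F] by simp

lemma hom_on_minus: "x \<in> F \<Longrightarrow> \<phi> (- x) = - \<phi> x"
  using hom_on_add[of x "- x"] subfieldD[OF F] hom_on_0 by (simp add: eq_neg_iff_add_eq_0 add.commute)

lemma hom_on_diff: "x \<in> F \<Longrightarrow> y \<in> F \<Longrightarrow> \<phi> (x - y) = \<phi> x - \<phi> y"
  using hom_on_add[of x "- y"] hom_on_minus[of y] subfieldD[OF F] by simp

lemma hom_on_sum: "(\<And>i. i \<in> I \<Longrightarrow> f i \<in> F) \<Longrightarrow> \<phi> (sum f I) = (\<Sum>i\<in>I. \<phi> (f i))"
  by (induction I rule: infinite_finite_induct) (auto simp: hom_on_0 hom_on_add subfield_sum[OF F])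

lemma hom_on_prod: "(\<And>i. i \<in> I \<Longrightarrow> f i \<in> F) \<Longrightarrow> \<phi> (prod f I) = (\<Prod>i\<in>I. \<phi> (f i))"
  by (induction I rule: infinite_finite_induct) (auto simp: hom_on_1 hom_on_mult subfield_prod[OF F])

lemma hom_on_power: "x \<in> F \<Longrightarrow> \<phi> (x ^ n) = \<phi> x ^ n"
  by (induction n) (auto simp: hom_on_1 hom_on_mult subfield_power[OF F])

lemma hom_on_inverse: "x \<in> F \<Longrightarrow> \<phi> (inverse x) = inverse (\<phi> x)"
proof (cases "x = 0")
  case False
  assume "x \<in> F"
  then have "\<phi> x * \<phi> (inverse x) = 1"
    using hom_on_mult[of x "inverse x"] subfieldD[OF F] hom_on_1 False by simp
  then show ?thesis by (metis inverse_unique)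
qed (simp add: hom_on_0)

lemma hom_on_inj: "inj_on \<phi> F"
proof (rule inj_onI)
  fix x y assume xy: "x \<in> F" "y \<in> F" "\<phi> x = \<phi> y"
  show "x = y"
  proof (rule ccontr)
    assume "x \<noteq> y"
    then have "(x - y) * inverse (x - y) = 1" by simp
    then have "\<phi> (x - y) * \<phi> (inverse (x - y)) = 1"
      using hom_on_mult[of "x - y" "inverse (x - y)"] hom_on_1 xy by (simp add: subfieldD[OF F])
    then show False using hom_on_diff xy by simp
  qed
qed

lemma hom_on_of_int: "\<phi> (of_int k) = of_int k"
proof -
  have *: "\<phi> (of_nat n) = of_nat n" for n
    using subfield_of_int[OF F, of "int n" for n] subfieldD(2)[OF F]
    by (induction n) (auto simp: hom_on_0 hom_on_1 hom_on_add)
  show ?thesis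
    using * hom_on_minus[OF subfield_of_int[OF F, of "int n" for n]]
    by (cases k) (auto simp del: of_nat_Suc)
qed

lemma hom_on_Rats: "x \<in> \<rat> \<Longrightarrow> \<phi> x = x"
proof -
  assume "x \<in> \<rat>"
  then obtain a b where x: "x = of_int a / of_int b" by (auto elim: Rats_cases')
  show ?thesis
    unfolding x divide_inverse using subfieldD[OF F] subfield_of_int[OF F]
    by (simp add: hom_on_mult hom_on_inverse hom_on_of_int)
qed

lemma coeff_map_hom [simp]: "coeff (map_poly \<phi> p) i = \<phi> (coeff p i)"
  using hom_on_0 by (simp add: coeff_map_poly)

lemma map_hom_mult:
  "p \<in> polys_over F \<Longrightarrow> q \<in> polys_over F \<Longrightarrow> map_poly \<phi> (p * q) = map_poly \<phi> p * map_poly \<phi> q"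
  by (intro poly_eqI)
     (auto simp: coeff_mult polys_over_def hom_on_sum hom_on_mult subfieldD[OF F])

lemma map_hom_prod:
  "(\<And>i. i \<in> I \<Longrightarrow> f i \<in> polys_over F) \<Longrightarrow> map_poly \<phi> (prod f I) = (\<Prod>i\<in>I. map_poly \<phi> (f i))"
  by (induction I rule: infinite_finite_induct)
     (auto simp: map_hom_mult polys_over_prod[OF F] hom_on_1 map_poly_1)

lemma map_hom_add:
  "p \<in> polys_over F \<Longrightarrow> q \<in> polys_over F \<Longrightarrow> map_poly \<phi> (p + q) = map_poly \<phi> p + map_poly \<phi> q"
  by (intro poly_eqI) (auto simp: polys_over_def hom_on_add)

lemma map_hom_pCons: "map_poly \<phi> (pCons a p) = pCons (\<phi> a) (map_poly \<phi> p)"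
  by (intro poly_eqI) (auto simp: coeff_pCons split: nat.split)

lemma poly_map_hom:
  assumes "p \<in> polys_over F" "a \<in> F"
  shows "poly (map_poly \<phi> p) (\<phi> a) = \<phi> (poly p a)"
  using assms(1)
proof (induction p)
  case 0
  then show ?case by (simp add: hom_on_0)
next
  case (pCons c p)
  have "p \<in> polys_over F" "c \<in> F"
    using pCons.prems unfolding polys_over_def by (auto simp: coeff_pCons split: nat.splits dest: spec[of _ "Suc _"] spec[of _ 0])
  then show ?case
    using pCons.IH poly_in_subfield[OF F _ assms(2)] assms(2)
    by (simp add: map_hom_pCons hom_on_add hom_on_mult subfieldD[OF F])
qed

lemma map_hom_Rats: "p \<in> polys_over \<rat> \<Longrightarrow> map_poly \<phi> p = p"
  by (intro poly_eqI) (auto simp: polys_over_def hom_on_Rats)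

end

text \<open>The ring \<open>F[a]\<close>. It is the field generated by \<open>a\<close> as soon as
  \<open>a\<close> is algebraic, so polynomials represent all its elements and no quotients
  occur.\<close>

definition adjoin :: "complex set \<Rightarrow> complex \<Rightarrow> complex set"
  where "adjoin F a = (\<lambda>p. poly p a) ` polys_over F"

text \<open>The extension sends \<open>poly p a\<close> to the value at \<open>b\<close> of the
  transported polynomial. Two choices of \<open>p\<close> differ by a multiple of \<open>m\<close>,
  whose image vanishes at \<open>b\<close>, so the value depends on \<open>poly p a\<close>
  only.\<close>

lemma hom_on_extend_to:
  assumes F: "subfield F complex_ring" and \<phi>: "hom_on F \<phi>"
    and m: "m \<in> polys_over F" "\<And>p. p \<in> polys_over F \<Longrightarrow> poly p a = 0 \<Longrightarrow> \<exists>q\<in>polys_over F. p = m * q"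
    and b: "poly (map_poly \<phi> m) b = 0"
  obtains \<psi> where "hom_on (adjoin F a) \<psi>" "\<And>x. x \<in> F \<Longrightarrow> \<psi> x = \<phi> x" "\<psi> a = b"
proof -
  have *: "poly (map_poly \<phi> p) b = poly (map_poly \<phi> q) b"
    if pq: "p \<in> polys_over F" "q \<in> polys_over F" "poly p a = poly q a" for p q
  proof -
    have "poly (p - q) a = 0" using pq by simp
    then obtain r where r: "r \<in> polys_over F" "p - q = m * r"
      using m(2) polys_over_diff[OF F pq(1,2)] by blast
    have "map_poly \<phi> p = map_poly \<phi> (q + m * r)" using r(2) by (simp add: algebra_simps flip: r(2))
    also have "\<dots> = map_poly \<phi> q + map_poly \<phi> m * map_poly \<phi> r"
      using pq m(1) r(1) polys_over_mult[OF F] by (simp add: map_hom_add[OF F \<phi>] map_hom_mult[OF F \<phi>])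
    finally show ?thesis using b by simp
  qed
  define \<psi> where "\<psi> x = poly (map_poly \<phi> (SOME p. p \<in> polys_over F \<and> poly p a = x)) b" for x
  have \<psi>: "\<psi> (poly p a) = poly (map_poly \<phi> p) b" if "p \<in> polys_over F" for p
  proof -
    have "(SOME q. q \<in> polys_over F \<and> poly q a = poly p a) \<in> polys_over F \<and>
       poly (SOME q. q \<in> polys_over F \<and> poly q a = poly p a) a = poly p a"
      by (rule someI[of "\<lambda>q. q \<in> polys_over F \<and> poly q a = poly p a" p]) (use that in simp)
    then show ?thesis unfolding \<psi>_def using * that by blast
  qed
  have const: "\<psi> x = \<phi> x" if "x \<in> F" for x
  proof -
    have "[:x:] \<in> polys_over F" by (intro polys_over_pCons[OF F] polys_over_0[OF F] that)
    then show ?thesis using \<psi>[of "[:x:]"] by (simp add: map_hom_pCons[OF F \<phi>])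
  qed
  have "[:0, 1:] \<in> polys_over F"
    by (intro polys_over_pCons[OF F] polys_over_0[OF F] subfieldD(1,2)[OF F])
  then have "\<psi> a = b"
    using \<psi>[of "[:0, 1:]"] by (simp add: map_hom_pCons[OF F \<phi>] hom_on_0[OF F \<phi>] hom_on_1[OF F \<phi>])
  moreover have "hom_on (adjoin F a) \<psi>"
    unfolding hom_on_def
  proof (intro conjI ballI)
    show "\<psi> 1 = 1" using const subfieldD[OF F] hom_on_1[OF F \<phi>] by simp
    fix x y assume "x \<in> adjoin F a" "y \<in> adjoin F a"
    then obtain p q where pq: "p \<in> polys_over F" "q \<in> polys_over F" "x = poly p a" "y = poly q a"
      unfolding adjoin_def by auto
    show "\<psi> (x + y) = \<psi> x + \<psi> y"
      using pq \<psi>[of "p + q"] polys_over_add[OF F] by (simp add: \<psi> map_hom_add[OF F \<phi>])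
    show "\<psi> (x * y) = \<psi> x * \<psi> y"
      using pq \<psi>[of "p * q"] polys_over_mult[OF F] by (simp add: \<psi> map_hom_mult[OF F \<phi>])
  qed
  ultimately show ?thesis using const that by blast
qed

lemma adjoin_eq_simple_extension:
  assumes "subfield F complex_ring"
  shows "CC.simple_extension F a = adjoin F a"
proof (intro equalityI subsetI)
  fix x assume "x \<in> CC.simple_extension F a"
  then show "x \<in> adjoin F a"
  proof (induction rule: CC.simple_extension.induct)
    case zero
    have "poly 0 a = 0" by simp
    then show ?case unfolding adjoin_def using polys_over_0[OF assms] by force
  next
    case (lin k1 k2)
    then obtain p where "p \<in> polys_over F" "k1 = poly p a" unfolding adjoin_def by auto
    then have "pCons k2 p \<in> polys_over F" "k1 * a + k2 = poly (pCons k2 p) a"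
      using lin polys_over_pCons[OF assms] by (simp_all add: mult.commute)
    then show ?case unfolding adjoin_def complex_ring_simps by blast
  qed
next
  fix x assume "x \<in> adjoin F a"
  then obtain p where p: "p \<in> polys_over F" "x = poly p a" unfolding adjoin_def by auto
  have "poly p a \<in> CC.simple_extension F a" using p(1)
  proof (induction p)
    case 0
    then show ?case using CC.simple_extension.zero by simp
  next
    case (pCons c p)
    have "p \<in> polys_over F" "c \<in> F"
      using pCons.prems unfolding polys_over_def by (auto simp: coeff_pCons split: nat.splits dest: spec[of _ "Suc _"] spec[of _ 0])
    then show ?case using CC.simple_extension.lin[OF pCons.IH, of c] by (simp add: mult.commute add.commute)
  qed
  then show "x \<in> CC.simple_extension F a" using p(2) by simp
qed

section \<open>Even permutations of five points\<close>

text \<open>With \<open>k = 2\<close> this excludes a partition of five points into pairs.\<close>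

lemma dvd_card_of_equal_classes:
  assumes "finite A" "\<And>x. x \<in> A \<Longrightarrow> card {y \<in> A. f y = f x} = k"
  shows "k dvd card A"
proof -
  let ?C = "(\<lambda>x. {y \<in> A. f y = f x}) ` A"
  have "\<Union>?C = A" by auto
  moreover have "k dvd card (\<Union>?C)"
    by (rule dvd_partition) (use assms calculation in auto)
  ultimately show ?thesis by simp
qed

text \<open>The order of \<open>H\<close> is bounded below by 60. If the stabilizer of
  \<open>a\<close> moves \<open>b\<close>, then with the help of \<open>t\<close> it is transitive
  on the other four points, and \<open>H\<close> is doubly transitive. If it fixes \<open>b\<close>,
  the points with equal stabilizers form pairs, which is impossible for five points. Double
  transitivity gives 20 positions for the pair of \<open>a\<close> and \<open>b\<close>, and the
  three powers of \<open>t\<close> leave this pair fixed.\<close>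

lemma transitive_even_with_three_cycle:
  fixes H :: "(nat \<Rightarrow> nat) set"
  assumes sub: "\<And>g. g \<in> H \<Longrightarrow> g permutes {1..5} \<and> evenperm g"
    and id: "id \<in> H" and comp: "\<And>g h. g \<in> H \<Longrightarrow> h \<in> H \<Longrightarrow> g \<circ> h \<in> H"
    and inv: "\<And>g. g \<in> H \<Longrightarrow> inv' g \<in> H"
    and trans: "\<And>i j. i \<in> {1..5} \<Longrightarrow> j \<in> {1..5} \<Longrightarrow> \<exists>g\<in>H. g i = j"
    and t: "t \<in> H" "t a = a" "t b = b" "t c1 = c2" "t c2 = c3" "t c3 = c1"
    and d: "distinct [a, b, c1, c2, c3]" "{a, b, c1, c2, c3} = {1..5}"
  shows "H = carrier (alt_group 5)"
proof -
  have finA: "finite (carrier (alt_group 5))" unfolding alt_group_def sym_group_def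
    by (simp add: finite_permutations)
  have HA: "H \<subseteq> carrier (alt_group 5)" using sub by (auto simp: alt_group_carrier)
  have finH: "finite H" using finite_subset[OF HA finA] .
  have inj: "g x = g y \<longleftrightarrow> x = y" if "g \<in> H" for g x y
    using permutes_inj[of g] sub[OF that] by (auto simp: inj_def)
  have invl: "inv' g (g x) = x" "g (inv' g x) = x" if "g \<in> H" for g x
    using permutes_inverses[of g] sub[OF that] by auto
  have mem: "g x \<in> {1..5} \<longleftrightarrow> x \<in> {1..5}" if "g \<in> H" for g x
    using permutes_in_image[of g] sub[OF that] by blast
  have five: "x \<in> {1..5} \<longleftrightarrow> x = a \<or> x = b \<or> x = c1 \<or> x = c2 \<or> x = c3" for x
    unfolding d(2)[symmetric] by blast
  have abc: "a \<in> {1..5}" "b \<in> {1..5}" "c1 \<in> {1..5}" "c2 \<in> {1..5}" "c3 \<in> {1..5}" unfolding five by blast+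
  define S where "S i = {g \<in> H. g i = i}" for i
  have conj: "S (g i) = (\<lambda>h. g \<circ> h \<circ> inv' g) ` S i" if g: "g \<in> H" for g i
  proof (intro equalityI subsetI)
    fix x assume "x \<in> S (g i)"
    then have x: "x \<in> H" "x (g i) = g i" unfolding S_def by auto
    have "x = g \<circ> (inv' g \<circ> x \<circ> g) \<circ> inv' g" using invl[OF g] by auto
    moreover have "inv' g \<circ> x \<circ> g \<in> S i"
      unfolding S_def using comp inv x invl[OF g] g by auto
    ultimately show "x \<in> (\<lambda>h. g \<circ> h \<circ> inv' g) ` S i" by blast
  next
    fix x assume "x \<in> (\<lambda>h. g \<circ> h \<circ> inv' g) ` S i"
    then show "x \<in> S (g i)" using invl[OF g] g comp inv unfolding S_def by auto
  qed
  have cardS: "card (S i) = card (S j)" if ij: "i \<in> {1..5}" "j \<in> {1..5}" for i j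
  proof -
    obtain g where g: "g \<in> H" "g i = j" using trans[OF ij] by blast
    have "inj_on (\<lambda>h. g \<circ> h \<circ> inv' g) (S i)"
    proof (rule inj_onI)
      fix h k assume *: "g \<circ> h \<circ> inv' g = g \<circ> k \<circ> inv' g"
      show "h = k"
      proof
        fix x show "h x = k x" using fun_cong[OF *, of "g x"] invl[OF g(1)] inj[OF g(1)] by simp
      qed
    qed
    then show ?thesis using conj[OF g(1), of i] g(2) card_image by metis
  qed
  have two: "\<exists>h\<in>H. h a = a \<and> h b = j" if j: "j \<in> {1..5}" "j \<noteq> a" for j
  proof (cases "\<exists>h\<in>S a. h b \<in> {c1, c2, c3}")
    case True
    then obtain h where h: "h \<in> H" "h a = a" "h b \<in> {c1, c2, c3}" unfolding S_def by auto
    have "j \<in> {b, c1, c2, c3}" using j unfolding five by blast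
    moreover have "t \<circ> h \<in> H" "t \<circ> (t \<circ> h) \<in> H" "(t \<circ> h) a = a" "(t \<circ> (t \<circ> h)) a = a"
      using comp t h by auto
    moreover have "j = b \<or> j \<in> {h b, (t \<circ> h) b, (t \<circ> (t \<circ> h)) b}"
      using calculation(1) h(3) t by auto
    ultimately show ?thesis using h id t(1,2) by (metis id_apply insert_iff empty_iff)
  next
    case False
    have "h b = b" if h: "h \<in> S a" for h
    proof -
      have "h b \<in> {1..5}" using mem abc h unfolding S_def by blast
      moreover have "h b \<noteq> a" using inj[of h b a] h d(1) unfolding S_def by auto
      ultimately show ?thesis using False h unfolding five by blast
    qed
    then have "S a \<subseteq> S b" unfolding S_def by auto
    moreover have "finite (S b)" unfolding S_def using finH by simp
    ultimately have Sab: "S a = S b" using cardS[OF abc(1,2)] by (simp add: card_subset_eq)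
    \<comment> \<open>\<open>t\<close> fixes \<open>a\<close> and moves each of \<open>c1\<close>,
      \<open>c2\<close>, \<open>c3\<close>, so none of these shares the stabilizer of
      \<open>a\<close>, and the class of \<open>a\<close> is exactly the pair
      \<open>{a, b}\<close>.\<close>
    have "c1 \<noteq> c2" "c2 \<noteq> c3" "c3 \<noteq> c1" using d(1) by auto
    then have "t \<in> S a" "t \<notin> S c1" "t \<notin> S c2" "t \<notin> S c3" unfolding S_def mem_Collect_eq t(2-6) using t(1) by simp_all
    then have "S c1 \<noteq> S a" "S c2 \<noteq> S a" "S c3 \<noteq> S a" by auto
    then have cl: "{y \<in> {1..5}. S y = S a} = {a, b}" using Sab five by blast
    have "card {y \<in> {1..5}. S y = S i} = 2" if i: "i \<in> {1..5}" for i
    proof -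
      obtain g where g: "g \<in> H" "g a = i" using trans[OF abc(1) i] by blast
      \<comment> \<open>Conjugation by \<open>g\<close> carries stabilizers to stabilizers, so by
        transitivity every class has as many elements as that of \<open>a\<close>.\<close>
      have *: "S (g y) = S (g a) \<longleftrightarrow> S y = S a" for y
      proof
        assume e: "S (g y) = S (g a)"
        have "S (inv' g (g y)) = S (inv' g (g a))"
          unfolding conj[OF inv[OF g(1)]] e ..
        then show "S y = S a" using invl[OF g(1)] by simp
      qed (simp add: conj[OF g(1)])
      have "{y \<in> {1..5}. S y = S i} = g ` {y \<in> {1..5}. S y = S a}"
      proof (intro equalityI subsetI)
        fix y assume "y \<in> {y \<in> {1..5}. S y = S i}"
        then have "inv' g y \<in> {y \<in> {1..5}. S y = S a}"
          using *[of "inv' g y"] invl[OF g(1)] g(2) mem[OF inv[OF g(1)]] by auto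
        then show "y \<in> g ` {y \<in> {1..5}. S y = S a}" using invl[OF g(1)] by (metis imageI)
      qed (use * g mem[OF g(1)] in auto)
      then have "card {y \<in> {1..5}. S y = S i} = card (g ` {a, b})" using cl by simp
      also have "\<dots> = 2" using inj[OF g(1)] d(1) by auto
      finally show ?thesis .
    qed
    then have "2 dvd card {1..5::nat}" by (intro dvd_card_of_equal_classes[where f = S]) auto
    then show ?thesis by simp
  qed
  have "\<exists>g\<in>H. g a = i \<and> g b = j" if ij: "i \<in> {1..5}" "j \<in> {1..5}" "i \<noteq> j" for i j
  proof -
    obtain g where g: "g \<in> H" "g a = i" using trans[OF abc(1) ij(1)] by blast
    have "inv' g j \<in> {1..5}" using mem[OF inv[OF g(1)]] ij by blast
    moreover have "inv' g j \<noteq> a" using g ij invl[OF g(1)] by metis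
    ultimately obtain h where "h \<in> H" "h a = a" "h b = inv' g j" using two by blast
    then have "g \<circ> h \<in> H" "(g \<circ> h) a = i" "(g \<circ> h) b = j" using comp g invl[OF g(1)] by auto
    then show ?thesis by blast
  qed
  then obtain G where G: "\<And>i j. i \<in> {1..5} \<Longrightarrow> j \<in> {1..5} \<Longrightarrow> i \<noteq> j \<Longrightarrow> G i j \<in> H \<and> G i j a = i \<and> G i j b = j"
    by metis
  define Q where "Q = Sigma {1..5::nat} (\<lambda>i. {1..5} - {i})"
  define T where "T = {id, t, t \<circ> t}"
  have tne: "id c1 \<noteq> t c1" "id c1 \<noteq> (t \<circ> t) c1" "t c1 \<noteq> (t \<circ> t) c1" using t d(1) by auto
  then have "card T = 3" unfolding T_def by (subst card_3_iff) (metis (no_types))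
  moreover have "card Q = 20" unfolding Q_def by (simp add: card_SigmaI)
  ultimately have c60: "card (Q \<times> T) = 60" by (simp add: card_cartesian_product)
  define F :: "(nat \<times> nat) \<times> (nat \<Rightarrow> nat) \<Rightarrow> nat \<Rightarrow> nat"
    where "F = (\<lambda>((i, j), k). G i j \<circ> k)"
  \<comment> \<open>The images of \<open>a\<close> and \<open>b\<close> determine \<open>i\<close>
    and \<open>j\<close>; the image of \<open>c1\<close> then determines the power of
    \<open>t\<close>.\<close>
  have "inj_on F (Q \<times> T)"
  proof (rule inj_onI)
    fix x y assume xy: "x \<in> Q \<times> T" "y \<in> Q \<times> T" "F x = F y"
    obtain i j k where x: "x = ((i, j), k)" by (metis prod.exhaust)
    obtain i' j' k' where y: "y = ((i', j'), k')" by (metis prod.exhaust)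
    have q: "i \<in> {1..5}" "j \<in> {1..5}" "i \<noteq> j" "i' \<in> {1..5}" "j' \<in> {1..5}" "i' \<noteq> j'"
      and k: "k \<in> T" "k' \<in> T" using xy x y unfolding Q_def by auto
    have ab: "k a = a" "k' a = a" "k b = b" "k' b = b" using k t unfolding T_def by auto
    have e: "G i j (k z) = G i' j' (k' z)" for z using fun_cong[OF xy(3), of z] unfolding F_def x y by simp
    have "i = i'" "j = j'" using e[of a] e[of b] ab G[OF q(1-3)] G[OF q(4-6)] by auto
    moreover from this have "k c1 = k' c1" using e[of c1] inj[of "G i j"] G[OF q(1-3)] by simp
    then have "k = k'" using k tne unfolding T_def by auto
    ultimately show "x = y" unfolding x y by simp
  qed
  moreover have "F ` (Q \<times> T) \<subseteq> H"
  proof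
    fix x assume "x \<in> F ` (Q \<times> T)"
    then obtain i j k where x1: "x = G i j \<circ> k" "(i, j) \<in> Q" "k \<in> T"
      unfolding F_def by auto
    then have x: "x = G i j \<circ> k" "i \<in> {1..5}" "j \<in> {1..5}" "i \<noteq> j" "k \<in> T"
      unfolding Q_def by auto
    have "k \<in> H" using x(5) id t(1) comp unfolding T_def by auto
    then show "x \<in> H" using G[OF x(2-4)] comp x(1) by simp
  qed
  ultimately have "60 \<le> card H" using card_inj_on_le[OF _ _ finH] c60 by metis
  moreover have "card (carrier (alt_group 5)) = 60"
    using alt_group_card_carrier[of 5] by (simp add: fact_numeral)
  ultimately show ?thesis using card_seteq[OF finA HA] by simp
qed

text \<open>An even permutation preserving the classes of a relation all of whose classes have at most two
  elements is the identity or exchanges the elements of two classes, and there is only one way to do so.\<close>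

lemma even_class_preserving_unique:
  fixes p q :: "nat \<Rightarrow> nat"
  assumes p: "p permutes {1..5}" "evenperm p" "p \<noteq> id" and q: "q permutes {1..5}" "evenperm q" "q \<noteq> id"
    and E: "\<And>i. i \<in> {1..5} \<Longrightarrow> E (p i) i" "\<And>i. i \<in> {1..5} \<Longrightarrow> E (q i) i"
    and eq: "\<And>i j. E i j \<Longrightarrow> E j i" "\<And>i j k. E i j \<Longrightarrow> E j k \<Longrightarrow> E i k"
    and small: "\<And>i j k. {i, j, k} \<subseteq> {1..5} \<Longrightarrow> distinct [i, j, k] \<Longrightarrow> E i j \<Longrightarrow> E j k \<Longrightarrow> False"
  shows "p = q"
proof -
  have main: "\<exists>i j k l. distinct [i, j, k, l] \<and> {i, j, k, l} \<subseteq> {1..5} \<and>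
      r i = j \<and> r j = i \<and> r k = l \<and> r l = k"
    if r: "r permutes {1..5}" "evenperm r" "r \<noteq> id" "\<And>i. i \<in> {1..5} \<Longrightarrow> E (r i) i" for r :: "nat \<Rightarrow> nat"
  proof -
    have inj: "r x = r y \<longleftrightarrow> x = y" for x y using permutes_inj[OF r(1)] by (auto simp: inj_def)
    have mem: "r x \<in> {1..5} \<longleftrightarrow> x \<in> {1..5}" for x using permutes_in_image[OF r(1)] .
    have invol: "r (r i) = i" if i: "i \<in> {1..5}" "r i \<noteq> i" for i
    proof (rule ccontr)
      assume n: "r (r i) \<noteq> i"
      have "E (r (r i)) (r i)" "E (r i) i" using r(4) mem i by auto
      then show False using small[of "r (r i)" "r i" i] n i inj[of "r i" i] mem by auto
    qed
    obtain i where i: "r i \<noteq> i" using r(3) by (metis eq_id_iff)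
    then have i5: "i \<in> {1..5}" using r(1) unfolding permutes_def by blast
    \<comment> \<open>Otherwise \<open>r\<close> would move only \<open>i\<close> and
      \<open>r i\<close> and be a single transposition, which is odd.\<close>
    obtain k where k: "r k \<noteq> k" "k \<noteq> i" "k \<noteq> r i"
    proof (rule ccontr)
      assume "\<not> thesis"
      then have *: "r k = k" if "k \<noteq> i" "k \<noteq> r i" for k using that \<open>\<And>k. r k \<noteq> k \<Longrightarrow> k \<noteq> i \<Longrightarrow> k \<noteq> r i \<Longrightarrow> thesis\<close> by blast
      have "r = Transposition.transpose i (r i)"
      proof
        fix x show "r x = Transposition.transpose i (r i) x"
          using *[of x] invol[OF i5 i] by (auto simp: Transposition.transpose_def)
      qed
      then have "\<not> evenperm r" using evenperm_swap[of i "r i"] i by metis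
      then show False using r(2) by simp
    qed
    have k5: "k \<in> {1..5}" using r(1) k unfolding permutes_def by blast
    have "r k \<noteq> i" using invol[OF k5 k(1)] k by metis
    moreover have "r k \<noteq> r i" using inj k by simp
    ultimately have "distinct [i, r i, k, r k]" using i k by (metis distinct_length_2_or_more distinct_singleton)
    moreover have "{i, r i, k, r k} \<subseteq> {1..5}" using i5 k5 mem by blast
    ultimately show ?thesis using invol[OF i5 i] invol[OF k5 k(1)] by metis
  qed
  obtain i j k l where 1: "distinct [i, j, k, l]" "{i, j, k, l} \<subseteq> {1..5}" "p i = j" "p j = i" "p k = l" "p l = k"
    using main[OF p E(1)] by blast
  obtain i' j' k' l' where 2: "distinct [i', j', k', l']" "{i', j', k', l'} \<subseteq> {1..5}" "q i' = j'" "q j' = i'" "q k' = l'" "q l' = k'"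
    using main[OF q E(2)] by blast
  have un: "x = y" if "{x, y, z} \<subseteq> {1..5}" "E x z" "E y z" "x \<noteq> z" "y \<noteq> z" for x y z
    using small[of x z y] that eq(1) by auto
  have fixp: "x \<in> {1..5} \<Longrightarrow> x \<notin> {i, j, k, l} \<Longrightarrow> p x = x" for x
  proof -
    assume x: "x \<in> {1..5}" "x \<notin> {i, j, k, l}"
    have "card {x, i, j, k, l} = 5" using 1 x by auto
    then have "{x, i, j, k, l} = {1..5}" using card_subset_eq[of "{1..5}" "{x, i, j, k, l}"] 1 x by auto
    moreover have "p x \<in> {1..5}" using permutes_in_image[OF p(1)] x by blast
    moreover have "p x \<noteq> j" "p x \<noteq> i" "p x \<noteq> l" "p x \<noteq> k"
      using permutes_inj[OF p(1)] 1 x unfolding inj_def by (metis insertI1 insertI2)+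
    ultimately show ?thesis by blast
  qed
  have fixq: "x \<in> {1..5} \<Longrightarrow> x \<notin> {i', j', k', l'} \<Longrightarrow> q x = x" for x
  proof -
    assume x: "x \<in> {1..5}" "x \<notin> {i', j', k', l'}"
    have "card {x, i', j', k', l'} = 5" using 2 x by auto
    then have "{x, i', j', k', l'} = {1..5}" using card_subset_eq[of "{1..5}" "{x, i', j', k', l'}"] 2 x by auto
    moreover have "q x \<in> {1..5}" using permutes_in_image[OF q(1)] x by blast
    moreover have "q x \<noteq> j'" "q x \<noteq> i'" "q x \<noteq> l'" "q x \<noteq> k'"
      using permutes_inj[OF q(1)] 2 x unfolding inj_def by (metis insertI1 insertI2)+
    ultimately show ?thesis by blast
  qed
  have same: "p x = q x" if x: "x \<in> {1..5}" "p x \<noteq> x" "q x \<noteq> x" for x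
    using un[of "p x" "q x" x] E x permutes_in_image[OF p(1)] permutes_in_image[OF q(1)] by auto
  \<comment> \<open>A double transposition of five points fixes just one of them. If
    \<open>q\<close> fixed \<open>x\<close>, it would therefore move \<open>p x\<close>, and to a
    point of the same class other than \<open>x\<close>, giving a class of three.\<close>
  have pq: "q x \<noteq> x" if x: "x \<in> {1..5}" "p x \<noteq> x" for x
  proof
    assume qx: "q x = x"
    have px: "p x \<in> {1..5}" "p (p x) = x"
    proof -
      show "p x \<in> {1..5}" using permutes_in_image[OF p(1)] x by blast
      have "x \<in> {i, j, k, l}" using fixp x by blast
      then show "p (p x) = x" by (elim insertE) (simp_all add: 1)
    qed
    have nx: "x \<notin> {i', j', k', l'}" using qx 2 by auto
    have "card {x, i', j', k', l'} = 5" using 2 nx by auto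
    then have all: "{x, i', j', k', l'} = {1..5}" using card_subset_eq[of "{1..5}" "{x, i', j', k', l'}"] 2 x by auto
    have "p x \<in> {i', j', k', l'}" using px(1) x(2) all by blast
    then have q': "q (p x) \<noteq> p x" using 2 by auto
    have "q (p x) \<noteq> x" using qx x permutes_inj[OF q(1)] unfolding inj_def by metis
    moreover have "E (q (p x)) (p x)" "E x (p x)" using E px x eq(1) by auto
    ultimately show False
      using un[of "q (p x)" x "p x"] px x q' permutes_in_image[OF q(1)] by auto
  qed
  have qp: "p x \<noteq> x" if x: "x \<in> {1..5}" "q x \<noteq> x" for x
  proof
    assume px: "p x = x"
    have qx: "q x \<in> {1..5}" "q (q x) = x"
    proof -
      show "q x \<in> {1..5}" using permutes_in_image[OF q(1)] x by blast
      have "x \<in> {i', j', k', l'}" using fixq x by blast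
      then show "q (q x) = x" by (elim insertE) (simp_all add: 2)
    qed
    have nx: "x \<notin> {i, j, k, l}" using px 1 by auto
    have "card {x, i, j, k, l} = 5" using 1 nx by auto
    then have all: "{x, i, j, k, l} = {1..5}" using card_subset_eq[of "{1..5}" "{x, i, j, k, l}"] 1 x by auto
    have "q x \<in> {i, j, k, l}" using qx(1) x(2) all by blast
    then have p': "p (q x) \<noteq> q x" using 1 by auto
    have "p (q x) \<noteq> x" using px x permutes_inj[OF p(1)] unfolding inj_def by metis
    moreover have "E (p (q x)) (q x)" "E x (q x)" using E qx x eq(1) by auto
    ultimately show False
      using un[of "p (q x)" x "q x"] qx x p' permutes_in_image[OF p(1)] by auto
  qed
  show "p = q"
  proof
    fix x show "p x = q x"
    proof (cases "x \<in> {1..5}")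
      case True then show ?thesis using same pq qp by metis
    next
      case False then show ?thesis using p(1) q(1) unfolding permutes_def by metis
    qed
  qed
qed

section \<open>Splitting fields\<close>

lemma CC_nat_pow [simp]: "x [^]\<^bsub>complex_ring\<^esub> (n :: nat) = x ^ n"
  by (induction n) (simp_all add: mult.commute)

text \<open>HOL-Algebra lists coefficients from the leading one, \<open>Poly\<close> from the
  constant one; hence the reversal.\<close>

lemma CC_eval: "CC.eval p x = poly (Poly (rev p)) x"
  by (induction p) (simp_all add: Poly_snoc poly_monom)

lemma CC_algebraic_iff:
  assumes "subfield F complex_ring"
  shows "(CC.algebraic over F) x \<longleftrightarrow> (\<exists>p\<in>polys_over F. p \<noteq> 0 \<and> poly p x = 0)"
proof
  assume "(CC.algebraic over F) x"
  then obtain p where p: "p \<in> carrier (F[X]\<^bsub>complex_ring\<^esub>)" "p \<noteq> []" "CC.eval p x = 0"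
    using CC.algebraicE[OF subfieldE(1)[OF assms], of x] by auto
  then have s: "set p \<subseteq> F" "hd p \<noteq> 0" by (auto simp: univ_poly_carrier[symmetric] polynomial_def)
  have "coeff (Poly (rev p)) i \<in> F" for i
    using s(1) subfieldD(1)[OF assms] nth_mem[of i "rev p"] by (auto simp: nth_default_def simp del: nth_mem)
  moreover have "Poly (rev p) \<noteq> 0"
  proof
    assume "Poly (rev p) = 0"
    then obtain n where "rev p = replicate n 0" unfolding Poly_eq_0 by blast
    then have "p = replicate n 0" by (metis rev_replicate rev_rev_ident)
    then show False using s(2) p(2) by (cases n) auto
  qed
  ultimately show "\<exists>p\<in>polys_over F. p \<noteq> 0 \<and> poly p x = 0"
    using p(3) unfolding CC_eval polys_over_def by blast
next
  assume "\<exists>p\<in>polys_over F. p \<noteq> 0 \<and> poly p x = 0"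
  then obtain p where p: "p \<in> polys_over F" "p \<noteq> 0" "poly p x = 0" by blast
  have "rev (coeffs p) \<in> carrier (F[X]\<^bsub>complex_ring\<^esub>)"
    unfolding univ_poly_carrier[symmetric] polynomial_def
    using p(1,2) by (auto simp: polys_over_def coeffs_def hd_rev last_map)
  moreover have "rev (coeffs p) \<noteq> []" using p(2) by simp
  moreover have "CC.eval (rev (coeffs p)) x = \<zero>\<^bsub>complex_ring\<^esub>" using p(3) by (simp add: CC_eval)
  ultimately show "(CC.algebraic over F) x" by (rule CC.algebraicI)
qed

lemma polys_over_mono: "F \<subseteq> G \<Longrightarrow> polys_over F \<subseteq> polys_over G"
  unfolding polys_over_def by auto

lemma finite_extension_Cons_eq_adjoin:
  assumes "subfield (CC.finite_extension F xs) complex_ring"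
  shows "CC.finite_extension F (x # xs) = adjoin (CC.finite_extension F xs) x"
  using adjoin_eq_simple_extension[OF assms] by simp

text \<open>Algebraicity is stated over the rationals throughout, so that one hypothesis on an
  element serves at every stage of a tower.\<close>

definition alg_over_Rats :: "complex \<Rightarrow> bool"
  where "alg_over_Rats x \<longleftrightarrow> (\<exists>p\<in>polys_over \<rat>. p \<noteq> 0 \<and> poly p x = 0)"

lemma alg_over_RatsD:
  assumes "alg_over_Rats x" "subfield F complex_ring"
  shows "\<exists>p\<in>polys_over F. p \<noteq> 0 \<and> poly p x = 0"
  using assms polys_over_mono[OF Rats_subset_subfield[OF assms(2)]] unfolding alg_over_Rats_def by blast

lemma subfield_finite_extension:
  assumes "subfield F complex_ring" "\<And>x. x \<in> set xs \<Longrightarrow> alg_over_Rats x"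
  shows "subfield (CC.finite_extension F xs) complex_ring"
  using assms(2) alg_over_RatsD[OF _ assms(1)]
  by (intro CC.finite_extension_is_subfield[OF assms(1)]) (auto simp: CC_algebraic_iff[OF assms(1)])

lemma subfield_adjoin:
  assumes "subfield F complex_ring" "alg_over_Rats x"
  shows "subfield (adjoin F x) complex_ring"
  using subfield_finite_extension[OF assms(1), of "[x]"] assms(2)
    adjoin_eq_simple_extension[OF assms(1), of x] by simp

text \<open>Values are allowed anywhere in the complex numbers, so the image of the minimal
  polynomial has a root by the fundamental theorem of algebra. The return into the splitting field
  is left to normality.\<close>

lemma hom_on_extend:
  assumes F: "subfield F complex_ring" and \<phi>: "hom_on F \<phi>" and x: "alg_over_Rats x"
  obtains \<psi> where "hom_on (adjoin F x) \<psi>" "\<And>y. y \<in> F \<Longrightarrow> \<psi> y = \<phi> y"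
proof -
  obtain p where p: "p \<in> polys_over F" "p \<noteq> 0" "poly p x = 0" using alg_over_RatsD[OF x F] by blast
  obtain m where m: "m \<in> polys_over F" "lead_coeff m = 1" "poly m x = 0"
    "\<And>p. p \<in> polys_over F \<Longrightarrow> poly p x = 0 \<Longrightarrow> \<exists>q\<in>polys_over F. p = m * q"
    using minimal_poly_over[OF F p] by metis
  have deg: "degree m \<noteq> 0"
  proof
    assume "degree m = 0"
    then have "m = [:1:]" using m(2) by (metis degree_eq_zeroE lead_coeff_pCons(2))
    then show False using m(3) by simp
  qed
  have "coeff (map_poly \<phi> m) (degree m) = 1"
    using m(2) by (simp add: coeff_map_hom[OF F \<phi>] hom_on_1[OF F \<phi>])
  then have "degree (map_poly \<phi> m) \<noteq> 0" using deg le_degree[of "map_poly \<phi> m" "degree m"] by simp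
  then have "\<not> constant (poly (map_poly \<phi> m))" by (simp add: constant_degree)
  then obtain b where b: "poly (map_poly \<phi> m) b = 0" using fundamental_theorem_of_algebra by blast
  show ?thesis
    using hom_on_extend_to[OF F \<phi> m(1,4) b] that by metis
qed

lemma hom_on_extend_list:
  assumes F: "subfield F complex_ring" and \<phi>: "hom_on F \<phi>"
    and xs: "\<And>x. x \<in> set xs \<Longrightarrow> alg_over_Rats x"
  shows "\<exists>\<psi>. hom_on (CC.finite_extension F xs) \<psi> \<and> (\<forall>y\<in>F. \<psi> y = \<phi> y)"
  using xs
proof (induction xs)
  case Nil
  then show ?case using \<phi> by auto
next
  case (Cons x xs)
  then obtain \<psi> where \<psi>: "hom_on (CC.finite_extension F xs) \<psi>" "\<forall>y\<in>F. \<psi> y = \<phi> y" by auto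
  have sf: "subfield (CC.finite_extension F xs) complex_ring"
    using subfield_finite_extension[OF F] Cons.prems by auto
  obtain \<psi>' where \<psi>': "hom_on (adjoin (CC.finite_extension F xs) x) \<psi>'"
    "\<And>y. y \<in> CC.finite_extension F xs \<Longrightarrow> \<psi>' y = \<psi> y"
    using hom_on_extend[OF sf \<psi>(1)] Cons.prems by (metis list.set_intros(1))
  have "F \<subseteq> CC.finite_extension F xs" by (rule CC.finite_extension_incl) auto
  then show ?case
    using \<psi>' \<psi>(2) unfolding finite_extension_Cons_eq_adjoin[OF sf] by (intro exI[of _ \<psi>']) auto
qed

lemma subring_of_hom:
  "\<sigma> \<in> Ring.ring_hom (subring_of K) (subring_of K) \<longleftrightarrow> hom_on K \<sigma> \<and> (\<forall>x\<in>K. \<sigma> x \<in> K)"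
  unfolding Ring.ring_hom_def subring_of_def hom_on_def by auto

lemma Gal_carrier:
  assumes "subfield K complex_ring"
  shows "\<sigma> \<in> carrier (Gal K) \<longleftrightarrow> \<sigma> \<in> extensional K \<and> bij_betw \<sigma> K K \<and> hom_on K \<sigma>"
  unfolding Gal_def Bij_def subring_of_hom using hom_on_Rats[OF assms]
  by (auto simp: bij_betw_def)

text \<open>The minimal polynomial of an irrational number has degree at least 2, and its roots are
  simple because the nonzero derivative has smaller degree. Hence there is a second root to which
  \<open>x\<close> can be sent, which shows that no irrational element is fixed by all
  automorphisms.\<close>

lemma conjugate_exists:
  assumes x: "alg_over_Rats x" "x \<notin> \<rat>"
  obtains y \<psi> where "y \<noteq> x" "hom_on (adjoin \<rat> x) \<psi>" "\<psi> x = y"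
proof -
  note Q = subfield_Rats
  obtain p where p: "p \<in> polys_over \<rat>" "p \<noteq> 0" "poly p x = 0" using x(1) unfolding alg_over_Rats_def by blast
  obtain m where m: "m \<in> polys_over \<rat>" "lead_coeff m = 1" "poly m x = 0"
    "\<And>p. p \<in> polys_over \<rat> \<Longrightarrow> poly p x = 0 \<Longrightarrow> \<exists>q\<in>polys_over \<rat>. p = m * q"
    "\<And>p. p \<in> polys_over \<rat> \<Longrightarrow> poly p x = 0 \<Longrightarrow> p \<noteq> 0 \<Longrightarrow> degree m \<le> degree p"
    using minimal_poly_over[OF Q p] by metis
  have id: "hom_on \<rat> (\<lambda>x. x)" unfolding hom_on_def by simp
  have m0: "m \<noteq> 0" using m(2) by auto
  obtain q where q: "m = [:- x, 1:] * q" using m(3) by (metis poly_eq_0_iff_dvd dvdE)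
  have "degree m \<noteq> 0"
  proof
    assume "degree m = 0"
    then have "m = [:1:]" using m(2) by (metis degree_eq_zeroE lead_coeff_pCons(2))
    then show False using m(3) by simp
  qed
  moreover have "degree m \<noteq> 1"
  proof
    assume "degree m = 1"
    then have "poly m x = coeff m 0 + x" using m(2) by (simp add: poly_altdef)
    then have "x = - coeff m 0" using m(3) by (simp add: eq_neg_iff_add_eq_0 add.commute)
    then show False using x(2) m(1) unfolding polys_over_def by simp
  qed
  moreover have q0: "q \<noteq> 0" using q m0 by auto
  then have "degree m = Suc (degree q)" unfolding q by (subst degree_mult_eq) auto
  ultimately have "degree q \<noteq> 0" by simp
  then have "\<not> constant (poly q)" by (simp add: constant_degree)
  then obtain y where y: "poly q y = 0" using fundamental_theorem_of_algebra by blast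
  have "y \<noteq> x"
  proof
    assume "y = x"
    then have "poly (pderiv m) x = 0" using y unfolding q pderiv_mult by (simp add: \<open>y = x\<close>)
    moreover have "pderiv m \<noteq> 0" using \<open>degree m \<noteq> 0\<close> by (simp add: pderiv_eq_0_iff)
    moreover have "pderiv m \<in> polys_over \<rat>" using m(1) unfolding polys_over_def by (auto simp: coeff_pderiv)
    ultimately have "degree m \<le> degree (pderiv m)" using m(5) by blast
    then show False using \<open>degree m \<noteq> 0\<close> by (simp add: degree_pderiv)
  qed
  moreover have "poly (map_poly (\<lambda>x. x) m) y = 0" using y q by (simp add: map_poly_idI)
  ultimately show ?thesis using hom_on_extend_to[OF Q id m(1,4)] that by metis
qed

section \<open>The splitting field of a rational polynomial as a Galois extension\<close>

locale splitting =
  fixes f :: "complex poly" and xs :: "complex list" and K :: "complex set"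
  assumes f: "f \<in> polys_over \<rat>" "f \<noteq> 0" and set_xs: "set xs = {z. poly f z = 0}"
    and K_def: "K = CC.finite_extension \<rat> xs"
begin

lemma alg_roots: "x \<in> set xs \<Longrightarrow> alg_over_Rats x"
  using f set_xs unfolding alg_over_Rats_def by blast

lemma subfield_K: "subfield K complex_ring"
  unfolding K_def using subfield_finite_extension[OF subfield_Rats] alg_roots by blast

lemma roots_in_K: "set xs \<subseteq> K"
  unfolding K_def by (rule CC.finite_extension_mem[OF subfieldE(1)[OF subfield_Rats]]) simp

lemma K_minimal: "subfield F complex_ring \<Longrightarrow> set xs \<subseteq> F \<Longrightarrow> K \<subseteq> F"
  unfolding K_def by (rule CC.finite_extension_subring_incl[OF subfieldE(1)]) (use Rats_subset_subfield in auto)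

lemma K_finite_dimension: "ring.finite_dimension complex_ring \<rat> K"
  unfolding K_def
  by (rule CC.finite_extension_finite_dimension(1)[OF subfield_Rats])
     (use alg_roots in \<open>auto simp: CC_algebraic_iff[OF subfield_Rats] alg_over_Rats_def\<close>)

lemma alg_K: "x \<in> K \<Longrightarrow> alg_over_Rats x"
  using CC.finite_extesion_mem_imp_algebraic[OF subfield_Rats, of xs x] alg_roots
  unfolding K_def by (auto simp: CC_algebraic_iff[OF subfield_Rats] alg_over_Rats_def)

lemma K_algebraic: "K \<subseteq> rat_closure"
  using alg_K unfolding rat_closure_def alg_over_Rats_def algebraic_altdef polys_over_def by blast

lemma hom_roots:
  assumes "subfield F complex_ring" "K \<subseteq> F" "hom_on F \<psi>"
  shows "\<psi> ` set xs = set xs"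
proof (rule endo_inj_surj)
  show "finite (set xs)" by simp
  have xF: "set xs \<subseteq> F" using roots_in_K assms(2) by simp
  show "\<psi> ` set xs \<subseteq> set xs"
  proof
    fix y assume "y \<in> \<psi> ` set xs"
    then obtain x where x: "x \<in> set xs" "y = \<psi> x" by blast
    have fF: "f \<in> polys_over F" using f polys_over_mono[OF Rats_subset_subfield[OF assms(1)]] by blast
    have "poly f (\<psi> x) = \<psi> (poly f x)"
      using poly_map_hom[OF assms(1,3) fF] map_hom_Rats[OF assms(1,3) f(1)] x xF by force
    then show "y \<in> set xs" using x set_xs hom_on_0[OF assms(1,3)] by simp
  qed
  show "inj_on \<psi> (set xs)" using hom_on_inj[OF assms(1,3)] xF inj_on_subset by blast
qed

lemma hom_restrict_Gal:
  assumes F: "subfield F complex_ring" and KF: "K \<subseteq> F" and \<psi>: "hom_on F \<psi>"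
  shows "restrict \<psi> K \<in> carrier (Gal K)"
proof -
  note s = subfieldD[OF F] and k = subfieldD[OF subfield_K]
  have im: "subfield (\<psi> ` K) complex_ring"
  proof (rule subfieldI_complex)
    show "1 \<in> \<psi> ` K" using hom_on_1[OF F \<psi>] k(2) by (metis imageI)
    fix x y assume "x \<in> \<psi> ` K" "y \<in> \<psi> ` K"
    then obtain u v where uv: "u \<in> K" "v \<in> K" "x = \<psi> u" "y = \<psi> v" by auto
    then have "u \<in> F" "v \<in> F" using KF by auto
    then have "x - y = \<psi> (u - v)" "x * y = \<psi> (u * v)" "inverse x = \<psi> (inverse u)"
      using uv by (simp_all add: hom_on_diff[OF F \<psi>] hom_on_mult[OF F \<psi>] hom_on_inverse[OF F \<psi>])
    then show "x - y \<in> \<psi> ` K" "x * y \<in> \<psi> ` K" "inverse x \<in> \<psi> ` K"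
      using k uv by auto
  next
  qed
  have "set xs \<subseteq> \<psi> ` K" using hom_roots[OF assms] roots_in_K by (metis image_mono)
  then have 1: "K \<subseteq> \<psi> ` K" using K_minimal[OF im] by blast
  have "subfield {x \<in> K. \<psi> x \<in> K} complex_ring"
    by (rule subfieldI_complex)
       (use k KF in \<open>auto simp: hom_on_1[OF F \<psi>] hom_on_diff[OF F \<psi>] hom_on_mult[OF F \<psi>] hom_on_inverse[OF F \<psi>] subset_iff\<close>)
  moreover have "set xs \<subseteq> {x \<in> K. \<psi> x \<in> K}" using hom_roots[OF assms] roots_in_K by auto
  ultimately have 2: "\<psi> ` K \<subseteq> K" using K_minimal by blast
  have "bij_betw \<psi> K K" using 1 2 hom_on_inj[OF F \<psi>] KF by (auto simp: bij_betw_def inj_on_subset)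
  moreover have "hom_on K (restrict \<psi> K)"
    using \<psi> KF k(2-4) unfolding hom_on_def by (auto simp: subset_iff)
  ultimately show ?thesis unfolding Gal_carrier[OF subfield_K]
    by (simp add: bij_betw_restrict_eq)
qed

lemma Gal_hom: "\<sigma> \<in> carrier (Gal K) \<Longrightarrow> hom_on K \<sigma>"
  unfolding Gal_carrier[OF subfield_K] by blast

lemma Gal_in_K: "\<sigma> \<in> carrier (Gal K) \<Longrightarrow> x \<in> K \<Longrightarrow> \<sigma> x \<in> K"
  unfolding Gal_carrier[OF subfield_K] by (auto simp: bij_betw_def)

lemma Gal_roots: "\<sigma> \<in> carrier (Gal K) \<Longrightarrow> \<sigma> ` set xs = set xs"
  using hom_roots[OF subfield_K subset_refl Gal_hom] .

text \<open>For irrational \<open>x\<close> a map moving \<open>x\<close> is extended from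
  \<open>adjoin \<rat> x\<close> to the field generated by \<open>x\<close> and all roots. That
  field contains \<open>K\<close>, and the restriction to \<open>K\<close> is an automorphism not
  fixing \<open>x\<close>.\<close>

lemma fixed_field: "{x \<in> K. \<forall>\<sigma>\<in>carrier (Gal K). \<sigma> x = x} = \<rat>"
proof (intro equalityI subsetI)
  fix x assume "x \<in> {x \<in> K. \<forall>\<sigma>\<in>carrier (Gal K). \<sigma> x = x}"
  then have x: "x \<in> K" "\<And>\<sigma>. \<sigma> \<in> carrier (Gal K) \<Longrightarrow> \<sigma> x = x" by auto
  show "x \<in> \<rat>"
  proof (rule ccontr)
    assume nQ: "x \<notin> \<rat>"
    obtain y \<psi> where y: "y \<noteq> x" "hom_on (adjoin \<rat> x) \<psi>" "\<psi> x = y"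
      using conjugate_exists[OF alg_K[OF x(1)] nQ] by blast
    have sf: "subfield (adjoin \<rat> x) complex_ring" using subfield_adjoin[OF subfield_Rats alg_K[OF x(1)]] .
    obtain \<psi>' where \<psi>': "hom_on (CC.finite_extension (adjoin \<rat> x) xs) \<psi>'" "\<forall>y\<in>adjoin \<rat> x. \<psi>' y = \<psi> y"
      using hom_on_extend_list[OF sf y(2)] alg_roots by blast
    have sf': "subfield (CC.finite_extension (adjoin \<rat> x) xs) complex_ring"
      using subfield_finite_extension[OF sf] alg_roots by blast
    have "K \<subseteq> CC.finite_extension (adjoin \<rat> x) xs"
      by (rule K_minimal[OF sf'], rule CC.finite_extension_mem[OF subfieldE(1)[OF sf]]) simp
    then have "restrict \<psi>' K \<in> carrier (Gal K)" by (rule hom_restrict_Gal[OF sf' _ \<psi>'(1)])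
    then have "\<psi>' x = x" using x by force
    moreover have "poly [:0, 1:] x \<in> adjoin \<rat> x" unfolding adjoin_def
      by (intro imageI polys_over_pCons[OF subfield_Rats] polys_over_0[OF subfield_Rats]) auto
    ultimately show False using y \<psi>'(2) by simp
  qed
next
  fix x :: complex assume "x \<in> \<rat>"
  then show "x \<in> {x \<in> K. \<forall>\<sigma>\<in>carrier (Gal K). \<sigma> x = x}"
    using Rats_subset_subfield[OF subfield_K] hom_on_Rats[OF subfield_K Gal_hom] by auto
qed

lemma finite_galois_ext_K: "finite_galois_ext K"
  unfolding finite_galois_ext_def
  using subfield_K K_algebraic K_finite_dimension fixed_field by blast

lemma Gal_eqI:
  assumes "\<sigma> \<in> carrier (Gal K)" "\<tau> \<in> carrier (Gal K)" "\<And>x. x \<in> set xs \<Longrightarrow> \<sigma> x = \<tau> x"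
  shows "\<sigma> = \<tau>"
proof -
  have \<sigma>: "hom_on K \<sigma>" "\<sigma> \<in> extensional K" and \<tau>: "hom_on K \<tau>" "\<tau> \<in> extensional K"
    using assms(1,2) unfolding Gal_carrier[OF subfield_K] by auto
  note k = subfieldD[OF subfield_K]
  have "subfield {x \<in> K. \<sigma> x = \<tau> x} complex_ring"
    by (rule subfieldI_complex)
       (use k in \<open>auto simp: hom_on_1[OF subfield_K] hom_on_diff[OF subfield_K] hom_on_mult[OF subfield_K]
         hom_on_inverse[OF subfield_K] \<sigma> \<tau>\<close>)
  then have "K \<subseteq> {x \<in> K. \<sigma> x = \<tau> x}" using K_minimal roots_in_K assms(3) by blast
  then show ?thesis using \<sigma>(2) \<tau>(2) by (intro extensionalityI[of _ K]) auto
qed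

lemma Gal_id: "(\<lambda>x\<in>K. x) \<in> carrier (Gal K)"
proof -
  have "hom_on K (\<lambda>x. x)" unfolding hom_on_def by simp
  then show ?thesis using hom_restrict_Gal[OF subfield_K subset_refl, of "\<lambda>x. x"] by simp
qed

lemma Gal_one: "\<one>\<^bsub>Gal K\<^esub> = (\<lambda>x\<in>K. x)"
  unfolding Gal_def BijGroup_def by simp

lemma Gal_mult:
  assumes "\<sigma> \<in> carrier (Gal K)" "\<tau> \<in> carrier (Gal K)"
  shows "\<sigma> \<otimes>\<^bsub>Gal K\<^esub> \<tau> = compose K \<sigma> \<tau>"
  using assms unfolding Gal_def BijGroup_def by simp

lemma Gal_compose:
  assumes "\<sigma> \<in> carrier (Gal K)" "\<tau> \<in> carrier (Gal K)"
  shows "compose K \<sigma> \<tau> \<in> carrier (Gal K)"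
proof -
  have "bij_betw (compose K \<sigma> \<tau>) K K"
    using assms bij_betw_compose[of \<tau> K K \<sigma> K] unfolding Gal_carrier[OF subfield_K] by blast
  moreover have "hom_on K (compose K \<sigma> \<tau>)"
    unfolding hom_on_def
    using Gal_in_K[OF assms(2)] subfieldD(2-4)[OF subfield_K] hom_on_1[OF subfield_K Gal_hom[OF assms(1)]]
      hom_on_add[OF subfield_K Gal_hom[OF assms(1)]] hom_on_mult[OF subfield_K Gal_hom[OF assms(1)]]
      hom_on_1[OF subfield_K Gal_hom[OF assms(2)]]
      hom_on_add[OF subfield_K Gal_hom[OF assms(2)]] hom_on_mult[OF subfield_K Gal_hom[OF assms(2)]]
    by (simp add: compose_def)
  ultimately show ?thesis unfolding Gal_carrier[OF subfield_K] by simp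
qed

lemma Gal_inv:
  assumes "\<sigma> \<in> carrier (Gal K)"
  shows "restrict (inv_into K \<sigma>) K \<in> carrier (Gal K)"
proof -
  have \<sigma>: "hom_on K \<sigma>" "inj_on \<sigma> K" "\<sigma> ` K = K" "bij_betw \<sigma> K K"
    using assms unfolding Gal_carrier[OF subfield_K] by (auto simp: bij_betw_def)
  note k = subfieldD[OF subfield_K]
  have inv: "inv_into K \<sigma> (\<sigma> x) = x" if "x \<in> K" for x using that \<sigma>(2) by simp
  have "hom_on K (inv_into K \<sigma>)"
    unfolding hom_on_def
  proof (intro conjI ballI)
    show "inv_into K \<sigma> 1 = 1" using inv[OF k(2)] hom_on_1[OF subfield_K \<sigma>(1)] by simp
    fix x y assume "x \<in> K" "y \<in> K"
    then obtain u v where uv: "u \<in> K" "v \<in> K" "x = \<sigma> u" "y = \<sigma> v" using \<sigma>(3) by (metis imageE)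
    show "inv_into K \<sigma> (x + y) = inv_into K \<sigma> x + inv_into K \<sigma> y"
      using inv[of "u + v"] k(3) uv inv by (simp add: hom_on_add[OF subfield_K \<sigma>(1)])
    show "inv_into K \<sigma> (x * y) = inv_into K \<sigma> x * inv_into K \<sigma> y"
      using inv[of "u * v"] k(4) uv inv by (simp add: hom_on_mult[OF subfield_K \<sigma>(1)])
  qed
  then show ?thesis using hom_restrict_Gal[OF subfield_K subset_refl] by blast
qed

lemma finite_Gal: "finite (carrier (Gal K))"
proof -
  have "inj_on (\<lambda>\<sigma>. map \<sigma> xs) (carrier (Gal K))"
    by (rule inj_onI) (use Gal_eqI in \<open>metis map_eq_conv\<close>)
  moreover have "(\<lambda>\<sigma>. map \<sigma> xs) ` carrier (Gal K) \<subseteq> {ys. set ys \<subseteq> set xs \<and> length ys = length xs}"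
    using Gal_roots by auto
  ultimately show ?thesis
    using finite_lists_length_eq[of "set xs" "length xs"] by (meson finite_imageD finite_subset List.finite_set)
qed

end

section \<open>Reduction modulo primes of the ring of algebraic integers\<close>

definition alg_prime :: "complex set \<Rightarrow> bool"
  where "alg_prime P \<longleftrightarrow> P \<subseteq> {x. algebraic_int x} \<and> 0 \<in> P \<and> 1 \<notin> P \<and>
    (\<forall>x\<in>P. \<forall>y\<in>P. x + y \<in> P) \<and> (\<forall>x\<in>P. \<forall>y. algebraic_int y \<longrightarrow> x * y \<in> P) \<and>
    (\<forall>x y. algebraic_int x \<longrightarrow> algebraic_int y \<longrightarrow> x * y \<in> P \<longrightarrow> x \<in> P \<or> y \<in> P)"

lemma inverse_prime_not_algebraic_int:
  assumes "prime q" "algebraic_int y"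
  shows "of_nat q * y \<noteq> (1 :: complex)"
proof
  assume e: "of_nat q * y = 1"
  then have y: "y = 1 / of_nat q" using assms(1) by (auto simp: field_simps)
  then have "y \<in> \<rat>" by simp
  then have "y \<in> \<int>" using rational_algebraic_int_is_int assms(2) by blast
  then obtain k where "y = of_int k" by (auto elim: Ints_cases)
  then have "of_int (int q * k) = (1 :: complex)" using e by simp
  then have "int q * k = 1" by (metis of_int_eq_1_iff)
  then show False using assms(1) by (metis nat_1_eq_mult_iff not_prime_1 of_nat_dvd_iff dvd_triv_left nat_dvd_1_iff_1 of_nat_1)
qed

text \<open>Zorn's lemma is applied to the proper ideals containing \<open>q\<close>. There is one,
  the multiples of \<open>q\<close>, because the inverse of \<open>q\<close> is rational but not an
  integer, hence not integral. A maximal element is prime by the usual argument.\<close>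

lemma alg_prime_exists:
  assumes q: "prime q"
  obtains P where "alg_prime P" "of_nat q \<in> P"
proof -
  define ideal where "ideal I \<longleftrightarrow> I \<subseteq> {x :: complex. algebraic_int x} \<and> 0 \<in> I \<and> of_nat q \<in> I \<and>
    (\<forall>x\<in>I. \<forall>y\<in>I. x + y \<in> I) \<and> (\<forall>x\<in>I. \<forall>y. algebraic_int y \<longrightarrow> x * y \<in> I)" for I
  define A where "A = {I. ideal I \<and> 1 \<notin> I}"
  define I0 where "I0 = {of_nat q * y | y :: complex. algebraic_int y}"
  have "ideal I0"
    unfolding ideal_def
  proof (intro conjI ballI allI impI)
    show "I0 \<subseteq> {x. algebraic_int x}"
      unfolding I0_def using algebraic_int_mult[OF algebraic_int_of_int[of "int q"]] by auto
    show "0 \<in> I0" unfolding I0_def by (intro CollectI exI[of _ 0]) auto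
    show "of_nat q \<in> I0" unfolding I0_def by (intro CollectI exI[of _ 1]) auto
    fix x y :: complex assume x: "x \<in> I0"
    then obtain u where u: "x = of_nat q * u" "algebraic_int u" unfolding I0_def by auto
    { assume "y \<in> I0"
      then obtain v where v: "y = of_nat q * v" "algebraic_int v" unfolding I0_def by auto
      show "x + y \<in> I0" unfolding I0_def u v
        by (intro CollectI exI[of _ "u + v"]) (simp add: distrib_left algebraic_int_add u v) }
    { assume "algebraic_int y"
      then show "x * y \<in> I0" unfolding I0_def u
        by (intro CollectI exI[of _ "u * y"]) (simp add: algebraic_int_mult u) }
  qed
  then have "I0 \<in> A" using inverse_prime_not_algebraic_int[OF q] unfolding A_def I0_def by fastforce
  then have "A \<noteq> {}" by blast
  moreover have "\<Union>C \<in> A" if C: "C \<noteq> {}" "subset.chain A C" for C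
  proof -
    have sub: "C \<subseteq> A" and tot: "\<And>U V. U \<in> C \<Longrightarrow> V \<in> C \<Longrightarrow> U \<subseteq> V \<or> V \<subseteq> U"
      using C(2) unfolding subset_chain_def by auto
    have id: "ideal U" if "U \<in> C" for U using that sub unfolding A_def by blast
    have "ideal (\<Union>C)"
      unfolding ideal_def
    proof (intro conjI ballI allI impI)
      show "\<Union>C \<subseteq> {x. algebraic_int x}" using id unfolding ideal_def by blast
      show "0 \<in> \<Union>C" "of_nat q \<in> \<Union>C" using id C(1) unfolding ideal_def by blast+
      fix x y :: complex assume "x \<in> \<Union>C"
      then obtain U where U: "x \<in> U" "U \<in> C" by blast
      { assume "y \<in> \<Union>C"
        then obtain V where V: "y \<in> V" "V \<in> C" by blast
        then have "\<exists>W\<in>C. x \<in> W \<and> y \<in> W" using tot[OF U(2) V(2)] U V by blast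
        then show "x + y \<in> \<Union>C" using id unfolding ideal_def by blast }
      { assume "algebraic_int y"
        then show "x * y \<in> \<Union>C" using U id unfolding ideal_def by blast }
    qed
    then show ?thesis using sub unfolding A_def by blast
  qed
  ultimately obtain M where M: "M \<in> A" "\<And>U. U \<in> A \<Longrightarrow> M \<subseteq> U \<Longrightarrow> U = M"
    using subset_Zorn_nonempty[of A] by metis
  then have id: "ideal M" and "1 \<notin> M" unfolding A_def by auto
  have "x \<in> M \<or> y \<in> M" if xy: "algebraic_int x" "algebraic_int y" "x * y \<in> M" for x y :: complex
  proof (rule disjCI)
    assume y: "y \<notin> M"
    define N where "N = {m + y * a | m a. m \<in> M \<and> algebraic_int a}"
    have MN: "M \<subseteq> N"
    proof
      fix m assume "m \<in> M"
      then show "m \<in> N" unfolding N_def by (intro CollectI exI[of _ m] exI[of _ 0]) simp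
    qed
    have "ideal N"
      unfolding ideal_def
    proof (intro conjI ballI allI impI)
      show "N \<subseteq> {x. algebraic_int x}"
        using id xy unfolding N_def ideal_def by (auto intro!: algebraic_int_add algebraic_int_mult)
      show "0 \<in> N" "of_nat q \<in> N" using MN id unfolding ideal_def by auto
      fix u v :: complex assume "u \<in> N"
      then obtain m a where u: "u = m + y * a" "m \<in> M" "algebraic_int a" unfolding N_def by auto
      { assume "v \<in> N"
        then obtain n b where v: "v = n + y * b" "n \<in> M" "algebraic_int b" unfolding N_def by auto
        have "u + v = (m + n) + y * (a + b)" unfolding u v by (simp add: algebra_simps)
        moreover have "m + n \<in> M" using id u v unfolding ideal_def by blast
        ultimately show "u + v \<in> N" using algebraic_int_add[OF u(3) v(3)] unfolding N_def by blast }
      { assume v: "algebraic_int v"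
        have "u * v = m * v + y * (a * v)" unfolding u by (simp add: algebra_simps)
        moreover have "m * v \<in> M" using id u v unfolding ideal_def by blast
        ultimately show "u * v \<in> N" using algebraic_int_mult[OF u(3) v] unfolding N_def by blast }
    qed
    moreover have "N \<noteq> M"
    proof -
      have "0 + y * 1 \<in> N" unfolding N_def using id unfolding ideal_def by (intro CollectI exI conjI) auto
      then show ?thesis using y by auto
    qed
    ultimately have "1 \<in> N" using M(2) MN unfolding A_def by blast
    then obtain m a where ma: "1 = m + y * a" "m \<in> M" "algebraic_int a" unfolding N_def by auto
    have "x = x * (m + y * a)" using ma(1) by simp
    also have "\<dots> = m * x + x * y * a" by (simp add: algebra_simps)
    finally show "x \<in> M" using id ma xy unfolding ideal_def by metis
  qed
  then have "alg_prime M" using id \<open>1 \<notin> M\<close> unfolding alg_prime_def ideal_def by blast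
  then show ?thesis using that id unfolding ideal_def by blast
qed

context
  fixes P assumes P: "alg_prime P"
begin

lemma
  shows alg_prime_0: "0 \<in> P" and alg_prime_1: "1 \<notin> P"
    and alg_prime_add: "x \<in> P \<Longrightarrow> y \<in> P \<Longrightarrow> x + y \<in> P"
    and alg_prime_mult: "x \<in> P \<Longrightarrow> algebraic_int y \<Longrightarrow> x * y \<in> P"
    and alg_prime_mult': "x \<in> P \<Longrightarrow> algebraic_int y \<Longrightarrow> y * x \<in> P"
    and alg_prime_cases: "algebraic_int x \<Longrightarrow> algebraic_int y \<Longrightarrow> x * y \<in> P \<Longrightarrow> x \<in> P \<or> y \<in> P"
  using P unfolding alg_prime_def by (auto simp: mult.commute)

lemma alg_prime_minus: "x \<in> P \<Longrightarrow> - x \<in> P"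
  using alg_prime_mult[of x "-1"] algebraic_int_of_int[of "-1"] by simp

lemma alg_prime_diff: "x \<in> P \<Longrightarrow> y \<in> P \<Longrightarrow> x - y \<in> P"
  using alg_prime_add[of x "- y"] alg_prime_minus by simp

lemma alg_prime_minus_commute: "x - y \<in> P \<Longrightarrow> y - x \<in> P"
  using alg_prime_minus[of "x - y"] by simp

lemma alg_prime_cong_iff: "x - y \<in> P \<Longrightarrow> x \<in> P \<longleftrightarrow> y \<in> P"
  using alg_prime_add[of "x - y" y] alg_prime_diff[of x "x - y"] by auto

lemma alg_prime_sum: "(\<And>i. i \<in> I \<Longrightarrow> f i \<in> P) \<Longrightarrow> sum f I \<in> P"
  by (induction I rule: infinite_finite_induct) (auto intro: alg_prime_0 alg_prime_add)

lemma alg_prime_prod: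
  assumes "finite I" "\<And>i. i \<in> I \<Longrightarrow> algebraic_int (f i)" "prod f I \<in> P"
  shows "\<exists>i\<in>I. f i \<in> P"
  using assms
proof (induction I rule: finite_induct)
  case empty
  then show ?case using alg_prime_1 by simp
next
  case (insert x F)
  have "f x \<in> P \<or> prod f F \<in> P"
    using alg_prime_cases[of "f x" "prod f F"] insert by (auto intro: algebraic_int_prod)
  then show ?case using insert by auto
qed

lemma alg_prime_power: "algebraic_int x \<Longrightarrow> x ^ n \<in> P \<Longrightarrow> x \<in> P"
  by (induction n) (use alg_prime_1 alg_prime_cases algebraic_int_power in auto)

lemma alg_prime_of_int:
  assumes "prime q" "of_nat q \<in> P" "of_int k \<in> P"
  shows "int q dvd k"
proof (rule ccontr)
  assume "\<not> int q dvd k"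
  then have "coprime (int q) k" using assms(1) by (simp add: prime_imp_coprime)
  then obtain u v where "u * int q + v * k = 1" by (metis bezout_int coprime_imp_gcd_eq_1)
  then have "of_int (u * int q + v * k) = (1 :: complex)" by simp
  then have "1 = of_nat q * of_int u + of_int k * (of_int v :: complex)" by (simp add: mult.commute)
  then show False
    using alg_prime_1 alg_prime_add alg_prime_mult assms(2,3) algebraic_int_of_int by metis
qed

lemma freshman:
  assumes q: "prime q" "of_nat q \<in> P" and xy: "algebraic_int x" "algebraic_int y"
  shows "(x + y) ^ q - (x ^ q + y ^ q) \<in> P"
proof -
  have q0: "q > 0" using q prime_gt_0_nat by blast
  have "(x + y) ^ q = (\<Sum>k\<le>q. of_nat (q choose k) * x ^ k * y ^ (q - k))" by (rule binomial_ring)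
  also have "{..q} = insert 0 (insert q {0<..<q})" using q0 by auto
  also have "(\<Sum>k\<in>insert 0 (insert q {0<..<q}). of_nat (q choose k) * x ^ k * y ^ (q - k)) =
     y ^ q + (x ^ q + (\<Sum>k\<in>{0<..<q}. of_nat (q choose k) * x ^ k * y ^ (q - k)))"
    using q0 by (subst sum.insert; simp)+
  finally have e: "(x + y) ^ q - (x ^ q + y ^ q) = (\<Sum>k\<in>{0<..<q}. of_nat (q choose k) * x ^ k * y ^ (q - k))"
    by simp
  show ?thesis
    unfolding e
  proof (rule alg_prime_sum)
    fix k assume "k \<in> {0<..<q}"
    then have "q dvd (q choose k)" using q(1) by (intro dvd_choose_prime) auto
    then obtain c where c: "q choose k = q * c" by blast
    have "of_nat (q choose k) * x ^ k * y ^ (q - k) = of_nat q * (of_int (int c) * (x ^ k * y ^ (q - k)))"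
      unfolding c by simp
    also have "\<dots> \<in> P" by (rule alg_prime_mult[OF q(2)]) (intro algebraic_int_closed xy)
    finally show "of_nat (q choose k) * x ^ k * y ^ (q - k) \<in> P" .
  qed
qed

lemma fermat_alg_prime:
  assumes q: "prime q" "of_nat q \<in> P"
  shows "of_int k ^ q - of_int k \<in> P"
proof -
  have step: "of_int (k + 1) ^ q - of_int (k + 1) - (of_int k ^ q - of_int k) \<in> P" for k
    using freshman[OF q algebraic_int_of_int[of k] algebraic_int_of_int[of 1]] by (simp add: algebra_simps)
  show ?thesis
  proof (induction k rule: int_induct[where k = 0])
    case base
    then show ?case using alg_prime_0 q prime_gt_0_nat by (simp add: power_0_left)
  next
    case (step1 i)
    then show ?case using alg_prime_cong_iff[OF step[of i]] by simp
  next
    case (step2 i)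
    then show ?case using alg_prime_cong_iff[OF step[of "i - 1"]] by simp
  qed
qed

text \<open>Raising to the power \<open>q\<close> is additive modulo \<open>P\<close> and fixes the
  integer coefficients by Fermat's theorem, so it may be moved into the argument.\<close>

lemma frobenius_int_poly:
  assumes q: "prime q" "of_nat q \<in> P" and x: "algebraic_int x"
  shows "poly (of_int_poly H) x ^ q - poly (of_int_poly H) (x ^ q) \<in> P"
proof (induction H)
  case 0
  then show ?case using alg_prime_0 q prime_gt_0_nat by (simp add: power_0_left)
next
  case (pCons a H)
  have alg: "algebraic_int (poly (of_int_poly H) z)" if "algebraic_int z" for z :: complex
    by (induction H) (auto simp: hom_distribs intro!: algebraic_int_closed that)
  let ?u = "poly (of_int_poly H) x" and ?v = "poly (of_int_poly H) (x ^ q)"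
  have "(of_int a + x * ?u) ^ q - (of_int a ^ q + (x * ?u) ^ q) \<in> P"
    by (rule freshman[OF q]) (intro algebraic_int_closed x alg)+
  moreover have "of_int a ^ q - of_int a \<in> P" by (rule fermat_alg_prime[OF q])
  moreover have "x ^ q * (?u ^ q - ?v) \<in> P"
    by (rule alg_prime_mult'[OF pCons.IH]) (intro algebraic_int_closed x)
  ultimately have "((of_int a + x * ?u) ^ q - (of_int a ^ q + (x * ?u) ^ q)) + (of_int a ^ q - of_int a) +
      x ^ q * (?u ^ q - ?v) \<in> P"
    by (intro alg_prime_add)
  then show ?case by (simp add: hom_distribs power_mult_distrib algebra_simps)
qed

end

section \<open>Galois invariants among the algebraic integers, and Frobenius congruences\<close>

definition alg_int_polys :: "complex poly set"
  where "alg_int_polys = {p. \<forall>i. algebraic_int (coeff p i)}"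

lemma alg_int_polys_mult: "p \<in> alg_int_polys \<Longrightarrow> q \<in> alg_int_polys \<Longrightarrow> p * q \<in> alg_int_polys"
  unfolding alg_int_polys_def by (auto simp: coeff_mult intro!: algebraic_int_sum algebraic_int_mult)

lemma alg_int_polys_prod: "(\<And>i. i \<in> I \<Longrightarrow> f i \<in> alg_int_polys) \<Longrightarrow> prod f I \<in> alg_int_polys"
proof (induction I rule: infinite_finite_induct)
  have "1 \<in> alg_int_polys" unfolding alg_int_polys_def by (auto simp: coeff_1)
  then show "prod f {} \<in> alg_int_polys" "\<And>A. infinite A \<Longrightarrow> prod f A \<in> alg_int_polys" by simp_all
qed (auto intro: alg_int_polys_mult)

lemma linear_alg_int_polys: "algebraic_int x \<Longrightarrow> [:- x, 1:] \<in> alg_int_polys"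
  unfolding alg_int_polys_def by (auto simp: coeff_pCons split: nat.split)

lemma int_poly_exists:
  assumes "\<And>i. coeff p i \<in> (\<int> :: complex set)"
  obtains H where "p = of_int_poly H"
proof -
  have "p = of_int_poly (map_poly (\<lambda>z. \<lfloor>Re z\<rfloor>) p)"
  proof (rule poly_eqI)
    fix i
    obtain k where "coeff p i = of_int k" using assms[of i] by (auto elim: Ints_cases)
    then show "coeff p i = coeff (of_int_poly (map_poly (\<lambda>z. \<lfloor>Re z\<rfloor>) p)) i"
      by (simp add: coeff_map_poly)
  qed
  then show ?thesis using that by blast
qed

lemma hom_on_algebraic_int:
  assumes K: "subfield K complex_ring" and \<sigma>: "hom_on K \<sigma>" and x: "x \<in> K" "algebraic_int x"
  shows "algebraic_int (\<sigma> x)"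
proof -
  obtain p where p: "lead_coeff p = 1" "\<forall>i. coeff p i \<in> \<int>" "poly p x = 0"
    using x(2) by (auto elim: algebraic_int.cases)
  have "coeff p i \<in> \<rat>" for i using p(2) Ints_subset_Rats by blast
  then have pQ: "p \<in> polys_over \<rat>" unfolding polys_over_def by blast
  then have "p \<in> polys_over K" using polys_over_mono[OF Rats_subset_subfield[OF K]] by blast
  then have "poly p (\<sigma> x) = 0"
    using poly_map_hom[OF K \<sigma> _ x(1)] map_hom_Rats[OF K \<sigma> pQ] p(3) hom_on_0[OF K \<sigma>] by force
  then show ?thesis using p by (blast intro: algebraic_int.intros)
qed

context splitting
begin

abbreviation "G \<equiv> carrier (Gal K)"

lemma Gal_algebraic_int: "\<sigma> \<in> G \<Longrightarrow> x \<in> K \<Longrightarrow> algebraic_int x \<Longrightarrow> algebraic_int (\<sigma> x)"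
  using hom_on_algebraic_int[OF subfield_K Gal_hom] .

lemma Gal_compose_bij:
  assumes "\<tau> \<in> G"
  shows "bij_betw (compose K \<tau>) G G"
proof -
  have "inj_on (compose K \<tau>) G"
  proof (rule inj_onI)
    fix \<sigma> \<sigma>' assume *: "\<sigma> \<in> G" "\<sigma>' \<in> G" "compose K \<tau> \<sigma> = compose K \<tau> \<sigma>'"
    have "\<sigma> x = \<sigma>' x" if x: "x \<in> set xs" for x
    proof -
      have xK: "x \<in> K" using x roots_in_K by blast
      then have "\<tau> (\<sigma> x) = \<tau> (\<sigma>' x)" using fun_cong[OF *(3), of x] by (simp add: compose_def)
      then show ?thesis
        using hom_on_inj[OF subfield_K Gal_hom[OF assms]] Gal_in_K[OF *(1) xK] Gal_in_K[OF *(2) xK]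
        by (auto dest: inj_onD)
    qed
    then show "\<sigma> = \<sigma>'" using Gal_eqI * by blast
  qed
  moreover have "compose K \<tau> ` G \<subseteq> G" using Gal_compose assms by blast
  ultimately show ?thesis using endo_inj_surj[OF finite_Gal] by (simp add: bij_betw_def)
qed

lemma invariant_Ints:
  assumes "x \<in> K" "algebraic_int x" "\<And>\<sigma>. \<sigma> \<in> G \<Longrightarrow> \<sigma> x = x"
  shows "x \<in> \<int>"
  using assms fixed_field rational_algebraic_int_is_int by blast

lemma trace_Ints:
  assumes x: "x \<in> K" "algebraic_int x"
  shows "(\<Sum>\<sigma>\<in>G. \<sigma> x) \<in> \<int>"
proof (rule invariant_Ints)
  show "(\<Sum>\<sigma>\<in>G. \<sigma> x) \<in> K" by (rule subfield_sum[OF subfield_K]) (erule Gal_in_K[OF _ x(1)])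
  show "algebraic_int (\<Sum>\<sigma>\<in>G. \<sigma> x)" by (rule algebraic_int_sum) (erule Gal_algebraic_int[OF _ x])
  fix \<tau> assume \<tau>: "\<tau> \<in> G"
  have "\<tau> (\<Sum>\<sigma>\<in>G. \<sigma> x) = (\<Sum>\<sigma>\<in>G. \<tau> (\<sigma> x))"
    by (rule hom_on_sum[OF subfield_K Gal_hom[OF \<tau>]]) (erule Gal_in_K[OF _ x(1)])
  also have "\<dots> = (\<Sum>\<sigma>\<in>G. compose K \<tau> \<sigma> x)" using x(1) by (simp add: compose_def)
  also have "\<dots> = (\<Sum>\<sigma>\<in>G. \<sigma> x)" by (rule sum.reindex_bij_betw[OF Gal_compose_bij[OF \<tau>]])
  finally show "\<tau> (\<Sum>\<sigma>\<in>G. \<sigma> x) = (\<Sum>\<sigma>\<in>G. \<sigma> x)" .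
qed

lemma norm_Ints:
  assumes x: "x \<in> K" "algebraic_int x"
  shows "(\<Prod>\<sigma>\<in>G. \<sigma> x) \<in> \<int>"
proof (rule invariant_Ints)
  show "(\<Prod>\<sigma>\<in>G. \<sigma> x) \<in> K" by (rule subfield_prod[OF subfield_K]) (erule Gal_in_K[OF _ x(1)])
  show "algebraic_int (\<Prod>\<sigma>\<in>G. \<sigma> x)" by (rule algebraic_int_prod) (erule Gal_algebraic_int[OF _ x])
  fix \<tau> assume \<tau>: "\<tau> \<in> G"
  have "\<tau> (\<Prod>\<sigma>\<in>G. \<sigma> x) = (\<Prod>\<sigma>\<in>G. \<tau> (\<sigma> x))"
    by (rule hom_on_prod[OF subfield_K Gal_hom[OF \<tau>]]) (erule Gal_in_K[OF _ x(1)])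
  also have "\<dots> = (\<Prod>\<sigma>\<in>G. compose K \<tau> \<sigma> x)" using x(1) by (simp add: compose_def)
  also have "\<dots> = (\<Prod>\<sigma>\<in>G. \<sigma> x)" by (rule prod.reindex_bij_betw[OF Gal_compose_bij[OF \<tau>]])
  finally show "\<tau> (\<Prod>\<sigma>\<in>G. \<sigma> x) = (\<Prod>\<sigma>\<in>G. \<sigma> x)" .
qed

lemma linear_polys_over_K: "x \<in> K \<Longrightarrow> [:- x, 1:] \<in> polys_over K"
  by (intro polys_over_pCons[OF subfield_K] polys_over_0[OF subfield_K] subfieldD(2,5)[OF subfield_K])

lemma map_hom_linear:
  assumes "\<tau> \<in> G" "x \<in> K"
  shows "map_poly \<tau> [:- x, 1:] = [:- \<tau> x, 1:]"
  using hom_on_minus[OF subfield_K Gal_hom[OF assms(1)] assms(2)] hom_on_1[OF subfield_K Gal_hom[OF assms(1)]]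
  by (simp add: map_hom_pCons[OF subfield_K Gal_hom[OF assms(1)]])

text \<open>An automorphism permutes the factors, so the coefficients are invariant algebraic
  integers, that is, rational integers.\<close>

lemma charpoly_int:
  assumes x: "x \<in> K" "algebraic_int x"
  obtains H where "(\<Prod>\<sigma>\<in>G. [:- \<sigma> x, 1:]) = of_int_poly H"
proof (rule int_poly_exists)
  let ?h = "\<Prod>\<sigma>\<in>G. [:- \<sigma> x, 1:]"
  have lin: "[:- \<sigma> x, 1:] \<in> polys_over K" if "\<sigma> \<in> G" for \<sigma>
    by (rule linear_polys_over_K[OF Gal_in_K[OF that x(1)]])
  fix i show "coeff ?h i \<in> \<int>"
  proof (rule invariant_Ints)
    have "?h \<in> polys_over K" by (rule polys_over_prod[OF subfield_K lin])
    then show "coeff ?h i \<in> K" unfolding polys_over_def by blast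
    have "?h \<in> alg_int_polys" by (rule alg_int_polys_prod, rule linear_alg_int_polys, erule Gal_algebraic_int[OF _ x])
    then show "algebraic_int (coeff ?h i)" unfolding alg_int_polys_def by blast
    fix \<tau> assume \<tau>: "\<tau> \<in> G"
    have "map_poly \<tau> ?h = (\<Prod>\<sigma>\<in>G. map_poly \<tau> [:- \<sigma> x, 1:])"
      by (rule map_hom_prod[OF subfield_K Gal_hom[OF \<tau>] lin])
    also have "\<dots> = (\<Prod>\<sigma>\<in>G. [:- compose K \<tau> \<sigma> x, 1:])"
      by (intro prod.cong refl) (simp only: map_hom_linear[OF \<tau> Gal_in_K[OF _ x(1)]] compose_eq[OF x(1)])
    also have "\<dots> = ?h" by (rule prod.reindex_bij_betw[OF Gal_compose_bij[OF \<tau>]])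
    finally have "coeff (map_poly \<tau> ?h) i = coeff ?h i" by simp
    then show "\<tau> (coeff ?h i) = coeff ?h i" by (simp add: coeff_map_hom[OF subfield_K Gal_hom[OF \<tau>]])
  qed
qed

text \<open>\<open>x\<close> is a root of its characteristic polynomial \<open>H\<close>, so the
  value of \<open>H\<close> at \<open>x ^ q\<close> is congruent to 0. This value is the product of
  all \<open>x ^ q - \<sigma> x\<close>, and the prime \<open>P\<close> contains one factor. The
  automorphism depends on \<open>x\<close>; it is not claimed to act as the Frobenius on other
  elements.\<close>

lemma frobenius_conjugate:
  assumes P: "alg_prime P" and q: "prime q" "of_nat q \<in> P" and x: "x \<in> K" "algebraic_int x"
  obtains \<sigma> where "\<sigma> \<in> G" "x ^ q - \<sigma> x \<in> P"
proof -
  obtain H where H: "(\<Prod>\<sigma>\<in>G. [:- \<sigma> x, 1:]) = of_int_poly H" using charpoly_int[OF x] .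
  have "poly (of_int_poly H) x = 0"
    unfolding H[symmetric] poly_prod using finite_Gal Gal_id x(1) by (auto intro!: bexI[of _ "\<lambda>x\<in>K. x"])
  then have "0 - poly (of_int_poly H) (x ^ q) \<in> P"
    using frobenius_int_poly[OF P q x(2), of H] prime_gt_0_nat[OF q(1)] by (simp add: power_0_left)
  then have "poly (of_int_poly H) (x ^ q) \<in> P" using alg_prime_minus_commute[OF P, of 0] by simp
  then have "(\<Prod>\<sigma>\<in>G. x ^ q - \<sigma> x) \<in> P" unfolding H[symmetric] poly_prod by simp
  moreover have "algebraic_int (x ^ q - \<sigma> x)" if "\<sigma> \<in> G" for \<sigma>
    by (rule algebraic_int_diff[OF algebraic_int_power[OF x(2)] Gal_algebraic_int[OF that x]])
  ultimately obtain \<sigma> where "\<sigma> \<in> G" "x ^ q - \<sigma> x \<in> P"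
    using alg_prime_prod[OF P finite_Gal, of "\<lambda>\<sigma>. x ^ q - \<sigma> x"] by blast
  then show ?thesis using that by blast
qed

text \<open>\<open>\<theta>\<close> is the value at a natural number \<open>m\<close> of the
  polynomial whose coefficients are the roots, and an automorphism acts on these coefficients. A
  nontrivial one changes the polynomial and so can fix \<open>\<theta>\<close> for finitely many
  \<open>m\<close> only.\<close>

lemma primitive_element:
  assumes "\<And>x. x \<in> set xs \<Longrightarrow> algebraic_int x"
  obtains \<theta> where "\<theta> \<in> K" "algebraic_int \<theta>" "\<And>\<sigma>. \<sigma> \<in> G \<Longrightarrow> \<sigma> \<theta> = \<theta> \<Longrightarrow> \<sigma> = (\<lambda>x\<in>K. x)"
proof -
  define D where "D \<sigma> = Poly (map \<sigma> xs) - Poly xs" for \<sigma>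
  define B where "B = (\<Union>\<sigma>\<in>G - {\<lambda>x\<in>K. x}. {z. poly (D \<sigma>) z = 0})"
  have "D \<sigma> \<noteq> 0" if \<sigma>: "\<sigma> \<in> G - {\<lambda>x\<in>K. x}" for \<sigma>
  proof
    assume "D \<sigma> = 0"
    then have e: "Poly (map \<sigma> xs) = Poly xs" unfolding D_def by simp
    have "\<sigma> x = (\<lambda>x\<in>K. x) x" if x: "x \<in> set xs" for x
    proof -
      obtain i where i: "i < length xs" "x = xs ! i" using x by (auto simp: in_set_conv_nth)
      have "coeff (Poly (map \<sigma> xs)) i = coeff (Poly xs) i" unfolding e ..
      moreover have "xs ! i \<in> K" using i(1) roots_in_K by auto
      ultimately show ?thesis using i by (simp add: nth_default_def)
    qed
    then have "\<sigma> = (\<lambda>x\<in>K. x)" using Gal_eqI \<sigma> Gal_id by blast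
    then show False using \<sigma> by simp
  qed
  then have "finite B" unfolding B_def using finite_Gal by (auto intro: poly_roots_finite)
  then have "finite (of_nat -` B :: nat set)" by (rule finite_vimageI) (simp add: inj_on_def)
  then obtain m where m: "m \<notin> (of_nat -` B :: nat set)" using infinite_UNIV_nat by (metis UNIV_I finite_subset subsetI)
  define \<theta> where "\<theta> = poly (Poly xs) (of_nat m)"
  have pe: "poly (Poly ys) (of_nat m) = (\<Sum>i<length ys. of_int (int m ^ i) * ys ! i)" for ys :: "complex list"
  proof (induction ys)
    case (Cons y ys)
    have "(\<Sum>i<length (y # ys). of_int (int m ^ i) * (y # ys) ! i) =
       y + of_nat m * (\<Sum>i<length ys. of_int (int m ^ i) * ys ! i)"
      unfolding length_Cons sum.lessThan_Suc_shift by (simp add: sum_distrib_left mult.assoc)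
    then show ?case using Cons by simp
  qed simp
  have xsK: "i < length xs \<Longrightarrow> xs ! i \<in> K" for i using roots_in_K by auto
  show ?thesis
  proof (rule that)
    show "\<theta> \<in> K" unfolding \<theta>_def pe
      by (intro subfield_sum[OF subfield_K] subfieldD(4)[OF subfield_K] subfield_of_int[OF subfield_K]) (simp add: xsK)
    show "algebraic_int \<theta>" unfolding \<theta>_def pe
      by (intro algebraic_int_closed assms) auto
    fix \<sigma> assume \<sigma>: "\<sigma> \<in> G" "\<sigma> \<theta> = \<theta>"
    have "\<sigma> \<theta> = (\<Sum>i<length xs. \<sigma> (of_int (int m ^ i) * xs ! i))"
      unfolding \<theta>_def pe
      by (rule hom_on_sum[OF subfield_K Gal_hom[OF \<sigma>(1)]])
         (intro subfieldD(4)[OF subfield_K] subfield_of_int[OF subfield_K], simp add: xsK)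
    also have "\<dots> = (\<Sum>i<length xs. of_int (int m ^ i) * map \<sigma> xs ! i)"
      by (intro sum.cong refl)
         (simp only: lessThan_iff hom_on_mult[OF subfield_K Gal_hom[OF \<sigma>(1)]] subfield_of_int[OF subfield_K] xsK
            hom_on_of_int[OF subfield_K Gal_hom[OF \<sigma>(1)]] nth_map)
    also have "\<dots> = poly (Poly (map \<sigma> xs)) (of_nat m)" unfolding pe by simp
    finally have "poly (D \<sigma>) (of_nat m) = 0" using \<sigma>(2) unfolding D_def \<theta>_def by simp
    then show "\<sigma> = (\<lambda>x\<in>K. x)" using m \<sigma>(1) unfolding B_def by auto
  qed
qed

text \<open>Lagrange interpolation at the conjugates of a primitive element \<open>\<theta>\<close> writes \<open>x\<close> times the different
  of \<open>\<theta>\<close> as a combination of powers of \<open>\<theta>\<close> whose coefficients are traces; these are divisible by \<open>p\<close>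
  as soon as \<open>x\<close> lies in all primes above \<open>p\<close>.\<close>

lemma reduced_almost_everywhere:
  assumes "\<And>x. x \<in> set xs \<Longrightarrow> algebraic_int x"
  obtains N :: int where "N \<noteq> 0"
    "\<And>p x y. prime p \<Longrightarrow> \<not> int p dvd N \<Longrightarrow> x \<in> K \<Longrightarrow> algebraic_int x \<Longrightarrow> algebraic_int y \<Longrightarrow>
       x ^ 2 = of_nat p * y \<Longrightarrow> \<exists>z. algebraic_int z \<and> x = of_nat p * z"
proof -
  obtain \<theta> where \<theta>: "\<theta> \<in> K" "algebraic_int \<theta>" "\<And>\<sigma>. \<sigma> \<in> G \<Longrightarrow> \<sigma> \<theta> = \<theta> \<Longrightarrow> \<sigma> = (\<lambda>x\<in>K. x)"
    using primitive_element assms by blast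
  let ?e = "\<lambda>x\<in>K. x"
  define h where "h \<sigma> = (\<Prod>\<tau>\<in>G - {\<sigma>}. [:- \<tau> \<theta>, 1:])" for \<sigma>
  have lin: "[:- \<sigma> \<theta>, 1:] \<in> polys_over K" if "\<sigma> \<in> G" for \<sigma>
    by (rule linear_polys_over_K[OF Gal_in_K[OF that \<theta>(1)]])
  have hK: "h \<sigma> \<in> polys_over K" for \<sigma> unfolding h_def by (rule polys_over_prod[OF subfield_K lin]) simp
  have hA: "h \<sigma> \<in> alg_int_polys" for \<sigma> unfolding h_def
    by (rule alg_int_polys_prod, rule linear_alg_int_polys, rule Gal_algebraic_int[OF _ \<theta>(1,2)]) simp
  have map_h: "map_poly \<sigma> (h ?e) = h \<sigma>" if \<sigma>: "\<sigma> \<in> G" for \<sigma>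
  proof -
    have "\<sigma> \<in> extensional K" using \<sigma> unfolding Gal_carrier[OF subfield_K] by blast
    then have "compose K \<sigma> ?e = \<sigma>" by (intro extensionalityI[of _ K]) (auto simp: compose_def)
    then have bij: "bij_betw (compose K \<sigma>) (G - {?e}) (G - {\<sigma>})"
      using bij_betw_DiffI[OF Gal_compose_bij[OF \<sigma>], of "{?e}" "{\<sigma>}"] Gal_id \<sigma> by (simp add: bij_betw_def)
    have "map_poly \<sigma> (h ?e) = (\<Prod>\<tau>\<in>G - {?e}. map_poly \<sigma> [:- \<tau> \<theta>, 1:])"
      unfolding h_def by (rule map_hom_prod[OF subfield_K Gal_hom[OF \<sigma>]]) (rule lin, simp)
    also have "\<dots> = (\<Prod>\<tau>\<in>G - {?e}. [:- compose K \<sigma> \<tau> \<theta>, 1:])"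
      by (intro prod.cong refl) (simp only: map_hom_linear[OF \<sigma> Gal_in_K[OF _ \<theta>(1)]] compose_eq[OF \<theta>(1)] Diff_iff)
    also have "\<dots> = h \<sigma>" unfolding h_def by (rule prod.reindex_bij_betw[OF bij])
    finally show ?thesis .
  qed
  \<comment> \<open>This is the product of the differences of \<open>\<theta>\<close> from its other
    conjugates, nonzero because only the identity fixes \<open>\<theta>\<close>. Its norm is the
    exceptional number \<open>N\<close>, with cofactor \<open>d'\<close>.\<close>
  define d where "d = poly (h ?e) \<theta>"
  have dK: "d \<in> K" unfolding d_def by (rule poly_in_subfield[OF subfield_K hK \<theta>(1)])
  have "d = (\<Prod>\<tau>\<in>G - {?e}. \<theta> - \<tau> \<theta>)" unfolding d_def h_def poly_prod by simp
  moreover have "algebraic_int (\<theta> - \<tau> \<theta>)" "\<theta> - \<tau> \<theta> \<noteq> 0" if "\<tau> \<in> G - {?e}" for \<tau>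
    using that algebraic_int_diff[OF \<theta>(2) Gal_algebraic_int[OF _ \<theta>(1,2)]] \<theta>(3)[of \<tau>] by auto
  ultimately have d0: "d \<noteq> 0" and dA: "algebraic_int d"
    using finite_Gal algebraic_int_prod[of "G - {?e}" "\<lambda>\<tau>. \<theta> - \<tau> \<theta>"] by (auto simp: prod_zero_iff)
  obtain N where N: "(\<Prod>\<sigma>\<in>G. \<sigma> d) = of_int N" using norm_Ints[OF dK dA] by (auto elim: Ints_cases)
  define d' where "d' = (\<Prod>\<sigma>\<in>G - {?e}. \<sigma> d)"
  have d'A: "algebraic_int d'" unfolding d'_def by (rule algebraic_int_prod, rule Gal_algebraic_int[OF _ dK dA]) simp
  have Nd: "of_int N = d * d'"
    unfolding N[symmetric] d'_def using prod.remove[OF finite_Gal Gal_id, of "\<lambda>\<sigma>. \<sigma> d"] dK by simp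
  have N0: "N \<noteq> 0"
  proof
    assume "N = 0"
    then obtain \<sigma> where \<sigma>: "\<sigma> \<in> G" "\<sigma> d = 0" using N finite_Gal by auto
    then have "\<sigma> d = \<sigma> 0" using hom_on_0[OF subfield_K Gal_hom] by simp
    then show False using hom_on_inj[OF subfield_K Gal_hom[OF \<sigma>(1)]] dK d0 subfieldD(1)[OF subfield_K]
      by (auto dest: inj_onD)
  qed
  show ?thesis
  proof (rule that[OF N0])
    fix p x y
    assume p: "prime p" "\<not> int p dvd N" and x: "x \<in> K" "algebraic_int x"
      and y: "algebraic_int y" "x ^ 2 = of_nat p * y"
    obtain P where P: "alg_prime P" "of_nat p \<in> P" using alg_prime_exists[OF p(1)] .
    define L where "L = (\<Sum>\<sigma>\<in>G. Polynomial.smult (\<sigma> x) (h \<sigma>))"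
    have yK: "y \<in> K"
    proof -
      have "y = x ^ 2 * inverse (of_int (int p))" using y(2) p(1) by (auto simp: field_simps)
      then show ?thesis using x subfieldD(4,7)[OF subfield_K] subfield_power[OF subfield_K] subfield_of_int[OF subfield_K] by metis
    qed
    have "\<exists>k. coeff L j = of_nat p * of_int k" for j
    proof -
      let ?w = "coeff (h ?e) j"
      have w: "?w \<in> K" "algebraic_int ?w" using hK hA unfolding polys_over_def alg_int_polys_def by auto
      have xw: "x * ?w \<in> K" "algebraic_int (x * ?w)" using x w subfieldD(4)[OF subfield_K] algebraic_int_mult by auto
      have "coeff L j = (\<Sum>\<sigma>\<in>G. \<sigma> x * coeff (h \<sigma>) j)" unfolding L_def coeff_sum by simp
      also have "\<dots> = (\<Sum>\<sigma>\<in>G. \<sigma> (x * ?w))"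
        by (intro sum.cong refl, subst map_h[symmetric])
           (simp_all add: coeff_map_hom[OF subfield_K Gal_hom] hom_on_mult[OF subfield_K Gal_hom] x w)
      finally have e: "coeff L j = (\<Sum>\<sigma>\<in>G. \<sigma> (x * ?w))" .
      obtain t where t: "(\<Sum>\<sigma>\<in>G. \<sigma> (x * ?w)) = of_int t" using trace_Ints[OF xw] by (auto elim: Ints_cases)
      have "\<sigma> (x * ?w) \<in> P" if \<sigma>: "\<sigma> \<in> G" for \<sigma>
      proof -
        note hm = hom_on_mult[OF subfield_K Gal_hom[OF \<sigma>]]
        have "\<sigma> x ^ 2 = of_nat p * \<sigma> y"
          using hom_on_power[OF subfield_K Gal_hom[OF \<sigma>] x(1), of 2] y(2) hm[OF subfield_of_int[OF subfield_K, of "int p"] yK]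
            hom_on_of_int[OF subfield_K Gal_hom[OF \<sigma>], of "int p"] by simp
        then have "\<sigma> x ^ 2 \<in> P" using alg_prime_mult[OF P] Gal_algebraic_int[OF \<sigma> yK y(1)] by simp
        then have "\<sigma> x \<in> P" using alg_prime_power[OF P(1)] Gal_algebraic_int[OF \<sigma> x] by blast
        then show ?thesis unfolding hm[OF x(1) w(1)] using alg_prime_mult[OF P(1)] Gal_algebraic_int[OF \<sigma> w] by blast
      qed
      then have "of_int t \<in> P" unfolding t[symmetric] by (rule alg_prime_sum[OF P(1)])
      then obtain k where "t = int p * k" using alg_prime_of_int[OF P(1) p(1) P(2)] by (metis dvdE)
      then show ?thesis unfolding e t by (intro exI[of _ k]) simp
    qed
    then obtain k where k: "\<And>j. coeff L j = of_nat p * of_int (k j)" by metis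
    have "poly L \<theta> = (\<Sum>\<sigma>\<in>G. \<sigma> x * poly (h \<sigma>) \<theta>)" unfolding L_def poly_sum by simp
    also have "\<dots> = x * d + (\<Sum>\<sigma>\<in>G - {?e}. \<sigma> x * poly (h \<sigma>) \<theta>)"
      using sum.remove[OF finite_Gal Gal_id, of "\<lambda>\<sigma>. \<sigma> x * poly (h \<sigma>) \<theta>"] x(1) unfolding d_def by simp
    also have "(\<Sum>\<sigma>\<in>G - {?e}. \<sigma> x * poly (h \<sigma>) \<theta>) = 0"
    proof (rule sum.neutral, intro ballI)
      fix \<sigma> assume "\<sigma> \<in> G - {?e}"
      then have "?e \<in> G - {\<sigma>}" using Gal_id by auto
      then have "poly (h \<sigma>) \<theta> = 0"
        unfolding h_def poly_prod using finite_Gal \<theta>(1) by (intro prod_zero) (auto intro!: bexI[of _ ?e])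
      then show "\<sigma> x * poly (h \<sigma>) \<theta> = 0" by simp
    qed
    finally have "x * d = poly L \<theta>" by simp
    also have "\<dots> = of_nat p * (\<Sum>j\<le>degree L. of_int (k j) * \<theta> ^ j)"
      unfolding poly_altdef k by (simp add: sum_distrib_left mult.assoc)
    finally have xd: "x * d = of_nat p * (\<Sum>j\<le>degree L. of_int (k j) * \<theta> ^ j)" .
    \<comment> \<open>Multiplication by \<open>d'\<close> turns the different into its norm
      \<open>N\<close>; a Bezout relation between \<open>N\<close> and \<open>p\<close> then removes
      \<open>N\<close>.\<close>
    define s where "s = d' * (\<Sum>j\<le>degree L. of_int (k j) * \<theta> ^ j)"
    have sA: "algebraic_int s" unfolding s_def by (intro algebraic_int_closed d'A \<theta>)
    have Nx: "of_int N * x = of_nat p * s" unfolding Nd s_def using xd by (simp add: mult_ac)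
    have "coprime (int p) N" using p by (simp add: prime_imp_coprime)
    then obtain u v where "u * int p + v * N = 1" by (metis bezout_int coprime_imp_gcd_eq_1)
    then have "of_int (u * int p + v * N) = (1 :: complex)" by simp
    then have "x = (of_int u * of_nat p + of_int v * of_int N) * x" by simp
    also have "\<dots> = of_nat p * (of_int u * x) + of_int v * (of_int N * x)" by (simp add: algebra_simps)
    also have "\<dots> = of_nat p * (of_int u * x + of_int v * s)" unfolding Nx by (simp add: algebra_simps)
    finally have "x = of_nat p * (of_int u * x + of_int v * s)" .
    then show "\<exists>z. algebraic_int z \<and> x = of_nat p * z"
      by (intro exI[of _ "of_int u * x + of_int v * s"] conjI algebraic_int_closed x sA)
  qed
qed

end

section \<open>The discriminant of the quintic\<close>

text \<open>Laplace expansion in a form whose minors are again matrices given by a function, so that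
  it can be iterated on symbolic entries.\<close>

lemma det_Suc_first_row:
  "det (mat (Suc n) (Suc n) h) =
    (\<Sum>j<Suc n. (-1) ^ j * h (0, j) * det (mat n n (\<lambda>(a, b). h (Suc a, if b < j then b else Suc b))))"
proof -
  let ?A = "mat (Suc n) (Suc n) h"
  have "det ?A = (\<Sum>j<Suc n. ?A $$ (0, j) * cofactor ?A 0 j)"
    by (rule laplace_expansion_row) auto
  also have "\<dots> = (\<Sum>j<Suc n. (-1) ^ j * h (0, j) * det (mat n n (\<lambda>(a, b). h (Suc a, if b < j then b else Suc b))))"
  proof (intro sum.cong refl)
    fix j assume "j \<in> {..<Suc n}"
    then have "mat_delete ?A 0 j = mat n n (\<lambda>(a, b). h (Suc a, if b < j then b else Suc b))"
      unfolding mat_delete_def by (intro eq_matI) auto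
    then show "?A $$ (0, j) * cofactor ?A 0 j =
        (-1) ^ j * h (0, j) * det (mat n n (\<lambda>(a, b). h (Suc a, if b < j then b else Suc b)))"
      using \<open>j \<in> {..<Suc n}\<close> by (simp add: cofactor_def)
  qed
  finally show ?thesis .
qed

lemma det_mat_1: "det (mat (Suc 0) (Suc 0) h) = h (0, 0)"
  by (simp add: det_Suc_first_row)

lemma det_mat_2: "det (mat (Suc (Suc 0)) (Suc (Suc 0)) h) = h (0, 0) * h (1, 1) - h (0, 1) * h (1, 0)"
  by (subst det_Suc_first_row) (simp add: det_mat_1 lessThan_Suc)

lemma det_mat_3:
  "det (mat (Suc (Suc (Suc 0))) (Suc (Suc (Suc 0))) h) =
    h (0, 0) * (h (1, 1) * h (2, 2) - h (1, 2) * h (2, 1)) - h (0, 1) * (h (1, 0) * h (2, 2) - h (1, 2) * h (2, 0))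
    + h (0, 2) * (h (1, 0) * h (2, 1) - h (1, 1) * h (2, 0))"
  by (subst det_Suc_first_row) (simp add: det_mat_2 lessThan_Suc numeral_2_eq_2)

lemma det_mat_4:
  fixes h :: "nat \<times> nat \<Rightarrow> 'a :: comm_ring_1"
  defines "M\<^sub>2 \<equiv> \<lambda>i j. h (2, i) * h (3, j) - h (2, j) * h (3, i)"
  defines "M\<^sub>3 \<equiv> \<lambda>i j k. h (1, i) * M\<^sub>2 j k - h (1, j) * M\<^sub>2 i k + h (1, k) * M\<^sub>2 i j"
  shows "det (mat (Suc (Suc (Suc (Suc 0)))) (Suc (Suc (Suc (Suc 0)))) h) =
    h (0, 0) * M\<^sub>3 1 2 3 - h (0, 1) * M\<^sub>3 0 2 3 + h (0, 2) * M\<^sub>3 0 1 3 - h (0, 3) * M\<^sub>3 0 1 2"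
  unfolding M\<^sub>3_def M\<^sub>2_def
  by (subst det_Suc_first_row) (simp add: det_mat_3 lessThan_Suc numeral_2_eq_2 numeral_3_eq_3)

lemma det_mat_5:
  fixes h :: "nat \<times> nat \<Rightarrow> 'a :: comm_ring_1"
  defines "M\<^sub>2 \<equiv> \<lambda>i j. h (3, i) * h (4, j) - h (3, j) * h (4, i)"
  defines "M\<^sub>3 \<equiv> \<lambda>i j k. h (2, i) * M\<^sub>2 j k - h (2, j) * M\<^sub>2 i k + h (2, k) * M\<^sub>2 i j"
  defines "M\<^sub>4 \<equiv> \<lambda>i j k l. h (1, i) * M\<^sub>3 j k l - h (1, j) * M\<^sub>3 i k l + h (1, k) * M\<^sub>3 i j l - h (1, l) * M\<^sub>3 i j k"
  shows "det (mat 5 5 h) = h (0, 0) * M\<^sub>4 1 2 3 4 - h (0, 1) * M\<^sub>4 0 2 3 4 + h (0, 2) * M\<^sub>4 0 1 3 4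
    - h (0, 3) * M\<^sub>4 0 1 2 4 + h (0, 4) * M\<^sub>4 0 1 2 3"
proof -
  have 5: "5 = Suc (Suc (Suc (Suc (Suc 0))))" by simp
  show ?thesis unfolding 5 M\<^sub>4_def M\<^sub>3_def M\<^sub>2_def
    by (subst det_Suc_first_row) (simp add: det_mat_4 lessThan_Suc eval_nat_numeral)
qed

section \<open>The quintic and the power sums of its roots\<close>

definition quintic :: "int \<Rightarrow> int poly"
  where "quintic T = [:24 - 9 * T, 25 - 3 * T, - T, - 10, 0, 1:]"

text \<open>A square root of the discriminant of \<open>quintic T\<close>.\<close>

definition disc_sqrt :: "int \<Rightarrow> int"
  where "disc_sqrt T = - 27 * T ^ 3 + 6480 * T ^ 2 - 28400 * T + 24000"

lemma vieta_quintic: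
  fixes a b c d e :: complex
  assumes "of_int_poly (quintic T) = [:- a, 1:] * [:- b, 1:] * [:- c, 1:] * [:- d, 1:] * [:- e, 1:]"
  shows "a + b + c + d + e = 0"
    "a*b + a*c + a*d + a*e + b*c + b*d + b*e + c*d + c*e + d*e = -10"
    "a*b*c + a*b*d + a*b*e + a*c*d + a*c*e + a*d*e + b*c*d + b*c*e + b*d*e + c*d*e = of_int T"
    "a*b*c*d + a*b*c*e + a*b*d*e + a*c*d*e + b*c*d*e = 25 - 3 * of_int T"
    "a*b*c*d*e = 9 * of_int T - 24"
  using assms by (simp_all add: quintic_def hom_distribs algebra_simps)

text \<open>The 5 by 5 Hankel matrix has the power sums of index 0 to 8 as entries. Those up to 4
  come from Newton's identities, the others from the equation multiplied by \<open>x ^ n\<close> and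
  summed over the roots.\<close>

lemma quintic_power_sums:
  fixes a b c d e :: complex
  assumes f: "of_int_poly (quintic T) = [:- a, 1:] * [:- b, 1:] * [:- c, 1:] * [:- d, 1:] * [:- e, 1:]"
  defines "p \<equiv> \<lambda>n. a ^ n + b ^ n + c ^ n + d ^ n + e ^ n" and "t \<equiv> of_int T"
  shows "p 0 = 5" "p 1 = 0" "p 2 = 20" "p 3 = 3 * t" "p 4 = 100 + 12 * t" "p 5 = 95 * t - 120"
    "p 6 = 3 * t ^ 2 + 180 * t + 500" "p 7 = 21 * t ^ 2 + 1155 * t - 1680"
    "p 8 = 188 * t ^ 2 + 1608 * t + 2500"
proof -
  note v = vieta_quintic[OF f, folded t_def]
  show 0: "p 0 = 5" and 1: "p 1 = 0" using v(1) by (simp_all add: p_def)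
  have "p 2 = (a + b + c + d + e) ^ 2 - 2 * (a*b + a*c + a*d + a*e + b*c + b*d + b*e + c*d + c*e + d*e)"
    unfolding p_def by Groebner_Basis.algebra
  then show 2: "p 2 = 20" unfolding v by simp
  have "p 3 = (a + b + c + d + e) ^ 3 - 3 * (a + b + c + d + e) * (a*b + a*c + a*d + a*e + b*c + b*d + b*e + c*d + c*e + d*e)
     + 3 * (a*b*c + a*b*d + a*b*e + a*c*d + a*c*e + a*d*e + b*c*d + b*c*e + b*d*e + c*d*e)"
    unfolding p_def by Groebner_Basis.algebra
  then show 3: "p 3 = 3 * t" unfolding v by simp
  have "p 4 = (a + b + c + d + e) ^ 4
     - 4 * (a + b + c + d + e) ^ 2 * (a*b + a*c + a*d + a*e + b*c + b*d + b*e + c*d + c*e + d*e)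
     + 2 * (a*b + a*c + a*d + a*e + b*c + b*d + b*e + c*d + c*e + d*e) ^ 2
     + 4 * (a + b + c + d + e) * (a*b*c + a*b*d + a*b*e + a*c*d + a*c*e + a*d*e + b*c*d + b*c*e + b*d*e + c*d*e)
     - 4 * (a*b*c*d + a*b*c*e + a*b*d*e + a*c*d*e + b*c*d*e)"
    unfolding p_def by Groebner_Basis.algebra
  then show 4: "p 4 = 100 + 12 * t" unfolding v by (simp add: t_def)
  have root: "x ^ (n + 5) = 10 * x ^ (n + 3) + t * x ^ (n + 2) - (25 - 3 * t) * x ^ (n + 1) - (24 - 9 * t) * x ^ n"
    if x: "x \<in> {a, b, c, d, e}" for x n
  proof -
    have "poly (of_int_poly (quintic T)) x = 0" unfolding f poly_mult using x by auto
    then have "x ^ 5 = 10 * x ^ 3 + t * x ^ 2 - (25 - 3 * t) * x - (24 - 9 * t)"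
      unfolding quintic_def t_def by (simp add: hom_distribs) Groebner_Basis.algebra
    then have "x ^ n * x ^ 5 = x ^ n * (10 * x ^ 3 + t * x ^ 2 - (25 - 3 * t) * x - (24 - 9 * t))" by simp
    then show ?thesis by (simp add: power_add algebra_simps power2_eq_square)
  qed
  have rec: "p (n + 5) = 10 * p (n + 3) + t * p (n + 2) - (25 - 3 * t) * p (n + 1) - (24 - 9 * t) * p n" for n
  proof -
    have ra: "a ^ (n + 5) = 10 * a ^ (n + 3) + t * a ^ (n + 2) - (25 - 3 * t) * a ^ (n + 1) - (24 - 9 * t) * a ^ n"
      and rb: "b ^ (n + 5) = 10 * b ^ (n + 3) + t * b ^ (n + 2) - (25 - 3 * t) * b ^ (n + 1) - (24 - 9 * t) * b ^ n"
      and rc: "c ^ (n + 5) = 10 * c ^ (n + 3) + t * c ^ (n + 2) - (25 - 3 * t) * c ^ (n + 1) - (24 - 9 * t) * c ^ n"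
      and rd: "d ^ (n + 5) = 10 * d ^ (n + 3) + t * d ^ (n + 2) - (25 - 3 * t) * d ^ (n + 1) - (24 - 9 * t) * d ^ n"
      and re: "e ^ (n + 5) = 10 * e ^ (n + 3) + t * e ^ (n + 2) - (25 - 3 * t) * e ^ (n + 1) - (24 - 9 * t) * e ^ n"
      by (rule root, blast)+
    show ?thesis unfolding p_def ra rb rc rd re by (simp add: algebra_simps)
  qed
  have "p 5 = 10 * p 3 + t * p 2 - (25 - 3 * t) * p 1 - (24 - 9 * t) * p 0"
    using rec[of 0] by (simp add: numeral_eq_Suc)
  then show 5: "p 5 = 95 * t - 120" unfolding 0 1 2 3 4 by (simp add: algebra_simps)
  have "p 6 = 10 * p 4 + t * p 3 - (25 - 3 * t) * p 2 - (24 - 9 * t) * p 1"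
    using rec[of 1] by (simp add: numeral_eq_Suc)
  then show 6: "p 6 = 3 * t ^ 2 + 180 * t + 500" unfolding 1 2 3 4 5 by (simp add: algebra_simps power2_eq_square)
  have "p 7 = 10 * p 5 + t * p 4 - (25 - 3 * t) * p 3 - (24 - 9 * t) * p 2"
    using rec[of 2] by (simp add: numeral_eq_Suc)
  then show 7: "p 7 = 21 * t ^ 2 + 1155 * t - 1680" unfolding 2 3 4 5 6 by (simp add: algebra_simps power2_eq_square)
  have "p 8 = 10 * p 6 + t * p 5 - (25 - 3 * t) * p 4 - (24 - 9 * t) * p 3"
    using rec[of 3] by (simp add: numeral_eq_Suc)
  then show 8: "p 8 = 188 * t ^ 2 + 1608 * t + 2500" unfolding 3 4 5 6 7 by (simp add: algebra_simps power2_eq_square)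
qed

definition vandermonde :: "(nat \<Rightarrow> complex) \<Rightarrow> complex mat"
  where "vandermonde s = mat 5 5 (\<lambda>(i, k). s i ^ k)"

text \<open>The square of the Vandermonde determinant is the determinant of the Hankel matrix of power sums.\<close>

lemma det_vandermonde_square:
  assumes f: "of_int_poly (quintic T) = [:- s 0, 1:] * [:- s 1, 1:] * [:- s 2, 1:] * [:- s 3, 1:] * [:- s 4, 1:]"
  shows "det (vandermonde s) ^ 2 = of_int (disc_sqrt T) ^ 2"
proof -
  let ?V = "vandermonde s"
  define t :: complex where "t = of_int T"
  define p where "p n = s 0 ^ n + s 1 ^ n + s 2 ^ n + s 3 ^ n + s 4 ^ n" for n
  note ps = quintic_power_sums[OF f, folded p_def t_def]
  have V: "?V \<in> carrier_mat 5 5" unfolding vandermonde_def by simp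
  have "det ?V ^ 2 = det (transpose_mat ?V * ?V)"
    using det_mult[of "transpose_mat ?V" 5 ?V] V det_transpose[OF V] by (simp add: power2_eq_square)
  also have "transpose_mat ?V * ?V = mat 5 5 (\<lambda>(i, j). p (i + j))"
    by (rule eq_matI)
       (auto simp: vandermonde_def scalar_prod_def p_def power_add numeral_eq_Suc sum.atLeast0_lessThan_Suc)
  also have "det (mat 5 5 (\<lambda>(i, j). p (i + j))) = of_int (disc_sqrt T) ^ 2"
    unfolding det_mat_5 split_conv
    by (simp add: ps ps(2)[unfolded One_nat_def] ps(3)[unfolded numeral_2_eq_2] ps(4)[unfolded numeral_3_eq_3] disc_sqrt_def t_def[symmetric]) Groebner_Basis.algebra
  finally show ?thesis .
qed

section \<open>The Galois group of the quintic\<close>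

lemma int_poly_cong:
  assumes P: "alg_prime P" and xy: "algebraic_int x" "algebraic_int y" "x - y \<in> P"
  shows "poly (of_int_poly F) x - poly (of_int_poly F) y \<in> P"
proof (induction F)
  case 0
  then show ?case using alg_prime_0[OF P] by simp
next
  case (pCons a F)
  have alg: "algebraic_int (poly (of_int_poly F) x)"
    by (induction F) (auto simp: hom_distribs intro!: algebraic_int_closed xy)
  let ?u = "poly (of_int_poly F) x" and ?v = "poly (of_int_poly F) y"
  have "(x - y) * ?u + y * (?u - ?v) \<in> P"
    by (intro alg_prime_add[OF P] alg_prime_mult[OF P] alg_prime_mult'[OF P] pCons.IH alg xy)
  then show ?case by (simp add: hom_distribs algebra_simps)
qed

lemma poly_of_int_poly_of_int: "poly (of_int_poly F) (of_int n) = (of_int (poly F n) :: complex)"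
  by (induction F) (simp_all add: hom_distribs)

lemma frobenius_inj_mod:
  assumes P: "alg_prime P" and q: "prime q" "of_nat q \<in> P"
    and xy: "algebraic_int x" "algebraic_int y" "x ^ q - y ^ q \<in> P"
  shows "x - y \<in> P"
proof -
  have d: "algebraic_int (x - y)" by (rule algebraic_int_diff[OF xy(1,2)])
  have "(x - y + y) ^ q - ((x - y) ^ q + y ^ q) \<in> P" by (rule freshman[OF P q d xy(2)])
  then have "(x ^ q - y ^ q) - (x - y) ^ q \<in> P" by (simp add: algebra_simps)
  then have "(x - y) ^ q \<in> P" using alg_prime_cong_iff[OF P] xy(3) by blast
  then show ?thesis using alg_prime_power[OF P d] by blast
qed

abbreviation "I5 \<equiv> {1..5::nat}"

text \<open>The roots are numbered from 1 to 5 because \<open>alt_group 5\<close> acts on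
  \<open>{1..5}\<close>. Their distinctness is not assumed but follows from reduction modulo 2, see
  \<open>inj_r\<close>.\<close>

locale quintic_field =
  fixes T :: int and r :: "nat \<Rightarrow> complex" and K :: "complex set"
  assumes T: "T mod 190 = 1"
    and factors: "of_int_poly (quintic T) = (\<Prod>i\<in>I5. [:- r i, 1:])"
    and K_eq: "K = CC.finite_extension \<rat> (map r [1..<6])"
begin

abbreviation "f \<equiv> of_int_poly (quintic T) :: complex poly"

lemma poly_f: "poly f x = (\<Prod>i\<in>I5. x - r i)"
  unfolding factors poly_prod by simp

lemma poly_f_explicit: "poly f x = x ^ 5 - 10 * x ^ 3 - of_int T * x ^ 2 + (25 - 3 * of_int T) * x + 24 - 9 * of_int T"
  unfolding quintic_def by (simp add: hom_distribs) Groebner_Basis.algebra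

lemma roots_image: "set (map r [1..<6]) = r ` I5"
  by (simp add: image_comp atLeastLessThanSuc_atLeastAtMost[symmetric] flip: set_upt)

sublocale splitting f "map r [1..<6]" K
proof
  show "f \<in> polys_over \<rat>" unfolding polys_over_def by simp
  show "f \<noteq> 0" unfolding quintic_def by simp
  show "set (map r [1..<6]) = {z. poly f z = 0}" unfolding roots_image poly_f by (auto simp: prod_zero_iff)
  show "K = CC.finite_extension \<rat> (map r [1..<6])" by (rule K_eq)
qed

lemma root: "i \<in> I5 \<Longrightarrow> poly f (r i) = 0"
  unfolding poly_f by (auto simp: prod_zero_iff)

lemma root_alg: "i \<in> I5 \<Longrightarrow> algebraic_int (r i)"
  unfolding algebraic_int_altdef_ipoly using root by (intro exI[of _ "quintic T"]) (simp add: quintic_def)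

lemma root_K: "i \<in> I5 \<Longrightarrow> r i \<in> K"
  using roots_in_K unfolding roots_image by blast

lemma T_eq: obtains k where "T = 1 + 190 * k"
  using T by (metis add.commute mod_mult_div_eq)

context
  fixes P q assumes P: "alg_prime P" and q: "prime q" "of_nat q \<in> P"
begin

lemma root_not_cong_int:
  assumes "i \<in> I5" "\<not> int q dvd poly (quintic T) n"
  shows "r i - of_int n \<notin> P"
proof
  assume "r i - of_int n \<in> P"
  then have "poly f (r i) - poly f (of_int n) \<in> P"
    using int_poly_cong[OF P root_alg[OF assms(1)] algebraic_int_of_int] by blast
  then have "0 - of_int (poly (quintic T) n) \<in> P"
    unfolding root[OF assms(1)] poly_of_int_poly_of_int .
  then have "of_int (poly (quintic T) n) \<in> P" using alg_prime_minus_commute[OF P, of 0] by simp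
  then show False using alg_prime_of_int[OF P q] assms(2) by blast
qed

lemma frobenius_root:
  assumes "i \<in> I5"
  obtains j where "j \<in> I5" "r i ^ q - r j \<in> P"
proof -
  have "0 - poly f (r i ^ q) \<in> P"
    using frobenius_int_poly[OF P q root_alg[OF assms], of "quintic T"] prime_gt_0_nat[OF q(1)]
    unfolding root[OF assms] by (simp add: power_0_left)
  then have "poly f (r i ^ q) \<in> P" using alg_prime_minus_commute[OF P, of 0] by simp
  then have "\<exists>j\<in>I5. r i ^ q - r j \<in> P"
    unfolding poly_f using root_alg assms
    by (intro alg_prime_prod[OF P]) (auto intro: algebraic_int_diff algebraic_int_power)
  then show ?thesis using that by blast
qed

end

lemma deriv_explicit:
  "poly (pderiv f) x = 5 * x ^ 4 - 30 * x ^ 2 - 2 * of_int T * x + 25 - 3 * of_int T"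
  unfolding quintic_def by (simp add: hom_distribs pderiv_pCons) Groebner_Basis.algebra

lemma deriv_prod: "poly (pderiv f) x = (\<Sum>i\<in>I5. \<Prod>j\<in>I5 - {i}. x - r j)"
  unfolding factors pderiv_prod poly_sum by (simp add: poly_prod pderiv_pCons)

lemma deriv_root: "i \<in> I5 \<Longrightarrow> poly (pderiv f) (r i) = (\<Prod>j\<in>I5 - {i}. r i - r j)"
proof -
  assume i: "i \<in> I5"
  have "(\<Sum>k\<in>I5 - {i}. \<Prod>j\<in>I5 - {k}. r i - r j) = 0"
  proof (rule sum.neutral, intro ballI)
    fix k assume "k \<in> I5 - {i}"
    then show "(\<Prod>j\<in>I5 - {k}. r i - r j) = 0" using i by (intro prod_zero) auto
  qed
  then show ?thesis unfolding deriv_prod using sum.remove[of I5 i "\<lambda>k. \<Prod>j\<in>I5 - {k}. r i - r j"] i by simp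
qed

lemma deriv_in_prime:
  assumes P: "alg_prime P" and ij: "i \<in> I5" "j \<in> I5" "i \<noteq> j" "r i - r j \<in> P"
  shows "5 * r i ^ 4 - 30 * r i ^ 2 - 2 * of_int T * r i + 25 - 3 * of_int T \<in> P"
proof -
  have "poly (pderiv f) (r i) = (r i - r j) * (\<Prod>k\<in>I5 - {i} - {j}. r i - r k)"
    unfolding deriv_root[OF ij(1)] by (rule prod.remove) (use ij in auto)
  also have "\<dots> \<in> P"
    by (rule alg_prime_mult[OF P ij(4)], rule algebraic_int_prod, rule algebraic_int_diff) (auto intro: root_alg ij)
  finally show ?thesis unfolding deriv_explicit .
qed

text \<open>This is the shape of the explicit certificates below: an element is placed in
  \<open>P\<close> by writing it as a combination of a known member \<open>x\<close> and of the
  prime \<open>q\<close>.\<close>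

lemma alg_prime_int_combination:
  assumes P: "alg_prime P" and "x \<in> P" "of_nat q \<in> P" "algebraic_int c" "algebraic_int d" "y = x * c + of_nat q * d"
  shows "y \<in> P"
  using assms by (auto intro: alg_prime_add alg_prime_mult)

text \<open>For odd \<open>T\<close> the derivative is congruent to \<open>x ^ 4\<close> modulo 2,
  so a multiple root would be congruent to 0, where the quintic has the odd value
  \<open>24 - 9 * T\<close>.\<close>

lemma distinct_mod_2:
  assumes P: "alg_prime P" "of_nat 2 \<in> P" and ij: "i \<in> I5" "j \<in> I5" "i \<noteq> j"
  shows "r i - r j \<notin> P"
proof
  assume d: "r i - r j \<in> P"
  obtain k where k: "T = 1 + 190 * k" by (rule T_eq)
  let ?x = "r i"
  note ai = algebraic_int_closed root_alg[OF ij(1)]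
  note D = deriv_in_prime[OF P(1) ij d]
  have "?x ^ 4 = (5 * r i ^ 4 - 30 * r i ^ 2 - 2 * of_int T * r i + 25 - 3 * of_int T) * of_int 1 +
     of_nat 2 * (of_int (- 2) * ?x ^ 4 + of_int 15 * ?x ^ 2 + of_int T * ?x + of_int (285 * k - 11))"
    unfolding k by (simp add: algebra_simps)
  then have "?x ^ 4 \<in> P"
    by (rule alg_prime_int_combination[OF P(1) D P(2) algebraic_int_of_int, rotated]) (intro ai)
  then have "?x - of_int 0 \<in> P" using alg_prime_power[OF P(1) root_alg[OF ij(1)]] by simp
  moreover have "\<not> int 2 dvd poly (quintic T) 0" unfolding k quintic_def by simp
  ultimately show False using root_not_cong_int[OF P(1) two_is_prime_nat P(2) ij(1)] by blast
qed

text \<open>Modulo 5 the derivative is linear: twice it is congruent to \<open>x - 1\<close>. A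
  multiple root would thus be congruent to 1, where the value of the quintic is congruent to
  27.\<close>

lemma distinct_mod_5:
  assumes P: "alg_prime P" "of_nat 5 \<in> P" and ij: "i \<in> I5" "j \<in> I5" "i \<noteq> j"
  shows "r i - r j \<notin> P"
proof
  assume d: "r i - r j \<in> P"
  obtain k where k: "T = 1 + 190 * k" by (rule T_eq)
  let ?x = "r i"
  note ai = algebraic_int_closed root_alg[OF ij(1)]
  note D = deriv_in_prime[OF P(1) ij d]
  have "?x - of_int 1 = (5 * r i ^ 4 - 30 * r i ^ 2 - 2 * of_int T * r i + 25 - 3 * of_int T) * of_int 2 +
     of_nat 5 * (of_int (- 2) * ?x ^ 4 + of_int 12 * ?x ^ 2 + of_int (1 + 152 * k) * ?x + of_int (228 * k - 9))"
    unfolding k by (simp add: algebra_simps)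
  then have "?x - of_int 1 \<in> P"
    by (rule alg_prime_int_combination[OF P(1) D P(2) algebraic_int_of_int, rotated]) (intro ai)
  moreover have e: "poly (quintic T) 1 = 27 - 2470 * k" unfolding k quintic_def by simp
  have "\<not> int 5 dvd poly (quintic T) 1"
  proof
    assume "int 5 dvd poly (quintic T) 1"
    then obtain c where "27 - 2470 * k = 5 * c" unfolding e by auto
    then have "27 = 5 * (c + 494 * k)" by simp
    then have "5 dvd (27 :: int)" by (metis dvd_triv_left)
    then show False by simp
  qed
  moreover have "prime (5 :: nat)" by simp
  ultimately show False using root_not_cong_int[OF P(1) _ P(2) ij(1)] by blast
qed

lemma inj_r: "i \<in> I5 \<Longrightarrow> j \<in> I5 \<Longrightarrow> r i = r j \<longleftrightarrow> i = j"
proof -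
  obtain P where P: "alg_prime P" "of_nat 2 \<in> P" using alg_prime_exists[of 2] by auto
  show "i \<in> I5 \<Longrightarrow> j \<in> I5 \<Longrightarrow> r i = r j \<longleftrightarrow> i = j"
    using distinct_mod_2[OF P, of i j] alg_prime_0[OF P(1)] by (metis diff_self)
qed

section \<open>The action of the Galois group on the indices of the roots\<close>

definition perm :: "(complex \<Rightarrow> complex) \<Rightarrow> nat \<Rightarrow> nat"
  where "perm \<sigma> i = (if i \<in> I5 then THE j. j \<in> I5 \<and> r j = \<sigma> (r i) else i)"

lemma perm_outside: "i \<notin> I5 \<Longrightarrow> perm \<sigma> i = i"
  unfolding perm_def by (rule if_not_P)

lemma perm_root:
  assumes "\<sigma> \<in> G" "i \<in> I5"
  shows "perm \<sigma> i \<in> I5" "r (perm \<sigma> i) = \<sigma> (r i)"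
proof -
  have "\<sigma> (r i) \<in> r ` I5" using Gal_roots[OF assms(1)] assms(2) unfolding roots_image by blast
  then obtain j where j: "j \<in> I5" "r j = \<sigma> (r i)" by auto
  have "perm \<sigma> i \<in> I5 \<and> r (perm \<sigma> i) = \<sigma> (r i)"
    unfolding perm_def if_P[OF assms(2)]
    by (rule theI[of _ j]) (use j inj_r in \<open>auto, metis\<close>)
  then show "perm \<sigma> i \<in> I5" "r (perm \<sigma> i) = \<sigma> (r i)" by auto
qed

lemma perm_eqI: "\<sigma> \<in> G \<Longrightarrow> i \<in> I5 \<Longrightarrow> j \<in> I5 \<Longrightarrow> r j = \<sigma> (r i) \<Longrightarrow> perm \<sigma> i = j"
  using perm_root inj_r by metis

lemma perm_permutes:
  assumes "\<sigma> \<in> G"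
  shows "perm \<sigma> permutes I5"
proof (rule bij_imp_permutes)
  have "inj_on (perm \<sigma>) I5"
  proof (rule inj_onI)
    fix i j assume ij: "i \<in> I5" "j \<in> I5" "perm \<sigma> i = perm \<sigma> j"
    then have "\<sigma> (r i) = \<sigma> (r j)" using perm_root[OF assms] by metis
    then have "r i = r j"
      using hom_on_inj[OF subfield_K Gal_hom[OF assms]] root_K ij by (auto dest: inj_onD)
    then show "i = j" using inj_r ij by blast
  qed
  moreover have "perm \<sigma> ` I5 \<subseteq> I5" using perm_root[OF assms] by blast
  ultimately show "bij_betw (perm \<sigma>) I5 I5" by (simp add: bij_betw_def endo_inj_surj)
qed (rule perm_outside)

lemma perm_compose:
  assumes "\<sigma> \<in> G" "\<tau> \<in> G"
  shows "perm (compose K \<sigma> \<tau>) = perm \<sigma> \<circ> perm \<tau>"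
proof
  fix i show "perm (compose K \<sigma> \<tau>) i = (perm \<sigma> \<circ> perm \<tau>) i"
  proof (cases "i \<in> I5")
    case True
    have "r (perm \<sigma> (perm \<tau> i)) = compose K \<sigma> \<tau> (r i)"
      using perm_root[OF assms(1) perm_root(1)[OF assms(2) True]] perm_root(2)[OF assms(2) True]
      by (simp add: compose_eq[OF root_K[OF True]])
    then show ?thesis using perm_eqI[OF Gal_compose[OF assms] True] perm_root assms True by simp
  qed (simp only: perm_outside o_apply not_False_eq_True)
qed

lemma perm_inj: "inj_on perm G"
proof (rule inj_onI)
  fix \<sigma> \<tau> assume *: "\<sigma> \<in> G" "\<tau> \<in> G" "perm \<sigma> = perm \<tau>"
  show "\<sigma> = \<tau>"
  proof (rule Gal_eqI[OF *(1,2)])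
    fix x assume "x \<in> set (map r [1..<6])"
    then obtain i where "i \<in> I5" "x = r i" unfolding roots_image by blast
    then show "\<sigma> x = \<tau> x" using perm_root(2) * by metis
  qed
qed

lemma perm_one: "perm (\<lambda>x\<in>K. x) = id"
proof
  fix i show "perm (\<lambda>x\<in>K. x) i = id i"
    using perm_eqI[OF Gal_id, of i i] root_K[of i] perm_outside[of i] by (cases "i \<in> I5") simp_all
qed

lemma disc_sqrt_odd: "odd (disc_sqrt T)"
proof -
  obtain k where k: "T = 1 + 190 * k" by (rule T_eq)
  then have "odd T" by simp
  then show ?thesis unfolding disc_sqrt_def by simp
qed

text \<open>The Vandermonde determinant is rational, so it is fixed by the automorphisms, while a permutation of
  the roots multiplies it by its sign.\<close>

lemma perm_even:
  assumes \<sigma>: "\<sigma> \<in> G"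
  shows "evenperm (perm \<sigma>)"
proof -
  \<comment> \<open>Rows of the matrix are numbered 0 to 4 and roots 1 to 5. Exchanging 0 and 5
    identifies the two index sets, and conjugation by this exchange preserves signs.\<close>
  define c where "c = Transposition.transpose 0 (5 :: nat)"
  have cc: "c (c i) = i" for i unfolding c_def by simp
  have cI: "c i \<in> I5 \<longleftrightarrow> i < 5" for i
    unfolding c_def Transposition.transpose_def by auto
  define s where "s i = r (c i)" for i
  let ?V = "vandermonde s"
  define D where "D = det ?V"
  have V: "?V \<in> carrier_mat 5 5" unfolding vandermonde_def by simp
  have "f = [:- s 0, 1:] * [:- s 1, 1:] * [:- s 2, 1:] * [:- s 3, 1:] * [:- s 4, 1:]"
  proof -
    have "I5 = {5, 1, 2, 3, 4}" by auto
    then have "f = [:- r 5, 1:] * ([:- r 1, 1:] * ([:- r 2, 1:] * ([:- r 3, 1:] * ([:- r 4, 1:] * 1))))"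
      unfolding factors by (simp only: prod.insert finite.intros prod.empty) simp
    then have "f = [:- r 5, 1:] * [:- r 1, 1:] * [:- r 2, 1:] * [:- r 3, 1:] * [:- r 4, 1:]"
      by (simp only: mult.assoc mult_1_right)
    then show ?thesis unfolding s_def c_def by (simp only: Transposition.transpose_def) simp
  qed
  then have D2: "D ^ 2 = of_int (disc_sqrt T) ^ 2" unfolding D_def by (rule det_vandermonde_square)
  have D0: "D \<noteq> 0" using D2 disc_sqrt_odd by auto
  have "D = of_int (disc_sqrt T) \<or> D = of_int (- disc_sqrt T)" using D2 by (auto simp: power2_eq_iff)
  then have \<sigma>D: "\<sigma> D = D" using hom_on_of_int[OF subfield_K Gal_hom[OF \<sigma>]] by metis
  have VK: "?V $$ (i, j) \<in> K" if "i < 5" "j < 5" for i j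
    using that cI subfield_power[OF subfield_K root_K] unfolding vandermonde_def s_def by auto
  define p where "p = c \<circ> perm \<sigma> \<circ> c"
  have pp: "permutation (perm \<sigma>)" using perm_permutes[OF \<sigma>] permutation_permutes by blast
  have pc: "permutation c" unfolding c_def by (rule permutation_swap_id)
  have sp: "sign p = sign (perm \<sigma>)"
    unfolding p_def using pp pc by (simp add: sign_compose permutation_compose)
  have p5: "p permutes {0..<5}"
  proof (rule bij_imp_permutes)
    have "p i \<in> {0..<5}" if "i \<in> {0..<5}" for i
      unfolding p_def using that cI[of i] cI[of "p i"] perm_root(1)[OF \<sigma>, of "c i"] by (simp add: p_def cc)
    then have "p ` {0..<5} \<subseteq> {0..<5}" by blast
    moreover have "inj c" using cc by (metis injI)
    then have "inj p" unfolding p_def by (intro inj_compose permutes_inj[OF perm_permutes[OF \<sigma>]])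
    then have "inj_on p {0..<5}" using inj_on_subset by blast
    ultimately show "bij_betw p {0..<5} {0..<5}" by (simp add: bij_betw_def endo_inj_surj)
    fix i assume "i \<notin> {0..<5 :: nat}"
    then have "c i \<notin> I5" using cI by simp
    then show "p i = i" unfolding p_def o_apply by (simp only: perm_outside cc not_False_eq_True)
  qed
  have "\<sigma> D = (\<Sum>\<pi>\<in>{\<pi>. \<pi> permutes {0..<5}}. \<sigma> (signof \<pi> * (\<Prod>i = 0..<5. ?V $$ (i, \<pi> i))))"
    unfolding D_def det_def'[OF V]
  proof (rule hom_on_sum[OF subfield_K Gal_hom[OF \<sigma>]])
    fix \<pi> :: "nat \<Rightarrow> nat" assume \<pi>: "\<pi> \<in> {\<pi>. \<pi> permutes {0..<5}}"
    show "signof \<pi> * (\<Prod>i = 0..<5. ?V $$ (i, \<pi> i)) \<in> K"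
      using \<pi> permutes_in_image[of \<pi> "{0..<5}"]
      by (intro subfieldD(4)[OF subfield_K] subfield_of_int[OF subfield_K] subfield_prod[OF subfield_K] VK) auto
  qed
  also have "\<dots> = (\<Sum>\<pi>\<in>{\<pi>. \<pi> permutes {0..<5}}. signof \<pi> * (\<Prod>i = 0..<5. mat 5 5 (\<lambda>(i, j). ?V $$ (p i, j)) $$ (i, \<pi> i)))"
  proof (intro sum.cong refl)
    fix \<pi> :: "nat \<Rightarrow> nat" assume \<pi>: "\<pi> \<in> {\<pi>. \<pi> permutes {0..<5}}"
    then have \<pi>5: "\<pi> i < 5" if "i < 5" for i using permutes_in_image[of \<pi> "{0..<5}" i] that by auto
    have *: "\<sigma> (?V $$ (i, j)) = ?V $$ (p i, j)" if ij: "i < 5" "j < 5" for i j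
    proof -
      have ci: "c i \<in> I5" using cI ij by simp
      have "p i < 5" using permutes_in_image[OF p5, of i] ij by simp
      then have "?V $$ (p i, j) = r (c (p i)) ^ j" using ij unfolding vandermonde_def s_def by simp
      also have "\<dots> = \<sigma> (r (c i)) ^ j" unfolding p_def using perm_root(2)[OF \<sigma> ci] by (simp add: cc)
      also have "\<dots> = \<sigma> (r (c i) ^ j)" using hom_on_power[OF subfield_K Gal_hom[OF \<sigma>] root_K[OF ci]] by simp
      finally show ?thesis using ij unfolding vandermonde_def s_def by simp
    qed
    have "\<sigma> (signof \<pi> * (\<Prod>i = 0..<5. ?V $$ (i, \<pi> i))) = signof \<pi> * \<sigma> (\<Prod>i = 0..<5. ?V $$ (i, \<pi> i))"
      using \<pi>5 VK
      by (subst hom_on_mult[OF subfield_K Gal_hom[OF \<sigma>]])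
         (auto simp: hom_on_of_int[OF subfield_K Gal_hom[OF \<sigma>]] intro!: subfield_of_int[OF subfield_K] subfield_prod[OF subfield_K])
    also have "\<sigma> (\<Prod>i = 0..<5. ?V $$ (i, \<pi> i)) = (\<Prod>i = 0..<5. \<sigma> (?V $$ (i, \<pi> i)))"
      by (rule hom_on_prod[OF subfield_K Gal_hom[OF \<sigma>]]) (use VK \<pi>5 in auto)
    also have "\<dots> = (\<Prod>i = 0..<5. mat 5 5 (\<lambda>(i, j). ?V $$ (p i, j)) $$ (i, \<pi> i))"
      by (intro prod.cong refl) (use * \<pi>5 in auto)
    finally show "\<sigma> (signof \<pi> * (\<Prod>i = 0..<5. ?V $$ (i, \<pi> i))) =
      signof \<pi> * (\<Prod>i = 0..<5. mat 5 5 (\<lambda>(i, j). ?V $$ (p i, j)) $$ (i, \<pi> i))" .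
  qed
  also have "\<dots> = det (mat 5 5 (\<lambda>(i, j). ?V $$ (p i, j)))"
    by (rule det_def'[symmetric]) simp
  also have "\<dots> = signof p * D" unfolding D_def by (rule det_permute_rows[OF V p5])
  finally have "signof p = (1 :: complex)" using \<sigma>D D0 by simp
  then have "sign p = 1" by (metis of_int_eq_1_iff)
  then show ?thesis unfolding sp by (simp add: sign_def split: if_splits)
qed

end

text \<open>This is a norm form of the Eisenstein integers, in which 5 is inert. The proof checks
  all residues.\<close>

lemma quadratic_form_mod_5:
  fixes u v :: int
  assumes "5 dvd u ^ 2 - u * v + v ^ 2"
  shows "5 dvd u" "5 dvd v"
proof -
  obtain a i where u: "u = 5 * a + i" "i \<in> {0..<5}" by (metis atLeastLessThan_iff mult_div_mod_eq pos_mod_bound pos_mod_sign zero_less_numeral)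
  obtain b j where v: "v = 5 * b + j" "j \<in> {0..<5}" by (metis atLeastLessThan_iff mult_div_mod_eq pos_mod_bound pos_mod_sign zero_less_numeral)
  have "i ^ 2 - i * j + j ^ 2 = (u ^ 2 - u * v + v ^ 2) - 5 * (5 * a ^ 2 + 2 * a * i - 5 * a * b - a * j - b * i + 5 * b ^ 2 + 2 * b * j)"
    unfolding u v by (simp add: power2_eq_square algebra_simps)
  then have "5 dvd i ^ 2 - i * j + j ^ 2" using assms by (metis dvd_diff dvd_triv_left)
  moreover have "{0..<5 :: int} = {0, 1, 2, 3, 4}" by auto
  ultimately have "i = 0 \<and> j = 0" using u(2) v(2) by (auto simp: power2_eq_square)
  then show "5 dvd u" "5 dvd v" using u v by auto
qed

lemma in_alg_prime_dvd:
  assumes P: "alg_prime P" "of_nat q \<in> P" and "int q dvd k" "algebraic_int x"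
  shows "of_int k * x \<in> P"
proof -
  obtain c where "k = int q * c" using assms(3) by blast
  then have "of_int k * x = of_nat q * (of_int c * x)" by (simp add: mult.assoc)
  also have "\<dots> \<in> P" by (rule alg_prime_mult[OF P]) (intro algebraic_int_closed assms(4))
  finally show ?thesis .
qed

lemma frobenius_int_mult:
  assumes P: "alg_prime P" and q: "prime q" "of_nat q \<in> P"
    and xy: "algebraic_int x" "algebraic_int y" "x ^ q - y \<in> P"
  shows "(of_int k * x) ^ q - of_int k * y \<in> P"
proof -
  have "(of_int k ^ q - of_int k) * x ^ q + of_int k * (x ^ q - y) \<in> P"
    by (intro alg_prime_add[OF P] alg_prime_mult[OF P] alg_prime_mult'[OF P] fermat_alg_prime[OF P q]
      algebraic_int_closed xy)
  then show ?thesis by (simp add: power_mult_distrib algebra_simps)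
qed

text \<open>If \<open>x\<close>, \<open>y\<close>, \<open>z\<close> are permuted cyclically by the Frobenius modulo 5, then they are independent up to
  their trace, because \<open>u\<^sup>2 - u v + v\<^sup>2\<close> is anisotropic modulo 5.\<close>

lemma cyclic_independent_mod_5:
  assumes P: "alg_prime P" "of_nat 5 \<in> P"
    and ai: "algebraic_int x" "algebraic_int y" "algebraic_int z"
    and fr: "x ^ 5 - y \<in> P" "y ^ 5 - z \<in> P" "z ^ 5 - x \<in> P" and ne: "y - z \<notin> P"
    and rel: "of_int k1 * x + of_int k2 * y + of_int k3 * z + of_int k0 \<in> P"
  shows "5 dvd k1 - k3" "5 dvd k2 - k3"
proof -
  have q: "prime (5 :: nat)" by simp
  note F = freshman[OF P(1) q P(2)]
  \<comment> \<open>The fifth power of the relation moves each coefficient to the next of the three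
    numbers in the cycle and leaves the integers unchanged modulo \<open>P\<close>.\<close>
  have step: "of_int k1 * b + of_int k2 * c + of_int k3 * a + of_int k0 \<in> P"
    if r: "of_int k1 * a + of_int k2 * b + of_int k3 * c + of_int k0 \<in> P"
      and ai: "algebraic_int a" "algebraic_int b" "algebraic_int c"
      and fr: "a ^ 5 - b \<in> P" "b ^ 5 - c \<in> P" "c ^ 5 - a \<in> P" for a b c
  proof -
    let ?A = "of_int k1 * a" and ?B = "of_int k2 * b" and ?C = "of_int k3 * c" and ?D = "of_int k0 :: complex"
    have d: "algebraic_int ?A" "algebraic_int ?B" "algebraic_int ?C" "algebraic_int ?D"
      by (intro algebraic_int_closed ai)+
    have r5: "(?A + ?B + ?C + ?D) * (?A + ?B + ?C + ?D) ^ 4 \<in> P"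
      by (rule alg_prime_mult[OF P(1) r]) (intro algebraic_int_closed d)
    have 1: "(?A + ?B + ?C + ?D) ^ 5 - ((?A + ?B + ?C) ^ 5 + ?D ^ 5) \<in> P" by (rule F) (intro algebraic_int_closed d)+
    have 2: "(?A + ?B + ?C) ^ 5 - ((?A + ?B) ^ 5 + ?C ^ 5) \<in> P" by (rule F) (intro algebraic_int_closed d)+
    have 3: "(?A + ?B) ^ 5 - (?A ^ 5 + ?B ^ 5) \<in> P" by (rule F) (intro algebraic_int_closed d)+
    have 4: "?A ^ 5 - of_int k1 * b \<in> P" "?B ^ 5 - of_int k2 * c \<in> P" "?C ^ 5 - of_int k3 * a \<in> P"
      by (rule frobenius_int_mult[OF P(1) q P(2)]; fact)+
    have 5: "?D ^ 5 - ?D \<in> P" by (rule fermat_alg_prime[OF P(1) q P(2)])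
    let ?e = "((?A + ?B + ?C + ?D) ^ 5 - ((?A + ?B + ?C) ^ 5 + ?D ^ 5)) + ((?A + ?B + ?C) ^ 5 - ((?A + ?B) ^ 5 + ?C ^ 5))
      + ((?A + ?B) ^ 5 - (?A ^ 5 + ?B ^ 5)) + (?A ^ 5 - of_int k1 * b) + (?B ^ 5 - of_int k2 * c)
      + (?C ^ 5 - of_int k3 * a) + (?D ^ 5 - ?D)"
    have "?e \<in> P" by (intro alg_prime_add[OF P(1)] 1 2 3 4 5)
    moreover have "?e = (?A + ?B + ?C + ?D) ^ 5 - (of_int k1 * b + of_int k2 * c + of_int k3 * a + of_int k0)" by simp
    moreover have "(?A + ?B + ?C + ?D) ^ 5 = (?A + ?B + ?C + ?D) * (?A + ?B + ?C + ?D) ^ 4" by (simp add: numeral_eq_Suc)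
    ultimately show ?thesis using r5 alg_prime_cong_iff[OF P(1)] by metis
  qed
  note r1 = step[OF rel ai fr]
  note r2 = step[OF r1 ai(2,3,1) fr(2,3,1)]
  define u v where "u = k1 - k3" and "v = k2 - k3"
  define A B where "A = x - y" and "B = y - z"
  have AB: "algebraic_int A" "algebraic_int B" unfolding A_def B_def by (intro algebraic_int_closed ai)+
  have e1: "of_int u * A + of_int v * B \<in> P"
    using alg_prime_diff[OF P(1) rel r1] by (simp add: u_def v_def A_def B_def algebra_simps)
  have e2: "of_int u * B - of_int v * (A + B) \<in> P"
    using alg_prime_diff[OF P(1) r1 r2] by (simp add: u_def v_def A_def B_def algebra_simps)
  \<comment> \<open>The differences of successive relations contain neither \<open>k0\<close> nor
    the common part \<open>k3\<close> of the coefficients. Eliminating \<open>A\<close> from them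
    leaves the quadratic form in \<open>u\<close> and \<open>v\<close> times \<open>B\<close>, which
    is not in \<open>P\<close>.\<close>
  have "of_int v * (of_int u * A + of_int v * B) + of_int u * (of_int u * B - of_int v * (A + B)) \<in> P"
    by (intro alg_prime_add[OF P(1)] alg_prime_mult'[OF P(1)] e1 e2 algebraic_int_of_int)
  then have "of_int (u ^ 2 - u * v + v ^ 2) * B \<in> P" by (simp add: algebra_simps power2_eq_square)
  then have "of_int (u ^ 2 - u * v + v ^ 2) \<in> P"
    using alg_prime_cases[OF P(1) algebraic_int_of_int AB(2)] ne unfolding B_def by blast
  then have "5 dvd u ^ 2 - u * v + v ^ 2" using alg_prime_of_int[OF P(1) q P(2)] by force
  then show "5 dvd k1 - k3" "5 dvd k2 - k3" using quadratic_form_mod_5 unfolding u_def v_def by blast+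
qed

section \<open>Frobenius congruences at 2 and 5 and the determination of the group\<close>

context quintic_field
begin

lemma frobenius_perm:
  assumes P: "alg_prime P" and q: "prime q" "of_nat q \<in> P" and i: "i \<in> I5"
  obtains \<sigma> where "\<sigma> \<in> G" "r i ^ q - r (perm \<sigma> i) \<in> P"
  using frobenius_conjugate[OF P q root_K[OF i] root_alg[OF i]] perm_root(2)[OF _ i] by metis

text \<open>A root fixed by the Frobenius or its square would lie in the field with 2 or 4 elements.
  The values of the quintic at 0 and 1 are odd, and modulo 2 it leaves remainder 1 on division by
  \<open>x ^ 2 + x + 1\<close>.\<close>

lemma frobenius_2_no_fixed:
  assumes P: "alg_prime P" "of_nat 2 \<in> P" and i: "i \<in> I5"
  shows "r i ^ 2 - r i \<notin> P" "r i ^ 4 - r i \<notin> P"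
proof -
  obtain k where k: "T = 1 + 190 * k" by (rule T_eq)
  let ?x = "r i"
  note x = root_alg[OF i]
  have "\<not> int 2 dvd poly (quintic T) 0" "\<not> int 2 dvd poly (quintic T) 1" unfolding k quintic_def by simp_all
  then have n: "?x - of_int 0 \<notin> P" "?x - of_int 1 \<notin> P"
    using root_not_cong_int[OF P(1) two_is_prime_nat P(2) i] by blast+
  have "?x * (?x - 1) \<notin> P" using n alg_prime_cases[OF P(1) x, of "?x - 1"] algebraic_int_diff[OF x algebraic_int_of_int[of 1]] by auto
  then show 2: "?x ^ 2 - ?x \<notin> P" by (simp add: power2_eq_square algebra_simps)
  show "?x ^ 4 - ?x \<notin> P"
  proof
    assume "?x ^ 4 - ?x \<in> P"
    moreover have "?x ^ 4 - ?x = (?x ^ 2 - ?x) * (?x ^ 2 + ?x + of_int 1)" by (simp add: algebra_simps numeral_eq_Suc)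
    ultimately have c: "?x ^ 2 + ?x + of_int 1 \<in> P"
      using alg_prime_cases[OF P(1)] 2 by (metis algebraic_int_closed x)
    have "poly (of_int_poly (quintic T)) ?x = 0" by (rule root[OF i])
    then have z: "?x ^ 5 - 10 * ?x ^ 3 - of_int T * ?x ^ 2 + (25 - 3 * of_int T) * ?x + 24 - 9 * of_int T = 0"
      unfolding poly_f_explicit .
    \<comment> \<open>Division of the quintic by \<open>x ^ 2 + x + 1\<close> leaves
      \<open>(24 - 2 * T) * x + 13 - 8 * T\<close>, which is 1 up to a multiple of 2.\<close>
    have "of_int 1 = (?x ^ 2 + ?x + of_int 1) * (- (?x ^ 3) + ?x ^ 2 + 10 * ?x + (of_int T - 11)) +
        of_nat 2 * (of_int (T - 12) * ?x + of_int (4 * T - 6)) + (?x ^ 5 - 10 * ?x ^ 3 - of_int T * ?x ^ 2 + (25 - 3 * of_int T) * ?x + 24 - 9 * of_int T)"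
      by (simp add: algebra_simps numeral_eq_Suc)
    then have "of_int 1 = (?x ^ 2 + ?x + of_int 1) * (of_int (- 1) * ?x ^ 3 + ?x ^ 2 + of_int 10 * ?x + of_int (T - 11)) +
        of_nat 2 * (of_int (T - 12) * ?x + of_int (4 * T - 6))"
      unfolding z by simp
    then have "of_int 1 \<in> P"
      by (rule alg_prime_int_combination[OF P(1) c P(2), rotated 2]) (intro algebraic_int_closed x)+
    then show False using alg_prime_1[OF P(1)] by simp
  qed
qed

lemma perm_inv:
  assumes "\<sigma> \<in> G"
  shows "inv' (perm \<sigma>) \<in> perm ` G"
proof -
  let ?\<tau> = "restrict (inv_into K \<sigma>) K"
  have \<tau>: "?\<tau> \<in> G" by (rule Gal_inv[OF assms])
  have "inj_on \<sigma> K" using assms unfolding Gal_carrier[OF subfield_K] by (auto simp: bij_betw_def)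
  then have "compose K ?\<tau> \<sigma> = (\<lambda>x\<in>K. x)"
    using Gal_in_K[OF assms] by (auto simp: compose_def restrict_def fun_eq_iff)
  then have "perm ?\<tau> \<circ> perm \<sigma> = id" using perm_compose[OF \<tau> assms] perm_one by simp
  then have "perm ?\<tau> = inv' (perm \<sigma>)"
    using permutes_inv_o(1)[OF perm_permutes[OF assms]] by (metis comp_assoc comp_id id_comp)
  then show ?thesis using \<tau> by (metis imageI)
qed

text \<open>Two successive Frobenius images show that each orbit has at least three elements, and
  two such orbits among five points must meet. The automorphisms realizing the two images may be
  different ones, which is harmless for orbits.\<close>

lemma perm_transitive:
  assumes ij: "i \<in> I5" "j \<in> I5"
  shows "\<exists>g\<in>perm ` G. g i = j"
proof -
  obtain P where P: "alg_prime P" "of_nat 2 \<in> P" using alg_prime_exists[of 2] by auto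
  let ?O = "\<lambda>i. {perm \<sigma> i | \<sigma>. \<sigma> \<in> G}"
  have OI: "?O i \<subseteq> I5" if "i \<in> I5" for i using perm_root(1) that by blast
  have big: "card (?O i) \<ge> 3" if i: "i \<in> I5" for i
  proof -
    obtain \<sigma> where \<sigma>: "\<sigma> \<in> G" "r i ^ 2 - r (perm \<sigma> i) \<in> P" using frobenius_perm[OF P(1) two_is_prime_nat P(2) i] .
    define j where "j = perm \<sigma> i"
    have j: "j \<in> I5" unfolding j_def by (rule perm_root(1)[OF \<sigma>(1) i])
    obtain \<tau> where \<tau>: "\<tau> \<in> G" "r j ^ 2 - r (perm \<tau> j) \<in> P" using frobenius_perm[OF P(1) two_is_prime_nat P(2) j] .
    define k where "k = perm \<tau> j"
    have k: "k \<in> I5" unfolding k_def by (rule perm_root(1)[OF \<tau>(1) j])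
    have "j \<noteq> i" using \<sigma>(2) frobenius_2_no_fixed(1)[OF P i] unfolding j_def by auto
    moreover have "k \<noteq> j" using \<tau>(2) frobenius_2_no_fixed(1)[OF P j] unfolding k_def by auto
    moreover have "k \<noteq> i"
    proof
      assume "k = i"
      then have "(r i ^ 2 - r j) * (r i ^ 2 + r j) + (r j ^ 2 - r i) \<in> P"
        using \<sigma>(2) \<tau>(2) unfolding j_def[symmetric] k_def[symmetric]
        by (intro alg_prime_add[OF P(1)] alg_prime_mult[OF P(1)] algebraic_int_closed root_alg i j) auto
      then have "r i ^ 4 - r i \<in> P" by (simp add: algebra_simps numeral_eq_Suc)
      then show False using frobenius_2_no_fixed(2)[OF P i] by blast
    qed
    ultimately have "card {i, j, k} = 3" by simp
    moreover have "{i, j, k} \<subseteq> ?O i"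
    proof -
      have "i = perm (\<lambda>x\<in>K. x) i" unfolding perm_one by simp
      moreover have "k = perm (compose K \<tau> \<sigma>) i"
        unfolding perm_compose[OF \<tau>(1) \<sigma>(1)] j_def k_def by simp
      ultimately show ?thesis using Gal_id \<sigma>(1) Gal_compose[OF \<tau>(1) \<sigma>(1)] j_def by blast
    qed
    then have "card {i, j, k} \<le> card (?O i)"
      by (rule card_mono[OF finite_subset[OF OI[OF i] finite_atLeastAtMost]])
    ultimately show ?thesis by linarith
  qed
  have "?O i \<inter> ?O j \<noteq> {}"
  proof
    assume e: "?O i \<inter> ?O j = {}"
    have f: "finite (?O i)" "finite (?O j)" using finite_subset[OF OI finite_atLeastAtMost] ij by blast+
    have "?O i \<union> ?O j \<subseteq> I5" using OI ij by blast
    then have "card (?O i \<union> ?O j) \<le> card I5" by (intro card_mono) auto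
    then show False using card_Un_disjoint[OF f e] big[OF ij(1)] big[OF ij(2)] by simp
  qed
  then obtain \<sigma> \<tau> where st: "\<sigma> \<in> G" "\<tau> \<in> G" "perm \<sigma> i = perm \<tau> j" by blast
  obtain \<rho> where \<rho>: "\<rho> \<in> G" "inv' (perm \<tau>) = perm \<rho>" using perm_inv[OF st(2)] by blast
  have "perm \<rho> (perm \<sigma> i) = j" unfolding \<rho>(2)[symmetric] st(3) using permutes_inverses(2)[OF perm_permutes[OF st(2)]] .
  then have "perm (compose K \<rho> \<sigma>) i = j" using perm_compose[OF \<rho>(1) st(1)] by simp
  then show ?thesis using Gal_compose[OF \<rho>(1) st(1)] by blast
qed

text \<open>Modulo 5 the quintic is \<open>x * (x - 3)\<close> times a cubic without roots in the
  prime field, so the fifth power fixes the classes of two roots and permutes the other three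
  cyclically. This concerns residues only; no automorphism is produced yet.\<close>

lemma frobenius_5:
  assumes P: "alg_prime P" "of_nat 5 \<in> P"
  obtains a b c1 c2 c3 where "distinct [a, b, c1, c2, c3]" "{a, b, c1, c2, c3} = I5"
    "of_int 0 - r a \<in> P" "of_int 3 - r b \<in> P" "r a ^ 5 - r a \<in> P" "r b ^ 5 - r b \<in> P"
    "r c1 ^ 5 - r c2 \<in> P" "r c2 ^ 5 - r c3 \<in> P" "r c3 ^ 5 - r c1 \<in> P"
proof -
  have q: "prime (5 :: nat)" by simp
  obtain k where k: "T = 1 + 190 * k" by (rule T_eq)
  have val: "poly (quintic T) n = n ^ 5 - 10 * n ^ 3 - n ^ 2 + 22 * n + 15 - 190 * k * (n ^ 2 + 3 * n + 9)" for n
    unfolding k quintic_def by (simp add: algebra_simps numeral_eq_Suc)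
  have dvd5: "5 dvd c - 190 * k * d \<longleftrightarrow> 5 dvd c" for c d :: int
  proof -
    have "190 * k * d = 5 * (38 * k * d)" by simp
    then have "5 dvd 190 * k * d" by (metis dvd_triv_left)
    then show ?thesis by (metis dvd_add dvd_diff diff_add_cancel)
  qed
  have near: "\<exists>i\<in>I5. of_int n - r i \<in> P" if "5 dvd poly (quintic T) n" for n
  proof -
    have "of_int (poly (quintic T) n) * 1 \<in> P" by (rule in_alg_prime_dvd[OF P]) (use that in auto)
    then have "poly f (of_int n) \<in> P" unfolding poly_of_int_poly_of_int by simp
    then show ?thesis unfolding poly_f
      using alg_prime_prod[OF P(1) finite_atLeastAtMost, where f = "\<lambda>i. of_int n - r i"]
        algebraic_int_diff[OF algebraic_int_of_int root_alg] by blast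
  qed
  have "\<exists>i\<in>I5. of_int 0 - r i \<in> P" by (rule near, unfold val) simp
  then obtain a where a: "a \<in> I5" "of_int 0 - r a \<in> P" by blast
  have "\<exists>i\<in>I5. of_int 3 - r i \<in> P" by (rule near, unfold val) simp
  then obtain b where b: "b \<in> I5" "of_int 3 - r b \<in> P" by blast
  have ab: "a \<noteq> b"
  proof
    assume "a = b"
    then have "(of_int 3 - r b) - (of_int 0 - r b) \<in> P" by (intro alg_prime_diff[OF P(1) b(2)]) (use a(2) in simp)
    then have "of_int 3 \<in> P" by simp
    then have "int 5 dvd 3" using alg_prime_of_int[OF P(1) q P(2)] by blast
    then show False by simp
  qed
  have uniq: "i = j" if "i \<in> I5" "j \<in> I5" "x - r i \<in> P" "x - r j \<in> P" for i j x
    using distinct_mod_5[OF P that(1,2)] alg_prime_diff[OF P(1) that(4,3)] by auto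
  have small: "i \<in> {a, b}" if i: "i \<in> I5" "r i ^ 5 - r i \<in> P" for i
  proof -
    let ?x = "r i"
    note x = root_alg[OF i(1)]
    \<comment> \<open>Modulo 5, \<open>x ^ 5 - x\<close> is the product of \<open>x - n\<close> over
      all residues \<open>n\<close>, so a fixed root is congruent to an integer; among these only 0
      and 3 are zeros of the quintic.\<close>
    have "?x * (?x - of_int 1) * (?x - of_int 2) * (?x - of_int 3) * (?x - of_int 4) =
       (?x ^ 5 - ?x) * of_int 1 + of_nat 5 * (of_int (- 2) * ?x ^ 4 + of_int 7 * ?x ^ 3 + of_int (- 10) * ?x ^ 2 + of_int 5 * ?x)"
      by (simp add: algebra_simps numeral_eq_Suc)
    then have "?x * (?x - of_int 1) * (?x - of_int 2) * (?x - of_int 3) * (?x - of_int 4) \<in> P"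
      by (rule alg_prime_int_combination[OF P(1) i(2) P(2), rotated 2]) (intro algebraic_int_closed x)+
    moreover have d: "algebraic_int (?x - of_int n)" for n by (intro algebraic_int_closed x)
    ultimately have "?x * (?x - of_int 1) * (?x - of_int 2) * (?x - of_int 3) \<in> P \<or> ?x - of_int 4 \<in> P"
      by (intro alg_prime_cases[OF P(1)] algebraic_int_mult d x)
    moreover have "?x * (?x - of_int 1) * (?x - of_int 2) * (?x - of_int 3) \<in> P \<Longrightarrow>
        ?x * (?x - of_int 1) * (?x - of_int 2) \<in> P \<or> ?x - of_int 3 \<in> P"
      by (intro alg_prime_cases[OF P(1)] algebraic_int_mult d x)
    moreover have "?x * (?x - of_int 1) * (?x - of_int 2) \<in> P \<Longrightarrow> ?x * (?x - of_int 1) \<in> P \<or> ?x - of_int 2 \<in> P"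
      by (intro alg_prime_cases[OF P(1)] algebraic_int_mult d x)
    moreover have "?x * (?x - of_int 1) \<in> P \<Longrightarrow> ?x \<in> P \<or> ?x - of_int 1 \<in> P"
      by (intro alg_prime_cases[OF P(1)] d x)
    moreover have "?x \<in> P \<Longrightarrow> ?x - of_int 0 \<in> P" by simp
    ultimately consider "?x - of_int 0 \<in> P" | "?x - of_int 1 \<in> P" | "?x - of_int 2 \<in> P" | "?x - of_int 3 \<in> P" | "?x - of_int 4 \<in> P"
      by blast
    then show ?thesis
    proof cases
      case 1
      then show ?thesis using uniq[OF i(1) a(1) _ a(2)] alg_prime_minus_commute[OF P(1)] by blast
    next
      case 4
      then show ?thesis using uniq[OF i(1) b(1) _ b(2)] alg_prime_minus_commute[OF P(1)] by blast
    next
      case 2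
      have e: "poly (quintic T) 1 = 27 - 190 * k * 13" unfolding val by simp
      have "\<not> int 5 dvd poly (quintic T) 1" unfolding e of_nat_numeral dvd5 by simp
      then show ?thesis using root_not_cong_int[OF P(1) q P(2) i(1)] 2 by blast
    next
      case 3
      have e: "poly (quintic T) 2 = 7 - 190 * k * 19" unfolding val by simp
      have "\<not> int 5 dvd poly (quintic T) 2" unfolding e of_nat_numeral dvd5 by simp
      then show ?thesis using root_not_cong_int[OF P(1) q P(2) i(1)] 3 by blast
    next
      case 5
      have e: "poly (quintic T) 4 = 471 - 190 * k * 37" unfolding val by simp
      have "\<not> int 5 dvd poly (quintic T) 4" unfolding e of_nat_numeral dvd5 by simp
      then show ?thesis using root_not_cong_int[OF P(1) q P(2) i(1)] 5 by blast
    qed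
  qed
  have fra: "r a ^ 5 - r a \<in> P" and frb: "r b ^ 5 - r b \<in> P"
  proof -
    have *: "r i ^ 5 - r i \<in> P" if "i \<in> I5" "of_int n - r i \<in> P" for i n
    proof -
      have f: "(of_int n - r i + r i) ^ 5 - ((of_int n - r i) ^ 5 + r i ^ 5) \<in> P"
        by (rule freshman[OF P(1) q P(2)]) (intro algebraic_int_closed root_alg that)+
      have g: "(of_int n - r i) * (of_int n - r i) ^ 4 \<in> P"
        by (rule alg_prime_mult[OF P(1) that(2)]) (intro algebraic_int_closed root_alg that)
      have h: "of_int n ^ 5 - of_int n \<in> P" by (rule fermat_alg_prime[OF P(1) q P(2)])
      have "(of_int n ^ 5 - of_int n) + (of_int n - r i) - ((of_int n - r i) * (of_int n - r i) ^ 4)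
          - ((of_int n - r i + r i) ^ 5 - ((of_int n - r i) ^ 5 + r i ^ 5)) \<in> P"
        by (rule alg_prime_diff[OF P(1) alg_prime_diff[OF P(1) alg_prime_add[OF P(1) h that(2)] g] f])
      then show ?thesis by (simp add: numeral_eq_Suc)
    qed
    show "r a ^ 5 - r a \<in> P" "r b ^ 5 - r b \<in> P" using * a b by blast+
  qed
  have "\<exists>j. i \<in> I5 \<longrightarrow> j \<in> I5 \<and> r i ^ 5 - r j \<in> P" for i using frobenius_root[OF P(1) q P(2)] by metis
  then obtain \<pi> where \<pi>: "\<And>i. i \<in> I5 \<Longrightarrow> \<pi> i \<in> I5 \<and> r i ^ 5 - r (\<pi> i) \<in> P" by metis
  have \<pi>inj: "i = j" if ij: "i \<in> I5" "j \<in> I5" "\<pi> i = \<pi> j" for i j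
  proof -
    have "(r i ^ 5 - r (\<pi> i)) - (r j ^ 5 - r (\<pi> j)) \<in> P"
      by (rule alg_prime_diff[OF P(1) conjunct2[OF \<pi>[OF ij(1)]] conjunct2[OF \<pi>[OF ij(2)]]])
    then have "r i ^ 5 - r j ^ 5 \<in> P" using ij(3) by simp
    then have "r i - r j \<in> P" by (rule frobenius_inj_mod[OF P(1) q P(2) root_alg[OF ij(1)] root_alg[OF ij(2)]])
    then show ?thesis using distinct_mod_5[OF P ij(1,2)] by blast
  qed
  have \<pi>a: "\<pi> a = a" using \<pi>[OF a(1)] a(1) fra by (intro uniq[of _ _ "r a ^ 5"]) auto
  have \<pi>b: "\<pi> b = b" using \<pi>[OF b(1)] b(1) frb by (intro uniq[of _ _ "r b ^ 5"]) auto
  have \<pi>fix: "i \<in> {a, b}" if "i \<in> I5" "\<pi> i = i" for i using small[OF that(1)] \<pi>[OF that(1)] that(2) by simp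
  let ?R = "I5 - {a, b}"
  have "card ?R = 3" using a b ab by (simp add: card_Diff_subset)
  then obtain c1 where c1: "c1 \<in> ?R" by (metis card.empty ex_in_conv zero_neq_numeral)
  have R: "\<pi> i \<in> ?R" if i: "i \<in> ?R" for i
    using \<pi>[of i] \<pi>inj[of i a] \<pi>inj[of i b] \<pi>a \<pi>b a(1) b(1) i by auto
  define c2 where "c2 = \<pi> c1"
  define c3 where "c3 = \<pi> c2"
  have c2: "c2 \<in> ?R" unfolding c2_def by (rule R[OF c1])
  have c3: "c3 \<in> ?R" unfolding c3_def by (rule R[OF c2])
  have c12: "c2 \<noteq> c1" unfolding c2_def using \<pi>fix[of c1] c1 by blast
  have c23: "c3 \<noteq> c2" unfolding c3_def using \<pi>fix[of c2] c2 by blast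
  \<comment> \<open>If \<open>c1\<close> and \<open>c2\<close> were exchanged, the third remaining
    index would be fixed, and only \<open>a\<close> and \<open>b\<close> are.\<close>
  have c13: "c3 \<noteq> c1"
  proof
    assume e: "c3 = c1"
    have "?R - {c1, c2} \<noteq> {}"
    proof
      assume "?R - {c1, c2} = {}"
      then have "?R \<subseteq> {c1, c2}" by blast
      then have "card ?R \<le> card {c1, c2}" by (intro card_mono) auto
      then show False using \<open>card ?R = 3\<close> c12 by simp
    qed
    then obtain c where c: "c \<in> ?R" "c \<noteq> c1" "c \<noteq> c2" by blast
    have "card {c, c1, c2} = 3" using c c12 by simp
    then have "{c, c1, c2} = ?R" using c c1 c2 \<open>card ?R = 3\<close> by (intro card_subset_eq) auto
    then have "\<pi> c \<in> {c, c1, c2}" using R[OF c(1)] by simp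
    moreover have "\<pi> c \<noteq> c" using \<pi>fix[of c] c by blast
    moreover have "\<pi> c \<noteq> c1" using \<pi>inj[of c c2] c c2 e unfolding c3_def by (metis DiffD1)
    moreover have "\<pi> c \<noteq> c2" using \<pi>inj[of c c1] c c1 unfolding c2_def by blast
    ultimately show False by blast
  qed
  have "card {c1, c2, c3} = 3" using c12 c23 c13 by simp
  then have Rc: "{c1, c2, c3} = ?R" using c1 c2 c3 \<open>card ?R = 3\<close> by (intro card_subset_eq) auto
  have "\<pi> c3 \<in> {c1, c2, c3}" unfolding Rc by (rule R[OF c3])
  moreover have "\<pi> c3 \<noteq> c3" using \<pi>fix[of c3] c3 by blast
  moreover have "\<pi> c3 \<noteq> c2" using \<pi>inj[of c3 c1] c3 c1 c13 unfolding c2_def by blast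
  ultimately have \<pi>c3: "\<pi> c3 = c1" by blast
  have dist: "distinct [a, b, c1, c2, c3]" using ab c1 c2 c3 c12 c23 c13 by force
  have all: "{a, b, c1, c2, c3} = I5" using Rc a(1) b(1) by blast
  have cI: "c1 \<in> I5" "c2 \<in> I5" "c3 \<in> I5" using c1 c2 c3 by blast+
  have fc: "r c1 ^ 5 - r c2 \<in> P" "r c2 ^ 5 - r c3 \<in> P" "r c3 ^ 5 - r c1 \<in> P"
    using \<pi>[OF cI(1)] \<pi>[OF cI(2)] \<pi>[OF cI(3)] \<pi>c3 unfolding c3_def c2_def by auto
  show ?thesis by (rule that[OF dist all a(2) b(2) fra frb fc])
qed

text \<open>A Frobenius congruence for a single root would show only one value of the permutation.
  It is therefore applied to a combination of the roots with chosen weights, and the weights of the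
  conjugate are compared modulo 5 by means of \<open>cyclic_independent_mod_5\<close>. This gives
  the images of \<open>c1\<close>, \<open>b\<close> and \<open>a\<close>; evenness settles the
  rest.\<close>

lemma perm_three_cycle:
  obtains t a b c1 c2 c3 where "t \<in> perm ` G" "t a = a" "t b = b" "t c1 = c2" "t c2 = c3" "t c3 = c1"
    "distinct [a, b, c1, c2, c3]" "{a, b, c1, c2, c3} = I5"
proof -
  have q: "prime (5 :: nat)" by simp
  obtain P where P: "alg_prime P" "of_nat 5 \<in> P" using alg_prime_exists[OF q] .
  obtain a b c1 c2 c3 where dist: "distinct [a, b, c1, c2, c3]" and all: "{a, b, c1, c2, c3} = I5"
    and ra: "of_int 0 - r a \<in> P" and rb: "of_int 3 - r b \<in> P" and fra: "r a ^ 5 - r a \<in> P" and frb: "r b ^ 5 - r b \<in> P"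
    and fc: "r c1 ^ 5 - r c2 \<in> P" "r c2 ^ 5 - r c3 \<in> P" "r c3 ^ 5 - r c1 \<in> P"
    using frobenius_5[OF P] .
  have cI: "c1 \<in> I5" "c2 \<in> I5" "c3 \<in> I5" and a: "a \<in> I5" and b: "b \<in> I5" unfolding all[symmetric] by blast+
  have c12: "c2 \<noteq> c1" and c23: "c3 \<noteq> c2" and c13: "c3 \<noteq> c1" using dist by auto
  \<comment> \<open>The weights in use are distinct modulo 5, and only the weight 0 is given to two
    roots. \<open>n i\<close> is the weight with which \<open>r i\<close> occurs in the
    conjugate.\<close>
  define m where "m i = (if i = a then 1 else if i = b then 2 else if i = c1 then 3 else 0 :: int)" for i
  have sum5: "(\<Sum>i\<in>I5. g i) = g a + g b + g c1 + g c2 + g c3" for g :: "nat \<Rightarrow> complex"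
    unfolding all[symmetric] using dist by (simp add: add.assoc)
  define x where "x = (\<Sum>i\<in>I5. of_int (m i) * r i)"
  have xK: "x \<in> K" unfolding x_def
    by (rule subfield_sum[OF subfield_K], rule subfieldD(4)[OF subfield_K subfield_of_int[OF subfield_K]], erule root_K)
  have xA: "algebraic_int x" unfolding x_def by (intro algebraic_int_closed root_alg)
  obtain \<sigma> where \<sigma>: "\<sigma> \<in> G" "x ^ 5 - \<sigma> x \<in> P" using frobenius_conjugate[OF P(1) q P(2) xK xA] .
  define p where "p = perm \<sigma>"
  have p: "p permutes I5" unfolding p_def by (rule perm_permutes[OF \<sigma>(1)])
  define n where "n i = m (inv' p i)" for i
  have "\<sigma> x = (\<Sum>i\<in>I5. \<sigma> (of_int (m i) * r i))" unfolding x_def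
    by (rule hom_on_sum[OF subfield_K Gal_hom[OF \<sigma>(1)]], rule subfieldD(4)[OF subfield_K subfield_of_int[OF subfield_K]], erule root_K)
  also have "\<dots> = (\<Sum>i\<in>I5. of_int (m i) * r (p i))"
    by (intro sum.cong refl, subst hom_on_mult[OF subfield_K Gal_hom[OF \<sigma>(1)] subfield_of_int[OF subfield_K] root_K])
       (simp_all only: hom_on_of_int[OF subfield_K Gal_hom[OF \<sigma>(1)]] perm_root(2)[OF \<sigma>(1)] p_def)
  also have "\<dots> = (\<Sum>i\<in>I5. of_int (n (p i)) * r (p i))"
    unfolding n_def using permutes_inverses(2)[OF p] by simp
  also have "\<dots> = (\<Sum>i\<in>I5. of_int (n i) * r i)"
    by (rule sum.reindex_bij_betw[OF permutes_imp_bij[OF p]])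
  finally have sx: "\<sigma> x = of_int (n a) * r a + of_int (n b) * r b + of_int (n c1) * r c1 + of_int (n c2) * r c2 + of_int (n c3) * r c3"
    unfolding sum5 .
  have "m a = 1" "m b = 2" "m c1 = 3" "m c2 = 0" "m c3 = 0" using dist by (auto simp: m_def)
  then have xe: "x = r a + 2 * r b + 3 * r c1" unfolding x_def sum5 by simp
  have x5: "x ^ 5 - (r a + of_int 2 * r b + of_int 3 * r c2) \<in> P"
  proof -
    have 1: "(r a + of_int 2 * r b + of_int 3 * r c1) ^ 5 - ((r a + of_int 2 * r b) ^ 5 + (of_int 3 * r c1) ^ 5) \<in> P"
      by (rule freshman[OF P(1) q P(2)]) (intro algebraic_int_closed root_alg a b cI)+
    have 2: "(r a + of_int 2 * r b) ^ 5 - (r a ^ 5 + (of_int 2 * r b) ^ 5) \<in> P"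
      by (rule freshman[OF P(1) q P(2)]) (intro algebraic_int_closed root_alg a b cI)+
    have 3: "(of_int 2 * r b) ^ 5 - of_int 2 * r b \<in> P" "(of_int 3 * r c1) ^ 5 - of_int 3 * r c2 \<in> P"
      by (rule frobenius_int_mult[OF P(1) q P(2) root_alg root_alg]; fact)+
    have "((r a + of_int 2 * r b + of_int 3 * r c1) ^ 5 - ((r a + of_int 2 * r b) ^ 5 + (of_int 3 * r c1) ^ 5)) +
      ((r a + of_int 2 * r b) ^ 5 - (r a ^ 5 + (of_int 2 * r b) ^ 5)) + (r a ^ 5 - r a) +
      ((of_int 2 * r b) ^ 5 - of_int 2 * r b) + ((of_int 3 * r c1) ^ 5 - of_int 3 * r c2) \<in> P"
      by (intro alg_prime_add[OF P(1)] 1 2 3 fra)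
    then show ?thesis unfolding xe by (simp add: algebra_simps)
  qed
  have h0: "(x ^ 5 - \<sigma> x) - (x ^ 5 - (r a + of_int 2 * r b + of_int 3 * r c2)) \<in> P"
    by (rule alg_prime_diff[OF P(1) \<sigma>(2) x5])
  \<comment> \<open>Modulo \<open>P\<close> the roots \<open>r a\<close> and \<open>r b\<close> are
    the integers 0 and 3, so their terms merge into the constant \<open>3 * (n b - 2)\<close> and
    only the cyclically permuted roots remain.\<close>
  have h: "of_int (n a - 1) * (of_int 0 - r a) + of_int (n b - 2) * (of_int 3 - r b) \<in> P"
    by (intro alg_prime_add[OF P(1)] alg_prime_mult'[OF P(1)] ra rb algebraic_int_of_int)
  have "- (((x ^ 5 - \<sigma> x) - (x ^ 5 - (r a + of_int 2 * r b + of_int 3 * r c2)))) +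
     (of_int (n a - 1) * (of_int 0 - r a) + of_int (n b - 2) * (of_int 3 - r b)) \<in> P"
    by (rule alg_prime_add[OF P(1) alg_prime_minus[OF P(1) h0] h])
  then have rel: "of_int (n c1) * r c1 + of_int (n c2 - 3) * r c2 + of_int (n c3) * r c3 + of_int (3 * (n b - 2)) \<in> P"
    unfolding sx by (simp add: algebra_simps)
  have "r c2 - r c3 \<notin> P" by (rule distinct_mod_5[OF P cI(2,3)]) (use c23 in auto)
  from cyclic_independent_mod_5[OF P root_alg[OF cI(1)] root_alg[OF cI(2)] root_alg[OF cI(3)] fc this rel]
  have dv: "5 dvd n c1 - n c3" "5 dvd n c2 - 3 - n c3" by auto
  have nr: "n i \<in> {0, 1, 2, 3}" for i unfolding n_def m_def by auto
  have ninj: "n i = n j \<Longrightarrow> n i \<noteq> 0 \<Longrightarrow> i = j" for i j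
  proof -
    assume "n i = n j" "n i \<noteq> 0"
    then have "inv' p i = inv' p j" unfolding n_def m_def by (auto split: if_splits)
    then show "i = j" using permutes_inverses(1)[OF p] by metis
  qed
  \<comment> \<open>Weights from 0 to 3 that agree modulo 5 are equal. As a nonzero weight occurs
    only once, the equal weights at \<open>c1\<close> and \<open>c3\<close> vanish.\<close>
  have "n c1 = n c3" using dv(1) nr[of c1] nr[of c3] by auto
  then have n13: "n c1 = 0" "n c3 = 0" using ninj[of c1 c3] c13 by auto
  have n2: "n c2 = 3" using dv(2) nr[of c2] n13 by auto
  have minv: "m i = 1 \<longleftrightarrow> i = a" "m i = 2 \<longleftrightarrow> i = b" "m i = 3 \<longleftrightarrow> i = c1" for i
    unfolding m_def using dist by auto
  have pinv: "p j = i" if "inv' p i = j" for i j using permutes_inverses(1)[OF p] that by metis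
  have pc1: "p c1 = c2" using n2 minv(3) pinv unfolding n_def by blast
  have "of_int (3 * (n b - 2)) \<in> P"
  proof -
    have "r c2 * of_int 0 + of_int (3 * (n b - 2)) \<in> P" using rel n13 n2 by simp
    then show ?thesis by simp
  qed
  then have "int 5 dvd 3 * (n b - 2)" using alg_prime_of_int[OF P(1) q P(2)] by blast
  then have nb: "n b = 2" using nr[of b] by auto
  then have pb: "p b = b" using minv(2) pinv unfolding n_def by blast
  have "p a = a"
  proof -
    have "p c1 \<noteq> a" "p b \<noteq> a" using pc1 pb dist by auto
    then have "inv' p a \<noteq> c1" "inv' p a \<noteq> b" using pinv by blast+
    moreover have "inv' p c1 \<noteq> a" "inv' p c3 \<noteq> a" using n13 minv(1)[of "inv' p c1"] minv(1)[of "inv' p c3"] unfolding n_def by auto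
    moreover have "p a \<in> I5" using permutes_in_image[OF p] a by blast
    moreover have "p a \<noteq> c2" "p a \<noteq> b" using pc1 pb dist permutes_inj[OF p] by (auto simp: inj_def)
    ultimately show ?thesis unfolding all[symmetric] using permutes_inverses(2)[OF p, of a] by auto
  qed
  have pI: "p i \<in> {a, b, c1, c2, c3}" if "i \<in> {a, b, c1, c2, c3}" for i
    using permutes_in_image[OF p, of i] that unfolding all by blast
  have pj: "p i = p j \<longleftrightarrow> i = j" for i j using permutes_inj[OF p] by (auto simp: inj_def)
  have pc2: "p c2 \<in> {c1, c3}"
    using pI[of c2] pj[of c2 a] pj[of c2 b] pj[of c2 c1] \<open>p a = a\<close> pb pc1 dist by auto
  have pc3: "p c3 \<in> {c1, c3}"
    using pI[of c3] pj[of c3 a] pj[of c3 b] pj[of c3 c1] \<open>p a = a\<close> pb pc1 dist by auto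
  \<comment> \<open>The alternative is the transposition of \<open>c1\<close> and \<open>c2\<close>,
    which is odd.\<close>
  have "p c2 = c3"
  proof (rule ccontr)
    assume "p c2 \<noteq> c3"
    then have "p c2 = c1" "p c3 = c3" using pc2 pc3 pj[of c2 c3] c23 by auto
    then have "p = Transposition.transpose c1 c2"
    proof (intro ext)
      fix i
      have "i \<notin> I5 \<or> i \<in> {a, b, c1, c2, c3}" unfolding all by blast
      then show "p i = Transposition.transpose c1 c2 i"
        using \<open>p c2 = c1\<close> \<open>p c3 = c3\<close> \<open>p a = a\<close> pb pc1 dist cI p
        unfolding permutes_def Transposition.transpose_def by auto
    qed
    then have "\<not> evenperm p" using evenperm_swap[of c1 c2] c12 by simp
    then show False using perm_even[OF \<sigma>(1)] unfolding p_def by simp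
  qed
  moreover have "p c3 = c1" using pc3 pj[of c3 c2] calculation c23 by auto
  ultimately show ?thesis
    using that[of p a b c1 c2 c3] \<sigma>(1) \<open>p a = a\<close> pb pc1 dist all unfolding p_def by blast
qed

lemma perm_image: "perm ` G = carrier (alt_group 5)"
proof -
  obtain t a b c1 c2 c3 where t: "t \<in> perm ` G" "t a = a" "t b = b" "t c1 = c2" "t c2 = c3" "t c3 = c1"
    "distinct [a, b, c1, c2, c3]" "{a, b, c1, c2, c3} = I5" using perm_three_cycle .
  show ?thesis
  proof (rule transitive_even_with_three_cycle[OF _ _ _ _ perm_transitive t])
    show "g permutes I5 \<and> evenperm g" if "g \<in> perm ` G" for g using that perm_permutes perm_even by blast
    show "id \<in> perm ` G" using Gal_id perm_one by (metis imageI)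
    show "g \<circ> h \<in> perm ` G" if "g \<in> perm ` G" "h \<in> perm ` G" for g h
    proof -
      obtain \<sigma> \<tau> where st: "\<sigma> \<in> G" "\<tau> \<in> G" "g = perm \<sigma>" "h = perm \<tau>" using \<open>g \<in> _\<close> \<open>h \<in> _\<close> by blast
      have "g \<circ> h = perm (compose K \<sigma> \<tau>)" unfolding st(3,4) by (rule perm_compose[OF st(1,2), symmetric])
      then show ?thesis using Gal_compose[OF st(1,2)] by blast
    qed
    show "inv' g \<in> perm ` G" if "g \<in> perm ` G" for g using that perm_inv by blast
  qed
qed

lemma Gal_iso_alt: "Gal K \<cong> alt_group 5"
proof -
  have "perm \<in> iso (Gal K) (alt_group 5)"
    unfolding iso_def hom_def
    using perm_image perm_inj by (auto simp: bij_betw_def Gal_mult perm_compose alt_group_mult)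
  then show ?thesis unfolding is_iso_def by blast
qed

end

section \<open>Inertia groups\<close>

text \<open>The left sides are half the second derivative and the first derivative at the root
  \<open>x\<close>. Each summand on the right contains \<open>x - b\<close> or \<open>x - c\<close>,
  so both sides lie in any prime modulo which \<open>x\<close>, \<open>b\<close> and
  \<open>c\<close> coincide.\<close>

lemma quintic_derivatives_at_root:
  fixes x b c d e :: complex
  assumes f: "of_int_poly (quintic T) = [:- x, 1:] * [:- b, 1:] * [:- c, 1:] * [:- d, 1:] * [:- e, 1:]"
  shows "10 * x ^ 3 - 30 * x - of_int T =
      (x - b) * ((x - c) * (x - d) + (x - c) * (x - e) + (x - d) * (x - e)) + (x - c) * ((x - d) * (x - e))"
    and "5 * x ^ 4 - 30 * x ^ 2 - 2 * of_int T * x + 25 - 3 * of_int T = (x - b) * ((x - c) * ((x - d) * (x - e)))"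
proof -
  note v = vieta_quintic[OF f]
  define E1 E2 E3 E4 where
    "E1 = x + b + c + d + e" and
    "E2 = x*b + x*c + x*d + x*e + b*c + b*d + b*e + c*d + c*e + d*e" and
    "E3 = x*b*c + x*b*d + x*b*e + x*c*d + x*c*e + x*d*e + b*c*d + b*c*e + b*d*e + c*d*e" and
    "E4 = x*b*c*d + x*b*c*e + x*b*d*e + x*c*d*e + b*c*d*e"
  have "(x - b) * ((x - c) * (x - d) + (x - c) * (x - e) + (x - d) * (x - e)) + (x - c) * ((x - d) * (x - e))
     = 10 * x ^ 3 - 6 * E1 * x ^ 2 + 3 * E2 * x - E3"
    unfolding E1_def E2_def E3_def by Groebner_Basis.algebra
  then show "10 * x ^ 3 - 30 * x - of_int T =
      (x - b) * ((x - c) * (x - d) + (x - c) * (x - e) + (x - d) * (x - e)) + (x - c) * ((x - d) * (x - e))"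
    using v unfolding E1_def E2_def E3_def by simp
  have "(x - b) * ((x - c) * ((x - d) * (x - e))) = 5 * x ^ 4 - 4 * E1 * x ^ 3 + 3 * E2 * x ^ 2 - 2 * E3 * x + E4"
    unfolding E1_def E2_def E3_def E4_def by Groebner_Basis.algebra
  then show "5 * x ^ 4 - 30 * x ^ 2 - 2 * of_int T * x + 25 - 3 * of_int T = (x - b) * ((x - c) * ((x - d) * (x - e)))"
    using v unfolding E1_def E2_def E3_def E4_def by simp
qed

text \<open>Eliminating \<open>T\<close> by means of \<open>f''(x)/2 = s\<close> leaves two polynomials in \<open>x\<close> with resultant
  \<open>190000 = 2\<^sup>4 5\<^sup>4 19\<close>; at 2, 5 and 19 the congruence for \<open>T\<close> excludes a triple root.\<close>

lemma quintic_bezout: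
  fixes x t :: complex
  defines "s \<equiv> 10 * x ^ 3 - 30 * x - t" and "D \<equiv> 5 * x ^ 4 - 30 * x ^ 2 - 2 * t * x + 25 - 3 * t"
  assumes "x ^ 5 - 10 * x ^ 3 - t * x ^ 2 + (25 - 3 * t) * x + 24 - 9 * t = 0"
  shows "190000 = s * (- (1035 * x ^ 3 + 1530 * x ^ 2 - 1815 * x - 3900) * (x ^ 2 + 3 * x + 9)
       - (- 621 * x ^ 4 - 1746 * x ^ 3 - 4551 * x ^ 2 + 6924 * x + 11344) * (2 * x + 3))
     + D * (- 621 * x ^ 4 - 1746 * x ^ 3 - 4551 * x ^ 2 + 6924 * x + 11344)"
proof -
  have "190000 = (1035 * x ^ 3 + 1530 * x ^ 2 - 1815 * x - 3900) *
        (x ^ 5 - 10 * x ^ 3 - t * x ^ 2 + (25 - 3 * t) * x + 24 - 9 * t)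
     + s * (- (1035 * x ^ 3 + 1530 * x ^ 2 - 1815 * x - 3900) * (x ^ 2 + 3 * x + 9)
       - (- 621 * x ^ 4 - 1746 * x ^ 3 - 4551 * x ^ 2 + 6924 * x + 11344) * (2 * x + 3))
     + D * (- 621 * x ^ 4 - 1746 * x ^ 3 - 4551 * x ^ 2 + 6924 * x + 11344)"
    unfolding s_def D_def by Groebner_Basis.algebra
  then show ?thesis unfolding assms(3) by simp
qed

text \<open>For \<open>T = 1 + 190 * k\<close> the element \<open>s\<close> is congruent to -1
  modulo 2 and modulo 5 and cannot lie in a prime above them. Modulo 19 it is nonconstant, and a
  Bezout identity between \<open>s\<close> and \<open>D\<close> is required.\<close>

lemma quintic_bezout_primes:
  fixes x k :: complex
  defines "s \<equiv> 10 * x ^ 3 - 30 * x - (1 + 190 * k)"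
    and "D \<equiv> 5 * x ^ 4 - 30 * x ^ 2 - 2 * (1 + 190 * k) * x + 25 - 3 * (1 + 190 * k)"
  shows "1 = s * (- 1) + 2 * (5 * x ^ 3 - 15 * x - 95 * k)"
    and "1 = s * (- 1) + 5 * (2 * x ^ 3 - 6 * x - 38 * k)"
    and "1 = s * (7 * x ^ 3 + 14 * x ^ 2 + 15 * x + 11) + D * (5 * x ^ 2 + 10 * x + 4)
      + 19 * (- 5 * x ^ 6 - 10 * x ^ 5 + 10 * x ^ 4 + 33 * x ^ 3 + 26 * x ^ 2 + 7 * x - 4
        + k * (170 * x ^ 3 + 490 * x ^ 2 + 530 * x + 230))"
  unfolding s_def D_def by Groebner_Basis.algebra+

context quintic_field
begin

context
  fixes P assumes P: "finite_prime K P"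
begin

lemma finite_primeD:
  shows "x \<in> P \<Longrightarrow> x \<in> ring_of_integers K" "0 \<in> P" "1 \<notin> P" "x \<in> P \<Longrightarrow> y \<in> P \<Longrightarrow> x + y \<in> P"
    "x \<in> P \<Longrightarrow> y \<in> ring_of_integers K \<Longrightarrow> x * y \<in> P"
    "x \<in> ring_of_integers K \<Longrightarrow> y \<in> ring_of_integers K \<Longrightarrow> x * y \<in> P \<Longrightarrow> x \<in> P \<or> y \<in> P"
proof -
  let ?R = "subring_of (ring_of_integers K)"
  have p: "primeideal P ?R" using P unfolding finite_prime_def by blast
  then interpret primeideal P ?R .
  note R = subring_of_def
  show "x \<in> P \<Longrightarrow> x \<in> ring_of_integers K" using a_subset unfolding R by auto
  show "0 \<in> P" using additive_subgroup.zero_closed[OF is_additive_subgroup] unfolding R by simp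
  show "1 \<notin> P" using one_imp_carrier I_notcarr unfolding R by auto
  show "x \<in> P \<Longrightarrow> y \<in> P \<Longrightarrow> x + y \<in> P" using additive_subgroup.a_closed[OF is_additive_subgroup] unfolding R by simp
  show "x \<in> P \<Longrightarrow> y \<in> ring_of_integers K \<Longrightarrow> x * y \<in> P" using I_r_closed unfolding R by simp
  show "x \<in> ring_of_integers K \<Longrightarrow> y \<in> ring_of_integers K \<Longrightarrow> x * y \<in> P \<Longrightarrow> x \<in> P \<or> y \<in> P"
    using I_prime unfolding R by simp
qed

lemma ring_of_integers_closed:
  "x \<in> ring_of_integers K \<Longrightarrow> y \<in> ring_of_integers K \<Longrightarrow> x + y \<in> ring_of_integers K"
  "x \<in> ring_of_integers K \<Longrightarrow> y \<in> ring_of_integers K \<Longrightarrow> x - y \<in> ring_of_integers K"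
  "x \<in> ring_of_integers K \<Longrightarrow> y \<in> ring_of_integers K \<Longrightarrow> x * y \<in> ring_of_integers K"
  "x \<in> ring_of_integers K \<Longrightarrow> - x \<in> ring_of_integers K"
  "x \<in> ring_of_integers K \<Longrightarrow> x ^ n \<in> ring_of_integers K"
  "numeral m \<in> ring_of_integers K" "1 \<in> ring_of_integers K" "of_int i \<in> ring_of_integers K"
  using subfieldD[OF subfield_K] subfield_power[OF subfield_K] subfield_of_int[OF subfield_K, of "numeral m"]
    subfield_of_int[OF subfield_K, of i] algebraic_int_of_int[of "numeral m"]
  unfolding ring_of_integers_def by (auto intro: algebraic_int_closed)

lemma finite_prime_minus: "x \<in> P \<Longrightarrow> - x \<in> P"
  using finite_primeD(5)[of x "- 1"] ring_of_integers_closed(4,7) by simp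

lemma finite_prime_prime_power:
  assumes "numeral m ^ n \<in> P"
  shows "(numeral m :: complex) \<in> P"
  using assms
proof (induction n)
  case 0
  then show ?case using finite_primeD(3) by simp
next
  case (Suc n)
  then show ?case using finite_primeD(6)[of "numeral m" "numeral m ^ n"] ring_of_integers_closed(5,6) by auto
qed

lemma no_triple_root:
  assumes ijk: "{i, j, k} \<subseteq> I5" "distinct [i, j, k]" and "r i - r j \<in> P" "r i - r k \<in> P"
  shows False
proof -
  have "card {i, j, k} = 3" using ijk(2) by simp
  then have "card (I5 - {i, j, k}) = 2" using ijk(1) by (simp add: card_Diff_subset)
  then obtain l m where lm: "I5 - {i, j, k} = {l, m}" "l \<noteq> m" by (auto simp: card_2_iff)
  then have I: "I5 = {i, j, k, l, m}" using ijk(1) by blast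
  have d: "distinct [i, j, k, l, m]" using ijk(2) lm by auto
  have fe: "of_int_poly (quintic T) = [:- r i, 1:] * [:- r j, 1:] * [:- r k, 1:] * [:- r l, 1:] * [:- r m, 1:]"
  proof -
    have n: "i \<notin> {j, k, l, m}" "j \<notin> {k, l, m}" "k \<notin> {l, m}" "l \<notin> {m}" "m \<notin> {}" using d by auto
    have "of_int_poly (quintic T) = [:- r i, 1:] * ([:- r j, 1:] * ([:- r k, 1:] * ([:- r l, 1:] * ([:- r m, 1:] * 1))))"
      unfolding factors I
      by (simp only: prod.insert[OF _ n(1)] prod.insert[OF _ n(2)] prod.insert[OF _ n(3)]
        prod.insert[OF _ n(4)] prod.insert[OF _ n(5)] finite.intros prod.empty)
    then show ?thesis by (simp only: mult.assoc mult_1_right)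
  qed
  define x where "x = r i"
  have rK: "r n \<in> ring_of_integers K" if "n \<in> I5" for n
    using that root_alg root_K unfolding ring_of_integers_def by blast
  have rO: "x \<in> ring_of_integers K" "r j \<in> ring_of_integers K" "r k \<in> ring_of_integers K"
     "r l \<in> ring_of_integers K" "r m \<in> ring_of_integers K"
    unfolding x_def by (rule rK, unfold I, blast)+
  note cl = ring_of_integers_closed rO
  define s where "s = 10 * x ^ 3 - 30 * x - of_int T"
  define D where "D = 5 * x ^ 4 - 30 * x ^ 2 - 2 * of_int T * x + 25 - 3 * of_int T"
  have s: "s \<in> P" unfolding s_def x_def quintic_derivatives_at_root(1)[OF fe]
    unfolding x_def[symmetric]
    by (intro finite_primeD(4) finite_primeD(5) assms(3,4)[folded x_def] cl)
  have D: "D \<in> P" unfolding D_def x_def quintic_derivatives_at_root(2)[OF fe]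
    unfolding x_def[symmetric]
    by (intro finite_primeD(5) assms(3,4)[folded x_def] cl)
  have "poly f x = 0" unfolding x_def by (rule root, unfold I, blast)
  then have z: "x ^ 5 - 10 * x ^ 3 - of_int T * x ^ 2 + (25 - 3 * of_int T) * x + 24 - 9 * of_int T = 0"
    unfolding poly_f_explicit .
  have "190000 \<in> P"
    unfolding quintic_bezout[OF z] unfolding s_def[symmetric] D_def[symmetric]
    by (intro finite_primeD(4) finite_primeD(5) s D cl)
  then have "2 ^ 4 * (5 ^ 4 * 19) \<in> P" by simp
  then have "2 ^ 4 \<in> P \<or> 5 ^ 4 * 19 \<in> P" by (intro finite_primeD(6) cl)
  moreover have "5 ^ 4 * 19 \<in> P \<Longrightarrow> 5 ^ 4 \<in> P \<or> 19 \<in> P" by (intro finite_primeD(6) cl)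
  ultimately consider "2 \<in> P" | "5 \<in> P" | "19 \<in> P" using finite_prime_prime_power by blast
  moreover obtain c where c: "T = 1 + 190 * c" by (rule T_eq)
  have sc: "s = 10 * x ^ 3 - 30 * x - (1 + 190 * of_int c)"
    and Dc: "D = 5 * x ^ 4 - 30 * x ^ 2 - 2 * (1 + 190 * of_int c) * x + 25 - 3 * (1 + 190 * of_int c)"
    unfolding s_def D_def c by simp_all
  note bz = quintic_bezout_primes[of x "of_int c", folded sc Dc]
  ultimately have "1 \<in> P"
  proof cases
    case 1
    show ?thesis by (subst bz(1)) (intro finite_primeD(4) finite_primeD(5) 1 s cl)
  next
    case 2
    show ?thesis by (subst bz(2)) (intro finite_primeD(4) finite_primeD(5) 2 s cl)
  next
    case 3
    show ?thesis by (subst bz(3)) (intro finite_primeD(4) finite_primeD(5) 3 s D cl)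
  qed
  then show False using finite_primeD(3) by simp
qed

lemma inertia_card:
  assumes "inertia_group K P \<noteq> {\<one>\<^bsub>Gal K\<^esub>}"
  shows "card (inertia_group K P) = 2"
proof -
  let ?e = "\<lambda>x\<in>K. x"
  let ?I = "inertia_group K P"
  have PK: "P \<subseteq> K" using finite_primeD(1) unfolding ring_of_integers_def by blast
  have "?e ` P = P" using PK by force
  then have eI: "?e \<in> ?I"
    unfolding inertia_group_def decomposition_group_def using Gal_id finite_primeD(2)
    by (auto simp: ring_of_integers_def)
  have IG: "?I \<subseteq> G" unfolding inertia_group_def decomposition_group_def by blast
  obtain \<sigma> where \<sigma>: "\<sigma> \<in> ?I" "\<sigma> \<noteq> ?e" using assms eI unfolding Gal_one by blast
  have nid: "perm \<tau> \<noteq> id" if "\<tau> \<in> ?I" "\<tau> \<noteq> ?e" for \<tau>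
    using that perm_inj Gal_id IG perm_one by (metis inj_onD subsetD)
  have E: "r (perm \<tau> i) - r i \<in> P" if "\<tau> \<in> ?I" "i \<in> I5" for \<tau> i
    using that perm_root(2)[of \<tau> i] IG root_K root_alg unfolding inertia_group_def ring_of_integers_def by auto
  have "\<tau> = \<sigma>" if \<tau>: "\<tau> \<in> ?I" "\<tau> \<noteq> ?e" for \<tau>
  proof -
    have st: "\<sigma> \<in> G" "\<tau> \<in> G" using \<sigma> \<tau> IG by auto
    have "perm \<tau> = perm \<sigma>"
    proof (rule even_class_preserving_unique[where E = "\<lambda>i j. r i - r j \<in> P"])
      show "perm \<tau> permutes I5" "evenperm (perm \<tau>)" "perm \<tau> \<noteq> id"
        "perm \<sigma> permutes I5" "evenperm (perm \<sigma>)" "perm \<sigma> \<noteq> id"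
        using perm_permutes perm_even st nid \<sigma> \<tau> by blast+
      show "r (perm \<tau> i) - r i \<in> P" "r (perm \<sigma> i) - r i \<in> P" if "i \<in> I5" for i using E \<sigma> \<tau> that by blast+
      show sym: "r j - r i \<in> P" if "r i - r j \<in> P" for i j using finite_prime_minus[OF that] by simp
      show "r i - r k \<in> P" if "r i - r j \<in> P" "r j - r k \<in> P" for i j k using finite_primeD(4)[OF that] by simp
      show False if "{i, j, k} \<subseteq> I5" "distinct [i, j, k]" "r i - r j \<in> P" "r j - r k \<in> P" for i j k
      proof (rule no_triple_root[of j i k])
        show "{j, i, k} \<subseteq> I5" "distinct [j, i, k]" using that by auto
        show "r j - r i \<in> P" "r j - r k \<in> P" using sym that by blast+
      qed
    qed
    then show ?thesis using perm_inj st by (auto dest: inj_onD)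
  qed
  then have "?I = {?e, \<sigma>}" using \<sigma> eI by blast
  then show ?thesis using \<sigma>(2) by simp
qed

end

text \<open>Modulo \<open>p\<close> the integer \<open>a\<close> is a double root; the products \<open>\<gamma> i\<close> of four of the differences \<open>a - r j\<close>
  have squares divisible by \<open>p\<close>, but not all of them are divisible by \<open>p\<close>.\<close>

lemma not_reduced_at_double_root:
  assumes p: "prime p" and fa: "poly (quintic T) a = int p * u" "\<not> int p dvd u"
    and fa': "int p dvd 5 * a ^ 4 - 30 * a ^ 2 - 2 * T * a + 25 - 3 * T"
  obtains x y where "x \<in> K" "algebraic_int x" "algebraic_int y" "x ^ 2 = of_nat p * y"
    "\<And>z. algebraic_int z \<Longrightarrow> x \<noteq> of_nat p * z"
proof -
  define \<beta> where "\<beta> i = of_int a - r i" for i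
  define \<gamma> where "\<gamma> i = (\<Prod>j\<in>I5 - {i}. \<beta> j)" for i
  have \<beta>A: "algebraic_int (\<beta> i)" if "i \<in> I5" for i
    unfolding \<beta>_def by (rule algebraic_int_diff[OF algebraic_int_of_int root_alg[OF that]])
  have \<beta>K: "\<beta> i \<in> K" if "i \<in> I5" for i
    unfolding \<beta>_def by (rule subfieldD(6)[OF subfield_K subfield_of_int[OF subfield_K] root_K[OF that]])
  have \<gamma>A: "algebraic_int (\<gamma> i)" for i unfolding \<gamma>_def by (rule algebraic_int_prod[OF \<beta>A]) simp
  have \<gamma>K: "\<gamma> i \<in> K" for i unfolding \<gamma>_def by (rule subfield_prod[OF subfield_K \<beta>K]) simp
  have all: "(\<Prod>i\<in>I5. \<beta> i) = of_nat p * of_int u"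
    using poly_f[of "of_int a"] fa(1) unfolding \<beta>_def poly_of_int_poly_of_int by simp
  obtain w where w: "5 * a ^ 4 - 30 * a ^ 2 - 2 * T * a + 25 - 3 * T = int p * w" using fa' by blast
  have sum: "(\<Sum>i\<in>I5. \<gamma> i) = of_nat p * of_int w"
  proof -
    have "(\<Sum>i\<in>I5. \<gamma> i) = of_int (5 * a ^ 4 - 30 * a ^ 2 - 2 * T * a + 25 - 3 * T)"
      using deriv_prod[of "of_int a"] deriv_explicit[of "of_int a"] unfolding \<gamma>_def \<beta>_def by simp
    then show ?thesis unfolding w by simp
  qed
  \<comment> \<open>For distinct \<open>i\<close> and \<open>j\<close> the product contains all five
    factors \<open>\<beta>\<close>, hence the value of the quintic at \<open>a\<close>.\<close>
  have mult: "\<exists>y. algebraic_int y \<and> \<gamma> i * \<gamma> j = of_nat p * y" if ij: "i \<in> I5" "j \<in> I5" "i \<noteq> j" for i j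
  proof -
    have "\<gamma> i = \<beta> j * (\<Prod>k\<in>I5 - {i} - {j}. \<beta> k)" unfolding \<gamma>_def by (rule prod.remove) (use ij in auto)
    moreover have "\<beta> j * \<gamma> j = of_nat p * of_int u" unfolding all[symmetric] \<gamma>_def
      by (rule prod.remove[symmetric]) (use ij in auto)
    ultimately have "\<gamma> i * \<gamma> j = of_nat p * (of_int u * (\<Prod>k\<in>I5 - {i} - {j}. \<beta> k))" by (simp add: mult_ac)
    moreover have "algebraic_int (of_int u * (\<Prod>k\<in>I5 - {i} - {j}. \<beta> k))"
      by (rule algebraic_int_mult[OF algebraic_int_of_int algebraic_int_prod[OF \<beta>A]]) simp
    ultimately show ?thesis by blast
  qed
  \<comment> \<open>The sum of all \<open>\<gamma> j\<close> is the derivative at \<open>a\<close>,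
    a multiple of \<open>p\<close>. Multiplied by \<open>\<gamma> i\<close> it becomes the square
    plus mixed terms already divisible by \<open>p\<close>.\<close>
  have sq: "\<exists>y. algebraic_int y \<and> \<gamma> i ^ 2 = of_nat p * y" if i: "i \<in> I5" for i
  proof -
    obtain Y where Y: "\<And>j. j \<in> I5 - {i} \<Longrightarrow> algebraic_int (Y j) \<and> \<gamma> i * \<gamma> j = of_nat p * Y j"
      using mult[OF i] by (metis DiffE singletonI)
    have "(\<Sum>j\<in>I5. \<gamma> i * \<gamma> j) = \<gamma> i ^ 2 + (\<Sum>j\<in>I5 - {i}. \<gamma> i * \<gamma> j)"
      using sum.remove[of I5 i "\<lambda>j. \<gamma> i * \<gamma> j"] i by (simp add: power2_eq_square)
    also have "(\<Sum>j\<in>I5 - {i}. \<gamma> i * \<gamma> j) = of_nat p * (\<Sum>j\<in>I5 - {i}. Y j)"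
      unfolding sum_distrib_left using Y by (intro sum.cong) auto
    finally have "\<gamma> i ^ 2 = (\<Sum>j\<in>I5. \<gamma> i * \<gamma> j) - of_nat p * (\<Sum>j\<in>I5 - {i}. Y j)" by simp
    also have "(\<Sum>j\<in>I5. \<gamma> i * \<gamma> j) = \<gamma> i * (of_nat p * of_int w)" unfolding sum[symmetric] by (simp add: sum_distrib_left)
    finally have "\<gamma> i ^ 2 = of_nat p * (\<gamma> i * of_int w - (\<Sum>j\<in>I5 - {i}. Y j))" by (simp add: algebra_simps)
    moreover have "algebraic_int (\<gamma> i * of_int w - (\<Sum>j\<in>I5 - {i}. Y j))"
      using Y by (intro algebraic_int_closed \<gamma>A) blast
    ultimately show ?thesis by blast
  qed
  \<comment> \<open>The product of all \<open>\<gamma> i\<close> is the fourth power of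
    \<open>p * u\<close>. If \<open>p\<close> divided every \<open>\<gamma> i\<close>, it would be
    divisible by \<open>p ^ 5\<close>, contrary to the single factor \<open>p\<close> in the value
    at \<open>a\<close>.\<close>
  have "\<exists>i\<in>I5. \<forall>z. algebraic_int z \<longrightarrow> \<gamma> i \<noteq> of_nat p * z"
  proof (rule ccontr)
    assume "\<not> ?thesis"
    then obtain Z where Z: "\<And>i. i \<in> I5 \<Longrightarrow> algebraic_int (Z i) \<and> \<gamma> i = of_nat p * Z i" by metis
    have "(\<Prod>i\<in>I5. \<beta> i) * (\<Prod>i\<in>I5. \<gamma> i) = (\<Prod>i\<in>I5. \<beta> i * \<gamma> i)" by (simp add: prod.distrib)
    also have "\<dots> = (\<Prod>i\<in>I5. of_nat p * of_int u)"
      unfolding all[symmetric] \<gamma>_def by (intro prod.cong refl prod.remove[symmetric]) auto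
    also have "\<dots> = (of_nat p * of_int u) ^ 5" by simp
    also have "\<dots> = (of_nat p * of_int u) * (of_nat p * of_int u) ^ 4" by (simp add: numeral_eq_Suc)
    finally have e: "(of_nat p * of_int u) * (\<Prod>i\<in>I5. \<gamma> i) = (of_nat p * of_int u) * (of_nat p * of_int u) ^ 4"
      unfolding all .
    have p0: "p \<noteq> 0" and u0: "u \<noteq> 0" using p fa(2) by auto
    then have "(\<Prod>i\<in>I5. \<gamma> i) = (of_nat p * of_int u) ^ 4" using e by simp
    moreover have "(\<Prod>i\<in>I5. \<gamma> i) = (\<Prod>i\<in>I5. of_nat p * Z i)" using Z by (intro prod.cong refl) blast
    then have "(\<Prod>i\<in>I5. \<gamma> i) = of_nat p ^ 5 * (\<Prod>i\<in>I5. Z i)" by (simp add: prod.distrib)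
    ultimately have e2: "of_nat p ^ 5 * (\<Prod>i\<in>I5. Z i) = (of_nat p * of_int u) ^ 4" by simp
    define w where "w = (\<Prod>i\<in>I5. Z i)"
    have "of_nat p ^ 4 * (of_nat p * w) = of_nat p ^ 4 * of_int u ^ 4"
      using e2[folded w_def] by Groebner_Basis.algebra
    then have "of_nat p * (\<Prod>i\<in>I5. Z i) = of_int (u ^ 4)" using p0 unfolding w_def[symmetric] by simp
    moreover have ZA: "algebraic_int (\<Prod>i\<in>I5. Z i)" by (rule algebraic_int_prod) (use Z in blast)
    obtain P where P: "alg_prime P" "of_nat p \<in> P" using alg_prime_exists[OF p] .
    ultimately have "of_int (u ^ 4) \<in> P" using alg_prime_mult[OF P ZA] by metis
    then have "int p dvd u ^ 4" using alg_prime_of_int[OF P(1) p P(2)] by blast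
    then show False using fa(2) p by (meson prime_dvd_power prime_nat_int_transfer)
  qed
  then obtain i where i: "i \<in> I5" "\<And>z. algebraic_int z \<Longrightarrow> \<gamma> i \<noteq> of_nat p * z" by blast
  obtain y where y: "algebraic_int y" "\<gamma> i ^ 2 = of_nat p * y" using sq[OF i(1)] by blast
  show ?thesis by (rule that[OF \<gamma>K \<gamma>A y i(2)])
qed

end

section \<open>Infinitely many splitting fields\<close>

text \<open>The polynomial \<open>W = f\<^sub>T' g - f\<^sub>T g'\<close> does not depend on \<open>T\<close>. As \<open>W(0) = 153\<close>, its value at
  \<open>a = 153 M\<close> is 153 times a number congruent to 1 modulo \<open>M\<close>, so Euclid's argument yields primes \<open>p > B\<close>
  dividing \<open>W(a)\<close>. The congruence \<open>F(a) - T g(a) \<equiv> p\<close> modulo \<open>p\<^sup>2\<close> is solvable for \<open>T\<close>, because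
  \<open>57\<^sup>3\<close> is a combination of \<open>W\<close> and \<open>g\<close>.\<close>

lemma ramified_specialization:
  fixes B :: nat
  assumes B: "190 \<le> B"
  obtains p :: nat and a T u :: int where "prime p" "p > B" "T mod 190 = 1"
    "poly (quintic T) a = int p * u" "\<not> int p dvd u"
    "int p dvd 5 * a ^ 4 - 30 * a ^ 2 - 2 * T * a + 25 - 3 * T"
proof -
  define M :: int where "M = fact B"
  define a where "a = 153 * M"
  define W where "W = 3 * a ^ 6 + 12 * a ^ 5 + 35 * a ^ 4 - 60 * a ^ 3 - 295 * a ^ 2 - 48 * a + 153"
  define g where "g = a ^ 2 + 3 * a + 9"
  define F where "F = a ^ 5 - 10 * a ^ 3 + 25 * a + 24"
  have "M \<ge> 190"
  proof -
    have "M \<ge> int B" unfolding M_def by (metis fact_ge_self of_nat_fact of_nat_le_iff)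
    then show ?thesis using B by simp
  qed
  \<comment> \<open>A crude bound, large enough to make the cofactor of \<open>M\<close> positive,
    so that \<open>Y\<close> exceeds 1 and has a prime factor.\<close>
  have a1: "a \<ge> 1000" unfolding a_def using \<open>M \<ge> 190\<close> by simp
  have WZ: "W = 153 * (1 + M * (a * (3 * a ^ 4 + 12 * a ^ 3 + 35 * a ^ 2 - 60 * a - 295) - 48))"
    unfolding W_def a_def by Groebner_Basis.algebra
  define Y where "Y = 1 + M * (a * (3 * a ^ 4 + 12 * a ^ 3 + 35 * a ^ 2 - 60 * a - 295) - 48)"
  have "35 * a ^ 2 - 60 * a - 295 \<ge> 1"
  proof -
    have "a * 1000 \<le> a * a" using a1 by (intro mult_left_mono) auto
    then show ?thesis using a1 unfolding power2_eq_square by linarith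
  qed
  moreover have "3 * a ^ 4 \<ge> 0" "12 * a ^ 3 \<ge> 0" using a1 by auto
  ultimately have "3 * a ^ 4 + 12 * a ^ 3 + 35 * a ^ 2 - 60 * a - 295 \<ge> 1" by linarith
  then have "a * 1 \<le> a * (3 * a ^ 4 + 12 * a ^ 3 + 35 * a ^ 2 - 60 * a - 295)" using a1 by (intro mult_left_mono) auto
  then have "M * 1 \<le> M * (a * (3 * a ^ 4 + 12 * a ^ 3 + 35 * a ^ 2 - 60 * a - 295) - 48)"
    using a1 \<open>M \<ge> 190\<close> by (intro mult_left_mono) linarith+
  then have "Y > 1" unfolding Y_def using \<open>M \<ge> 190\<close> by linarith
  then obtain p where p: "prime p" "int p dvd Y"
    using prime_factor_nat[of "nat Y"] by (auto simp: nat_dvd_iff int_dvd_int_iff[symmetric] nat_eq_iff)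
  have pB: "p > B"
  proof (rule ccontr)
    assume "\<not> B < p"
    then have "int p dvd M" unfolding M_def using p(1) dvd_fact[of p B]
      by (metis int_dvd_int_iff not_less of_nat_fact prime_ge_1_nat)
    then have "int p dvd 1" using p(2) unfolding Y_def by (simp add: dvd_add_left_iff)
    then show False using p(1) by (metis int_dvd_int_iff of_nat_1 not_prime_unit)
  qed
  have pW: "int p dvd W" unfolding WZ Y_def[symmetric] using p(2) by simp
  have pi: "prime (int p)" using p(1) by simp
  \<comment> \<open>As \<open>p\<close> exceeds 190, this makes it prime to 190, which leaves
    \<open>T\<close> free modulo 190, and to 57, the base of the constant for \<open>W\<close> and
    \<open>g\<close>.\<close>
  have small: "\<not> int p dvd n" if "0 < n" "n \<le> 190" for n
    using zdvd_imp_le[of "int p" n] that pB B by linarith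
  have pg: "\<not> int p dvd g"
  proof
    assume "int p dvd g"
    moreover have "57 ^ 3 = (- 73 - 30 * a) * W
        + (21818 - 7152 * a - 2593 * a ^ 2 + 189 * a ^ 3 + 309 * a ^ 4 + 90 * a ^ 5) * g"
      unfolding W_def g_def by Groebner_Basis.algebra
    ultimately have "int p dvd 57 ^ 3" using pW by (metis dvd_add dvd_mult)
    then have "int p dvd 57" using pi prime_dvd_power by blast
    then show False using small[of 57] by simp
  qed
  have "coprime (int p) (190 * g)"
    using pi pg small[of 190] by (intro prime_imp_coprime) (auto simp: prime_dvd_mult_iff)
  then have "coprime (190 * g) (int p ^ 2)" by (simp add: coprime_commute)
  then obtain x y where xy: "x * (190 * g) + y * int p ^ 2 = 1"
    using bezout_int[of "190 * g" "int p ^ 2"] by (metis coprime_iff_gcd_eq_1)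
  \<comment> \<open>\<open>x\<close> inverts \<open>190 * g\<close> modulo \<open>p ^ 2\<close>.
    Hence \<open>T * g\<close> is congruent to \<open>F - p\<close> modulo \<open>p ^ 2\<close>
    while \<open>T\<close> keeps its residue modulo 190, and \<open>m\<close> is the resulting
    quotient.\<close>
  define m where "m = y * (F - int p - g)"
  define T where "T = 1 + 190 * (x * (F - int p - g))"
  have fa: "poly (quintic T) a = F - T * g"
    unfolding quintic_def F_def g_def by simp Groebner_Basis.algebra
  also have "\<dots> = int p * (1 + int p * m)"
    using xy unfolding T_def m_def by Groebner_Basis.algebra
  finally have f1: "poly (quintic T) a = int p * (1 + int p * m)" .
  have "\<not> int p dvd 1 + int p * m"
    using small[of 1] by (simp add: dvd_add_left_iff)
  moreover have "int p dvd 5 * a ^ 4 - 30 * a ^ 2 - 2 * T * a + 25 - 3 * T"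
  proof -
    \<comment> \<open>Multiplied by \<open>g\<close>, which is prime to \<open>p\<close>, the
      derivative becomes \<open>W\<close> plus a multiple of the value of the quintic.\<close>
    have "g * (5 * a ^ 4 - 30 * a ^ 2 - 2 * T * a + 25 - 3 * T) = W + (2 * a + 3) * (F - T * g)"
      unfolding W_def g_def F_def by Groebner_Basis.algebra
    also have "int p dvd \<dots>" using pW f1 fa by (metis dvd_add dvd_mult dvd_triv_left)
    finally show ?thesis using pg pi prime_dvd_multD by blast
  qed
  moreover have "T mod 190 = 1" unfolding T_def by simp
  ultimately show ?thesis using that[OF p(1) pB _ f1] by blast
qed

lemma quintic_field_exists:
  assumes "T mod 190 = 1"
  obtains r K where "quintic_field T r K"
proof -
  let ?f = "of_int_poly (quintic T) :: complex poly"
  have deg: "degree ?f = 5" and lead: "lead_coeff ?f = 1"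
    unfolding quintic_def by simp_all
  obtain as where as: "smult (lead_coeff ?f) (\<Prod>a\<leftarrow>as. [:- a, 1:]) = ?f" "length as = degree ?f"
    using fundamental_theorem_algebra_factorized by blast
  define r where "r i = as ! (i - 1)" for i
  have "?f = (\<Prod>i\<in>I5. [:- r i, 1:])"
  proof -
    have "?f = (\<Prod>i = 0..<5. [:- (as ! i), 1:])" using as lead deg by (simp add: prod.list_conv_set_nth)
    also have "\<dots> = (\<Prod>i = Suc 0..<Suc 5. [:- r i, 1:])" unfolding prod.shift_bounds_Suc_ivl r_def by simp
    finally show ?thesis unfolding atLeastLessThanSuc_atLeastAtMost by simp
  qed
  then have "quintic_field T r (CC.finite_extension \<rat> (map r [1..<6]))"
    by (intro quintic_field.intro assms refl)
  then show ?thesis by (rule that)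
qed

theorem theorem3p1:
  shows "infinite {K :: complex set.
    finite_galois_ext K \<and> Gal K \<cong> alt_group 5 \<and>
    (\<forall>P. finite_prime K P \<longrightarrow> inertia_group K P \<noteq> {\<one>\<^bsub>Gal K\<^esub>} \<longrightarrow>
      card (inertia_group K P) = 2)}"
    (is "infinite ?S")
proof -
  define F where "F = {K. \<exists>T r. quintic_field T r K}"
  have "F \<subseteq> ?S"
    unfolding F_def
  proof clarify
    fix K T r assume "quintic_field T r K"
    then interpret quintic_field T r K .
    show "finite_galois_ext K \<and> Gal K \<cong> alt_group 5 \<and>
      (\<forall>P. finite_prime K P \<longrightarrow> inertia_group K P \<noteq> {\<one>\<^bsub>Gal K\<^esub>} \<longrightarrow> card (inertia_group K P) = 2)"
      using finite_galois_ext_K Gal_iso_alt inertia_card by blast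
  qed
  moreover have "infinite F"
  proof
    assume fin: "finite F"
    have "\<exists>N :: int. N \<noteq> 0 \<and> (\<forall>p x y. prime p \<longrightarrow> \<not> int p dvd N \<longrightarrow> x \<in> K \<longrightarrow> algebraic_int x \<longrightarrow>
        algebraic_int y \<longrightarrow> x ^ 2 = of_nat p * y \<longrightarrow> (\<exists>z. algebraic_int z \<and> x = of_nat p * z))" if "K \<in> F" for K
    proof -
      obtain T r where "quintic_field T r K" using \<open>K \<in> F\<close> unfolding F_def by blast
      then interpret quintic_field T r K .
      have "algebraic_int x" if "x \<in> set (map r [1..<6])" for x
        using that root_alg unfolding roots_image by blast
      then obtain N :: int where "N \<noteq> 0" "\<And>p x y. prime p \<Longrightarrow> \<not> int p dvd N \<Longrightarrow> x \<in> K \<Longrightarrow> algebraic_int x \<Longrightarrow>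
          algebraic_int y \<Longrightarrow> x ^ 2 = of_nat p * y \<Longrightarrow> \<exists>z. algebraic_int z \<and> x = of_nat p * z"
        using reduced_almost_everywhere by blast
      then show ?thesis by (intro exI[of _ N]) blast
    qed
    then obtain N :: "complex set \<Rightarrow> int" where N: "\<And>K. K \<in> F \<Longrightarrow> N K \<noteq> 0"
      "\<And>K p x y. K \<in> F \<Longrightarrow> prime p \<Longrightarrow> \<not> int p dvd N K \<Longrightarrow> x \<in> K \<Longrightarrow> algebraic_int x \<Longrightarrow>
          algebraic_int y \<Longrightarrow> x ^ 2 = of_nat p * y \<Longrightarrow> \<exists>z. algebraic_int z \<and> x = of_nat p * z"
      by metis
    \<comment> \<open>A prime above \<open>B\<close> divides none of the finitely many nonzero
      exceptional numbers \<open>N K\<close>, yet it violates the conclusion of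
      \<open>reduced_almost_everywhere\<close> for the field constructed from it.\<close>
    define B where "B = 190 + (\<Sum>K\<in>F. nat \<bar>N K\<bar>)"
    obtain p a T u where pa: "prime p" "p > B" "T mod 190 = 1" "poly (quintic T) a = int p * u" "\<not> int p dvd u"
        "int p dvd 5 * a ^ 4 - 30 * a ^ 2 - 2 * T * a + 25 - 3 * T"
      by (rule ramified_specialization[of B]) (simp add: B_def)
    obtain r K where K: "quintic_field T r K" using quintic_field_exists[OF pa(3)] .
    interpret quintic_field T r K by (rule K)
    have KF: "K \<in> F" using K unfolding F_def by blast
    have "nat \<bar>N K\<bar> \<le> B" unfolding B_def using member_le_sum[OF KF _ fin, of "\<lambda>K. nat \<bar>N K\<bar>"] by simp
    then have "\<bar>N K\<bar> < int p" using pa(2) by linarith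
    then have "\<not> int p dvd N K" using dvd_imp_le_int[of "N K" "int p"] N(1)[OF KF] by auto
    moreover obtain x y where "x \<in> K" "algebraic_int x" "algebraic_int y" "x ^ 2 = of_nat p * y"
       "\<And>z. algebraic_int z \<Longrightarrow> x \<noteq> of_nat p * z"
      by (rule not_reduced_at_double_root[OF pa(1,4-6)]) blast
    ultimately show False using N(2)[OF KF pa(1)] by blast
  qed
  ultimately show ?thesis by (rule infinite_super)
qed

end
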